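(* Let $k$ be a field of odd characteristic $p$ and let $G$ and $H$ be finite $p$-groups such that the group algebras $kG$ and $kH$ are isomorphic as $k$-algebras. If the commutator subgroup $G'$ is cyclic, then: (1) ${\rm C}_G(G')$ and ${\rm C}_H(H')$ have the same exponent; (2) ${\rm C}_G(G')/G'\cong {\rm C}_H(H')/H'$; (3) ${\rm C}_G(G')/{\rm C}_G(G')'\cong {\rm C}_H(H')/{\rm C}_H(H')'$.
   Context: $G'$ denotes the commutator subgroup of $G$ and ${\rm C}_G(X)$ the centralizer in $G$ of a subset $X$; ${\rm C}_G(G')'$ is the commutator subgroup of ${\rm C}_G(G')$. *)

theory Defs
  imports "HOL-Algebra.Algebra"
begin

abbreviation commutator_subgroup :: "('a, 'b) monoid_scheme \<Rightarrow> 'a set" where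
  "commutator_subgroup G \<equiv> derived G (carrier G)"

definition centralizer :: "('a, 'b) monoid_scheme \<Rightarrow> 'a set \<Rightarrow> 'a set" where
  "centralizer G S = {g \<in> carrier G. \<forall>x\<in>S. g \<otimes>\<^bsub>G\<^esub> x = x \<otimes>\<^bsub>G\<^esub> g}"

definition cent_comm_group :: "('a, 'b) monoid_scheme \<Rightarrow> ('a, 'b) monoid_scheme" where
  "cent_comm_group G = G\<lparr>carrier := centralizer G (commutator_subgroup G)\<rparr>"

definition finite_p_group :: "nat \<Rightarrow> ('a, 'b) monoid_scheme \<Rightarrow> bool" where
  "finite_p_group p G \<longleftrightarrow> group G \<and> finite (carrier G) \<and> (\<exists>n. order G = p ^ n)"

definition cyclic_subgroup :: "('a, 'b) monoid_scheme \<Rightarrow> 'a set \<Rightarrow> bool" where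
  "cyclic_subgroup G S \<longleftrightarrow> (\<exists>a\<in>carrier G. S = generate G {a})"

definition group_exponent :: "('a, 'b) monoid_scheme \<Rightarrow> nat" where
  "group_exponent G = (LEAST n. 0 < n \<and> (\<forall>x\<in>carrier G. x [^]\<^bsub>G\<^esub> n = \<one>\<^bsub>G\<^esub>))"

(* Group algebra kG of a finite group G over a field 'k: functions G -> k
   (zero outside the carrier), pointwise addition and scalar multiplication,
   convolution product. *)
definition ga_carrier :: "('a, 'b) monoid_scheme \<Rightarrow> ('a \<Rightarrow> 'k::field) set" where
  "ga_carrier G = {f. \<forall>x. x \<notin> carrier G \<longrightarrow> f x = 0}"

definition ga_mult :: "('a, 'b) monoid_scheme \<Rightarrow> ('a \<Rightarrow> 'k::field) \<Rightarrow> ('a \<Rightarrow> 'k) \<Rightarrow> ('a \<Rightarrow> 'k)" where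
  "ga_mult G f g = (\<lambda>x. if x \<in> carrier G
      then (\<Sum>y\<in>carrier G. f y * g (inv\<^bsub>G\<^esub> y \<otimes>\<^bsub>G\<^esub> x)) else 0)"

definition ga_one :: "('a, 'b) monoid_scheme \<Rightarrow> ('a \<Rightarrow> 'k::field)" where
  "ga_one G = (\<lambda>x. if x = \<one>\<^bsub>G\<^esub> then 1 else 0)"

definition ga_smult :: "'k::field \<Rightarrow> ('a \<Rightarrow> 'k) \<Rightarrow> ('a \<Rightarrow> 'k)" where
  "ga_smult c f = (\<lambda>x. c * f x)"

definition ga_iso :: "('a, 'b) monoid_scheme \<Rightarrow> ('c, 'd) monoid_scheme
    \<Rightarrow> (('a \<Rightarrow> 'k::field) \<Rightarrow> ('c \<Rightarrow> 'k)) \<Rightarrow> bool" where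
  "ga_iso G H \<phi> \<longleftrightarrow>
     bij_betw \<phi> (ga_carrier G) (ga_carrier H) \<and>
     (\<forall>f\<in>ga_carrier G. \<forall>g\<in>ga_carrier G. \<phi> (\<lambda>x. f x + g x) = (\<lambda>y. \<phi> f y + \<phi> g y)) \<and>
     (\<forall>c. \<forall>f\<in>ga_carrier G. \<phi> (ga_smult c f) = ga_smult c (\<phi> f)) \<and>
     (\<forall>f\<in>ga_carrier G. \<forall>g\<in>ga_carrier G. \<phi> (ga_mult G f g) = ga_mult H (\<phi> f) (\<phi> g)) \<and>
     \<phi> (ga_one G) = ga_one H"

definition group_algebras_isomorphic :: "'k::field itself \<Rightarrow> ('a, 'b) monoid_scheme
    \<Rightarrow> ('c, 'd) monoid_scheme \<Rightarrow> bool" where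
  "group_algebras_isomorphic (_ :: 'k itself) G H \<longleftrightarrow>
     (\<exists>\<phi> :: ('a \<Rightarrow> 'k) \<Rightarrow> ('c \<Rightarrow> 'k). ga_iso G H \<phi>)"

end

theory Submission
  imports Defs
begin

text \<open>
  Let \<open>G'\<close> be cyclic of order \<open>p ^ n\<close>. Instead of ideals of the group algebra we transport linear functionals:
  a normal subgroup \<open>N\<close> of \<open>G\<close> and a normal subgroup \<open>N'\<close> of \<open>H\<close> correspond if the functionals constant on the
  cosets of \<open>N'\<close> pull back to functionals constant on the cosets of \<open>N\<close>, and then \<open>N\<close> and \<open>N'\<close> have equal order
  by a dimension count.

  The subgroup \<open>G'\<close> corresponds to \<open>H'\<close> because constancy on its cosets means \<open>\<tau> (x y u) = \<tau> (y x u)\<close>;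
  \<open>Z(G) G'\<close> corresponds because a central element of \<open>kG\<close> acts on such functionals through its
  coefficients on \<open>Z(G)\<close>, the other classes having length divisible by \<open>p\<close>. The number of generators of \<open>G'\<close>
  is visible in the square of the augmentation ideal of \<open>G'\<close>, so \<open>H'\<close> is cyclic too, and the \<open>p ^ m\<close>-th power of that
  ideal determines the subgroup \<open>M m\<close> of \<open>p ^ m\<close>-th powers in \<open>G'\<close>.
  For a trace \<open>\<tau>\<close> one has \<open>\<tau> (y ^ P) = \<Sum>g. y g ^ P * \<tau> (g ^ P)\<close> with \<open>P = p ^ k\<close>; hence if \<open>x \<mapsto> x ^ P\<close> is
  a homomorphism with central image modulo corresponding subgroups \<open>N\<close> and \<open>N'\<close>, the preimages of \<open>N\<close> and \<open>N'\<close>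
  under this map correspond. This applies to \<open>N = Z(G) G'\<close> and \<open>P = p ^ e\<close>, the order of the intersection of \<open>Z(G)\<close> with
  \<open>G'\<close>, where the preimage is the centralizer \<open>C\<close> of \<open>G'\<close>, and to \<open>N = M m\<close> for \<open>m \<le> k\<close>.

  Consequently the number of \<open>x\<close> in \<open>C\<close> with \<open>x ^ (p ^ k)\<close> in \<open>M m\<close> is an invariant for \<open>m \<le> k\<close>.
  For \<open>m \<ge> n\<close> this gives the exponent of \<open>C\<close>; for \<open>m = 0\<close>, and for \<open>m = n - e\<close> where \<open>M m\<close> is the commutator
  subgroup of \<open>C\<close>, it gives the torsion counts of the two abelian quotients, which determine
  a finite abelian \<open>p\<close>-group.
\<close>

section \<open>Linear systems and sums over fixed points\<close>

text \<open>Functionals make quotient algebras unnecessary, but pulling back gives only one half of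
  a correspondence, hence an inequality between orders; the other half comes from the inverse
  isomorphism. Products of corresponding subgroups correspond again. Intersections are not
  transported; their orders are recovered from the product formula. The constant \<open>e\<close>
  has two faces. The group acts on \<open>G'\<close> through a cyclic group of order
  \<open>p ^ (n - e)\<close>, generated by an exponent \<open>1 + p ^ e * t\<close>, and
  \<open>p ^ e\<close> is the order of the intersection of \<open>Z(G)\<close> with
  \<open>G'\<close>. The second description makes \<open>e\<close> an invariant, because the orders
  of \<open>Z(G)\<close>, \<open>G'\<close> and \<open>Z(G) G'\<close> are. Oddness of
  \<open>p\<close> makes the group of exponents cyclic and makes \<open>p\<close> divide 1 + ... +
  (p - 1), which turns \<open>x \<mapsto> x ^ (p ^ k)\<close> into a homomorphism modulo
  \<open>M m\<close> for \<open>m \<le> k\<close>. This bound on \<open>m\<close> is the obstacle: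
  the abelianization of \<open>C\<close> needs \<open>m = n - e\<close> for smaller \<open>k\<close>
  as well, and there the count is reduced to the case \<open>m = k\<close>.\<close>

lemma homogeneous_system_nontrivial:
  fixes A :: "'i \<Rightarrow> 'j \<Rightarrow> 'k::field"
  assumes "finite I" "finite J" "card I < card J"
  shows "\<exists>c. (\<exists>j\<in>J. c j \<noteq> 0) \<and> (\<forall>i\<in>I. (\<Sum>j\<in>J. A i j * c j) = 0)"
  using assms
proof (induction I arbitrary: J A rule: finite_induct)
  case empty
  then have "J \<noteq> {}" by auto
  then show ?case by (intro exI[of _ "\<lambda>_. 1"]) auto
next
  case (insert i0 I)
  show ?case
  proof (cases "\<forall>j\<in>J. A i0 j = 0")
    case True
    have "card I < card J" using insert by simp
    from insert.IH[OF \<open>finite J\<close> this, of A] True show ?thesis by auto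
  next
    case False
    then obtain j0 where j0: "j0 \<in> J" "A i0 j0 \<noteq> 0" by auto
    define J' where "J' = J - {j0}"
    have fin: "finite J'" "J = insert j0 J'" "j0 \<notin> J'" using j0 insert.prems by (auto simp: J'_def)
    have "card I < card J'" using insert fin by simp
    \<comment> \<open>Gaussian elimination: a multiple of row \<open>i0\<close> is subtracted so
      that column \<open>j0\<close> vanishes; \<open>d\<close> then solves row \<open>i0\<close> for
      its entry at \<open>j0\<close>.\<close>
    from insert.IH[OF fin(1) this, of "\<lambda>i j. A i j - A i j0 * A i0 j / A i0 j0"]
    obtain c where c: "\<exists>j\<in>J'. c j \<noteq> 0"
      "\<And>i. i \<in> I \<Longrightarrow> (\<Sum>j\<in>J'. (A i j - A i j0 * A i0 j / A i0 j0) * c j) = 0" by auto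
    define s where "s = (\<Sum>j\<in>J'. A i0 j * c j)"
    define d where "d = c(j0 := - s / A i0 j0)"
    have dJ: "(\<Sum>j\<in>J'. A i j * d j) = (\<Sum>j\<in>J'. A i j * c j)" for i
      by (rule sum.cong) (use fin in \<open>auto simp: d_def\<close>)
    have tot: "(\<Sum>j\<in>J. A i j * d j) = - A i j0 * s / A i0 j0 + (\<Sum>j\<in>J'. A i j * c j)" for i
      using fin dJ[of i] by (simp add: d_def)
    have "(\<Sum>j\<in>J. A i j * d j) = 0" if "i \<in> I" for i
    proof -
      have "(\<Sum>j\<in>J'. (A i j - A i j0 * A i0 j / A i0 j0) * c j)
        = (\<Sum>j\<in>J'. A i j * c j) - A i j0 / A i0 j0 * s"
        unfolding s_def sum_distrib_left sum_subtractf[symmetric]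
        by (rule sum.cong) (auto simp: algebra_simps)
      then show ?thesis using c(2)[OF that] tot[of i] by simp
    qed
    moreover have "(\<Sum>j\<in>J. A i0 j * d j) = 0"
      using tot[of i0] j0 by (simp add: s_def)
    moreover have "\<exists>j\<in>J. d j \<noteq> 0" using c(1) fin by (auto simp: d_def)
    ultimately show ?thesis by (intro exI[of _ d]) auto
  qed
qed

text \<open>Every orbit has length a power of \<open>p\<close>. On a nontrivial orbit the invariant
  \<open>w\<close> contributes a multiple of \<open>p\<close>, which is zero in the field, so only
  fixed points survive. With \<open>w = 1\<close> this counts fixed points modulo
  \<open>p\<close>.\<close>

lemma sum_fixed_points_p_group:
  fixes w :: "'e \<Rightarrow> 'k::field" and \<Gamma> (structure)
  assumes "group \<Gamma>" "order \<Gamma> = p ^ N" "Factorial_Ring.prime p" "CHAR('k) = p" "finite E"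
    and cl: "\<And>g x. g \<in> carrier \<Gamma> \<Longrightarrow> x \<in> E \<Longrightarrow> act g x \<in> E"
    and a1: "\<And>x. x \<in> E \<Longrightarrow> act \<one> x = x"
    and am: "\<And>g h x. g \<in> carrier \<Gamma> \<Longrightarrow> h \<in> carrier \<Gamma> \<Longrightarrow> x \<in> E \<Longrightarrow> act (g \<otimes> h) x = act g (act h x)"
    and inv: "\<And>g x. g \<in> carrier \<Gamma> \<Longrightarrow> x \<in> E \<Longrightarrow> w (act g x) = w x"
  shows "(\<Sum>x\<in>E. w x) = (\<Sum>x | x \<in> E \<and> (\<forall>g\<in>carrier \<Gamma>. act g x = x). w x)"
proof -
  interpret group \<Gamma> by fact
  define R where "R = {(x, y). x \<in> E \<and> (\<exists>g\<in>carrier \<Gamma>. y = act g x)}"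
  define F where "F = {x \<in> E. \<forall>g\<in>carrier \<Gamma>. act g x = x}"
  have fin\<Gamma>: "finite (carrier \<Gamma>)" using assms(2,3)
    by (metis card.infinite order_def power_not_zero not_prime_0)
  have eq: "equiv E R"
  proof (rule equivI)
    show "R \<subseteq> E \<times> E" using cl by (auto simp: R_def)
    show "refl_on E R" using cl a1 by (auto simp: refl_on_def R_def intro!: bexI[of _ "\<one>"])
    show "sym R"
    proof (rule symI)
      fix x y assume "(x, y) \<in> R"
      then obtain g where g: "x \<in> E" "g \<in> carrier \<Gamma>" "y = act g x" by (auto simp: R_def)
      then have "act (inv g) y = x" using am[of "inv g" g x] a1 by simp
      then show "(y, x) \<in> R" using g cl by (auto simp: R_def intro!: bexI[of _ "inv g"])
    qed
    show "trans R"
    proof (rule transI)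
      fix x y z assume "(x, y) \<in> R" "(y, z) \<in> R"
      then obtain g h where g: "x \<in> E" "g \<in> carrier \<Gamma>" "y = act g x" "h \<in> carrier \<Gamma>" "z = act h y"
        by (auto simp: R_def)
      then show "(x, z) \<in> R" using am[of h g x] by (auto simp: R_def intro!: bexI[of _ "h \<otimes> g"])
    qed
  qed
  have orb: "card (R `` {x}) dvd p ^ N" if x: "x \<in> E" for x
  proof -
    \<comment> \<open>\<open>S y\<close> is the fibre of \<open>g \<mapsto> act g x\<close> over
      \<open>y\<close>. Translations identify all these fibres, so the orbit length divides the
      group order.\<close>
    define S where "S = (\<lambda>y. {g \<in> carrier \<Gamma>. act g x = y})"
    have "card (S (act h x)) = card (S x)" if h: "h \<in> carrier \<Gamma>" for h
    proof -
      have "bij_betw (\<lambda>g. h \<otimes> g) (S x) (S (act h x))"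
      proof (rule bij_betwI[where g = "\<lambda>g. inv h \<otimes> g"])
        show "(\<lambda>g. h \<otimes> g) \<in> S x \<rightarrow> S (act h x)" using h x am by (auto simp: S_def)
        show "(\<lambda>g. inv h \<otimes> g) \<in> S (act h x) \<rightarrow> S x"
        proof
          fix g assume "g \<in> S (act h x)"
          then have g: "g \<in> carrier \<Gamma>" "act g x = act h x" by (auto simp: S_def)
          have "act (inv h \<otimes> g) x = act (inv h) (act h x)" using g h x am by simp
          also have "\<dots> = x" using am[of "inv h" h x] h x a1 by simp
          finally show "inv h \<otimes> g \<in> S x" using g h by (auto simp: S_def)
        qed
      qed (use h in \<open>auto simp: S_def m_assoc[symmetric]\<close>)
      then show ?thesis by (simp add: bij_betw_same_card)
    qed
    then have const: "\<forall>y\<in>R `` {x}. card (S y) = card (S x)" by (auto simp: R_def)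
    have "carrier \<Gamma> = (\<Union>y\<in>R `` {x}. S y)" using x by (auto simp: S_def R_def)
    then have "order \<Gamma> = card (\<Union>y\<in>R `` {x}. S y)" by (simp add: order_def)
    also have "\<dots> = (\<Sum>y\<in>R `` {x}. card (S y))"
      by (rule card_UN_disjoint)
        (use fin\<Gamma> \<open>finite E\<close> eq in \<open>auto simp: S_def dest: equiv_type intro: finite_subset[of _ E]\<close>)
    also have "\<dots> = card (R `` {x}) * card (S x)" using const by simp
    finally show ?thesis using assms(2) by (metis dvd_triv_left)
  qed
  have cls: "(\<Sum>y\<in>B. w y) = (\<Sum>y\<in>B \<inter> F. w y)" if B: "B \<in> E // R" for B
  proof -
    obtain x where x: "x \<in> E" "B = R `` {x}" using B by (rule quotientE)
    have wx: "\<forall>y\<in>B. w y = w x" using x inv by (auto simp: R_def)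
    obtain i where i: "card B = p ^ i" using orb[OF x(1)] x(2) assms(3)
      by (metis divides_primepow_nat)
    show ?thesis
    proof (cases "i = 0")
      case True
      then obtain z where "B = {z}" using i by (auto simp: card_1_singleton_iff)
      then have "B = {x}" using x(2) equiv_class_self[OF eq x(1)] by auto
      then have "act g x = x" if "g \<in> carrier \<Gamma>" for g using that x by (auto simp: R_def)
      then show ?thesis using \<open>B = {x}\<close> x by (simp add: F_def)
    next
      case False
      have "B \<inter> F = {}"
      proof (rule ccontr)
        assume "B \<inter> F \<noteq> {}"
        then obtain y where y: "y \<in> B" "y \<in> F" by auto
        have "B = R `` {y}" using x y equiv_class_eq[OF eq] by auto
        also have "\<dots> = {y}" using y a1 by (auto simp: R_def F_def)
        finally have "p ^ i = 1" using i by simp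
        then show False using one_less_power[OF prime_gt_1_nat[OF assms(3)], of i] False by simp
      qed
      moreover have "(\<Sum>y\<in>B. w y) = of_nat (card B) * w x" using wx by simp
      moreover have "of_nat (card B) = (0::'k)" using i False assms(4) by (simp add: of_nat_eq_0_iff_char_dvd)
      ultimately show ?thesis by simp
    qed
  qed
  have finX: "finite B" if "B \<in> E // R" for B using that eq \<open>finite E\<close>
    by (meson finite_equiv_class equiv_type)
  have disj: "B \<inter> D = {}" if "B \<in> E // R" "D \<in> E // R" "B \<noteq> D" for B D
    using quotient_disj[OF eq] that by blast
  have "(\<Sum>x\<in>E. w x) = sum w (\<Union>(E // R))" using Union_quotient[OF eq] by simp
  also have "\<dots> = (\<Sum>B\<in>E // R. sum w B)"
    using sum.Union_disjoint[of "E // R" w] finX disj by simp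
  also have "\<dots> = (\<Sum>B\<in>E // R. sum w (B \<inter> F))" using cls by simp
  also have "\<dots> = sum w (\<Union>B\<in>E // R. B \<inter> F)"
    by (rule sum.UNION_disjoint[symmetric])
      (use finX disj \<open>finite E\<close> eq in \<open>auto simp: finite_quotient equiv_type\<close>)
  also have "(\<Union>B\<in>E // R. B \<inter> F) = F" using Union_quotient[OF eq] by (auto simp: F_def)
  finally show ?thesis by (simp add: F_def)
qed

text \<open>The residues modulo \<open>p ^ N\<close> act by iterating \<open>f\<close>. This form
  serves the rotation of tuples and a shift of order \<open>p\<close>.\<close>

lemma sum_fixed_points_permutation:
  fixes w :: "'e \<Rightarrow> 'k::field"
  assumes "Factorial_Ring.prime p" "CHAR('k) = p" "finite E"
    and cl: "\<And>x. x \<in> E \<Longrightarrow> f x \<in> E"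
    and per: "\<And>x. x \<in> E \<Longrightarrow> (f ^^ (p ^ N)) x = x"
    and inv: "\<And>x. x \<in> E \<Longrightarrow> w (f x) = w x"
  shows "(\<Sum>x\<in>E. w x) = (\<Sum>x | x \<in> E \<and> f x = x. w x)"
proof -
  define P where "P = p ^ N"
  have P0: "P > 0" using assms(1) prime_gt_0_nat by (simp add: P_def)
  let ?\<Gamma> = "integer_mod_group P"
  have car: "carrier ?\<Gamma> = {0..<int P}" using P0 by (simp add: carrier_integer_mod_group)
  have clE: "(f ^^ i) x \<in> E" if "x \<in> E" for i x using that by (induction i) (auto intro: cl)
  have per': "(f ^^ (P * i)) x = x" if "x \<in> E" for i x
    using that by (induction i) (auto simp: funpow_add per P_def)
  have pmod: "(f ^^ (i mod P)) x = (f ^^ i) x" if "x \<in> E" for i x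
  proof -
    have "(f ^^ i) x = (f ^^ (P * (i div P) + i mod P)) x" by simp
    also have "\<dots> = (f ^^ (i mod P + P * (i div P))) x" by (simp only: add.commute)
    also have "\<dots> = (f ^^ (i mod P)) x" unfolding funpow_add o_def using per'[OF that] by simp
    finally show ?thesis by simp
  qed
  have "(\<Sum>x\<in>E. w x) = (\<Sum>x | x \<in> E \<and> (\<forall>g\<in>carrier ?\<Gamma>. (f ^^ nat g) x = x). w x)"
  proof (rule sum_fixed_points_p_group[where p = p and N = N])
    show "order ?\<Gamma> = p ^ N" using car by (simp add: order_def) (simp add: P_def nat_power_eq)
    fix g h x assume gh: "g \<in> carrier ?\<Gamma>" "h \<in> carrier ?\<Gamma>" "x \<in> E"
    then have "nat (g \<otimes>\<^bsub>?\<Gamma>\<^esub> h) = (nat g + nat h) mod P"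
      using P0 by (simp add: car mult_integer_mod_group nat_mod_distrib nat_add_distrib)
    then show "(f ^^ nat (g \<otimes>\<^bsub>?\<Gamma>\<^esub> h)) x = (f ^^ nat g) ((f ^^ nat h) x)"
      using pmod gh by (simp add: funpow_add)
  next
    fix g x assume gx: "g \<in> carrier ?\<Gamma>" "x \<in> E"
    have "w ((f ^^ i) x) = w x" for i by (induction i) (auto simp: inv clE gx)
    then show "w ((f ^^ nat g) x) = w x" .
  qed (use assms clE in \<open>auto\<close>)
  also have "{x. x \<in> E \<and> (\<forall>g\<in>carrier ?\<Gamma>. (f ^^ nat g) x = x)} = {x. x \<in> E \<and> f x = x}"
  proof -
    have "(\<forall>g\<in>carrier ?\<Gamma>. (f ^^ nat g) x = x) \<longleftrightarrow> f x = x" if x: "x \<in> E" for x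
    proof
      assume a: "\<forall>g\<in>carrier ?\<Gamma>. (f ^^ nat g) x = x"
      show "f x = x"
      \<comment> \<open>For \<open>P = 1\<close> the residue 1 is not in the carrier and cannot be
        used as a generator, but then \<open>f x = x\<close> holds by periodicity.\<close>
      proof (cases "P = 1")
        case True then show ?thesis using per'[OF x, of 1] by simp
      next
        case False
        then have "1 \<in> carrier ?\<Gamma>" using P0 by (simp add: car)
        then show ?thesis using a by (metis One_nat_def funpow.simps(2) funpow_0 comp_apply nat_one_as_int)
      qed
    next
      assume fx: "f x = x"
      have "(f ^^ i) x = x" for i by (induction i) (auto simp: fx)
      then show "\<forall>g\<in>carrier ?\<Gamma>. (f ^^ nat g) x = x" by simp
    qed
    then show ?thesis by auto
  qed
  finally show ?thesis .
qed

section \<open>Geometric sums modulo prime powers\<close>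

text \<open>The quotient of \<open>r ^ v - 1\<close> by \<open>r - 1\<close>, in a form that also
  covers \<open>r = 1\<close>. It is the exponent accumulated by \<open>v\<close> conjugations, each
  of which raises to the power \<open>r\<close> and adds one factor.\<close>

definition geo :: "nat \<Rightarrow> nat \<Rightarrow> nat" where "geo r v = (\<Sum>i<v. r ^ i)"

text \<open>The exponent left in the commutator subgroup when the factors of the \<open>v\<close>-th
  power of a product are collected.\<close>

definition geo2 :: "nat \<Rightarrow> nat \<Rightarrow> nat" where "geo2 r v = (\<Sum>j<v. geo r j)"

lemma geo_simps [simp]: "geo r 0 = 0" "geo r (Suc v) = geo r v + r ^ v"
  by (auto simp: geo_def)

lemma geo2_simps [simp]: "geo2 r 0 = 0" "geo2 r (Suc v) = geo2 r v + geo r v"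
  by (auto simp: geo2_def)

lemma geo_add: "geo r (m + n) = geo r m + r ^ m * geo r n"
  by (induction n) (auto simp: algebra_simps power_add)

lemma geo_mult: "geo r (m * n) = geo r m * geo (r ^ m) n"
proof (induction n)
  case (Suc n)
  have "geo r (m * Suc n) = geo r (m * n + m)" by (simp add: add.commute)
  also have "\<dots> = geo r (m * n) + r ^ (m * n) * geo r m" by (rule geo_add)
  finally show ?case using Suc by (simp add: algebra_simps power_mult)
qed simp

lemma geo2_add: "geo2 r (m + n) = geo2 r m + n * geo r m + r ^ m * geo2 r n"
proof (induction n)
  case (Suc n)
  have "geo2 r (m + Suc n) = geo2 r (m + n) + geo r (m + n)" by simp
  then show ?case using Suc geo_add[of r m n] by (simp add: algebra_simps del: geo_simps(2))
qed simp

lemma geo2_mult: "geo2 r (m * n) = m * geo r m * geo2 (r ^ m) n + geo2 r m * geo (r ^ m) n"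
proof (induction n)
  case (Suc n)
  have "geo2 r (m * Suc n) = geo2 r (m * n + m)" by (simp add: add.commute)
  also have "\<dots> = geo2 r (m * n) + m * geo r (m * n) + r ^ (m * n) * geo2 r m" by (rule geo2_add)
  finally show ?case using Suc by (simp add: algebra_simps power_mult geo_mult)
qed simp

lemma pow_eq_1_plus: "(r::nat) * geo r v + 1 = geo r v + r ^ v"
  by (induction v) (auto simp: algebra_simps)

lemma geo_mod:
  assumes "r mod p = 1 mod p"
  shows "geo r v mod p = v mod p"
proof (induction v)
  case (Suc v)
  have "r ^ v mod p = 1 mod p" using assms by (metis power_mod power_one)
  then show ?case using Suc by (metis geo_simps(2) mod_add_eq Suc_eq_plus1)
qed simp

text \<open>Modulo \<open>p\<close> every power of \<open>r\<close> is 1, so the double sum becomes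
  0 + 1 + ... + (p - 1), which is \<open>p\<close> times \<open>(p - 1) / 2\<close>. This fails for
  \<open>p = 2\<close>.\<close>

lemma geo2_prime_dvd:
  assumes "Factorial_Ring.prime p" "odd p" "r mod p = 1 mod p"
  shows "p dvd geo2 r p"
proof -
  have "geo2 r v mod p = (\<Sum>j<v. j) mod p" for v
  proof (induction v)
    case (Suc v)
    then show ?case using geo_mod[OF assms(3), of v] by (metis geo2_simps(2) mod_add_eq sum.lessThan_Suc)
  qed simp
  moreover have "p dvd (\<Sum>j<p. j)"
  proof -
    obtain h where h: "p = 2 * h + 1" using assms(2) by (elim oddE)
    have "2 * (\<Sum>j<n. j) = n * (n - 1)" for n :: nat
    proof (induction n)
      case (Suc n) then show ?case by (cases n) (auto simp: algebra_simps)
    qed simp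
    from this[of p] have "(\<Sum>j<p. j) = p * h" using h by simp
    then show ?thesis by simp
  qed
  ultimately show ?thesis by (metis dvd_eq_mod_eq_0)
qed

lemma power_mod_1: "(r::nat) mod p = 1 mod p \<Longrightarrow> r ^ m mod p = 1 mod p"
  by (metis power_mod power_one)

text \<open>Writing \<open>r = 1 + p * t\<close> turns the sum into
  \<open>p + p * t * geo2 r p\<close>, and its last factor is divisible by \<open>p\<close>, so the
  sum contains \<open>p\<close> exactly once.\<close>

lemma geo_prime:
  assumes "Factorial_Ring.prime p" "odd p" "r mod p = 1 mod p"
  shows "\<exists>y. coprime y p \<and> geo r p = p * y"
proof -
  have p1: "p > 1" using assms(1) prime_gt_1_nat by blast
  obtain t where t: "r = 1 + p * t"
    using assms(3) p1 by (metis mod_less add.commute div_mult_mod_eq mult.commute)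
  obtain z where z: "geo2 r p = p * z" using geo2_prime_dvd[OF assms] by (elim dvdE)
  have e: "geo r v = v + p * t * geo2 r v" for v
  proof (induction v)
    case (Suc v)
    have "r ^ v = 1 + p * t * geo r v" using pow_eq_1_plus[of r v] t by (simp add: algebra_simps)
    then have "geo r (Suc v) = geo r v + (1 + p * t * geo r v)" unfolding geo_simps(2) by (rule arg_cong)
    also have "\<dots> = (v + p * t * geo2 r v) + (1 + p * t * geo r v)" using Suc.IH by presburger
    also have "\<dots> = Suc v + p * t * geo2 r (Suc v)"
      by (metis (no_types) geo2_simps(2) distrib_left Suc_eq_plus1 add.commute add.left_commute)
    finally show ?case .
  qed simp
  have "geo r p = p * (1 + p * (t * z))"
    unfolding e[of p] z by (simp only: distrib_left mult.assoc mult.left_commute[of p t] mult_1_right)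
  moreover have "coprime (1 + p * (t * z)) p" 
    by (rule coprimeI) (metis dvd_add_left_iff dvd_mult2)
  ultimately show ?thesis by blast
qed

lemma geo_prime_power:
  assumes "Factorial_Ring.prime p" "odd p" "r mod p = 1 mod p"
  shows "\<exists>y. coprime y p \<and> geo r (p ^ k) = p ^ k * y"
  using assms(3)
proof (induction k arbitrary: r)
  case 0
  show ?case by (intro exI[of _ 1]) auto
next
  case (Suc k)
  obtain y where y: "coprime y p" "geo r p = p * y" using geo_prime[OF assms(1,2) Suc.prems] by blast
  obtain z where z: "coprime z p" "geo (r ^ p) (p ^ k) = p ^ k * z"
    using Suc.IH[OF power_mod_1[OF Suc.prems]] by blast
  have "geo r (p ^ Suc k) = p ^ Suc k * (y * z)" using geo_mult[of r p "p ^ k"] y z by simp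
  then show ?case using y z by (intro exI[of _ "y * z"]) auto
qed

text \<open>Lifting the exponent. Each factor \<open>p\<close> of \<open>v\<close> is split off by
  \<open>geo_mult\<close>, at the price of replacing \<open>r\<close> by
  \<open>r ^ p\<close>.\<close>

lemma prime_power_dvd_geo:
  assumes "Factorial_Ring.prime p" "odd p" "r mod p = 1 mod p"
  shows "p ^ k dvd geo r v \<longleftrightarrow> p ^ k dvd v"
  using assms(3)
proof (induction k arbitrary: r v)
  case (Suc k)
  have p0: "p > 0" using assms(1) prime_gt_0_nat by blast
  show ?case
  proof (cases "p dvd v")
    case False
    then have "\<not> p dvd geo r v" using geo_mod[OF Suc.prems, of v] by (metis dvd_eq_mod_eq_0)
    with False show ?thesis by (metis dvd_mult_left power_Suc)
  next
    case True
    then obtain u where u: "v = p * u" by auto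
    obtain y where y: "coprime y p" "geo r p = p * y" using geo_prime[OF assms(1,2) Suc.prems] by blast
    have "p ^ Suc k dvd geo r v \<longleftrightarrow> p ^ k dvd y * geo (r ^ p) u"
      using p0 by (simp add: u geo_mult y mult.assoc)
    also have "\<dots> \<longleftrightarrow> p ^ k dvd geo (r ^ p) u"
      using y(1) by (metis coprime_commute coprime_dvd_mult_right_iff coprime_power_left_iff)
    also have "\<dots> \<longleftrightarrow> p ^ k dvd u" by (rule Suc.IH[OF power_mod_1[OF Suc.prems]])
    finally show ?thesis using p0 by (simp add: u)
  qed
qed simp

text \<open>Splitting off a factor \<open>p\<close> by \<open>geo2_mult\<close> leaves two summands;
  one gets the new factor \<open>p\<close> from \<open>geo2\<close>, the other from
  \<open>geo\<close>.\<close>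

lemma geo2_prime_power_dvd:
  assumes "Factorial_Ring.prime p" "odd p" "r mod p = 1 mod p"
  shows "p ^ k dvd geo2 r (p ^ k)"
proof (induction k)
  case (Suc k)
  let ?m = "p ^ k"
  have r: "(r ^ ?m) mod p = 1 mod p" by (rule power_mod_1[OF assms(3)])
  have "p ^ Suc k dvd ?m * geo r ?m * geo2 (r ^ ?m) p"
    using geo2_prime_dvd[OF assms(1,2) r]
    by (metis mult_dvd_mono dvd_triv_left power_Suc2)
  moreover have "p ^ Suc k dvd geo2 r ?m * geo (r ^ ?m) p"
    using mult_dvd_mono[OF Suc.IH, of p "geo (r ^ ?m) p"] geo_prime[OF assms(1,2) r]
    by (metis dvd_triv_left mult.commute power_Suc)
  ultimately show ?case using geo2_mult[of r ?m p]
    by (metis dvd_add mult.commute power_Suc)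
qed simp

section \<open>Finite abelian p-groups\<close>

lemma (in group) finite_subgroupI:
  assumes "finite (carrier G)" "S \<subseteq> carrier G" "\<one> \<in> S"
    and m: "\<And>x y. x \<in> S \<Longrightarrow> y \<in> S \<Longrightarrow> x \<otimes> y \<in> S"
  shows "subgroup S G"
proof (rule subgroupI)
  fix x assume x: "x \<in> S"
  then have xG: "x \<in> carrier G" using assms(2) by auto
  have pw: "x [^] (n::nat) \<in> S" for n by (induction n) (use x assms(3) m in auto)
  have "order G > 0" using assms(1) order_gt_0_iff_finite by blast
  then have "x \<otimes> x [^] (order G - 1) = x [^] order G"
    using xG by (metis Suc_diff_1 nat_pow_Suc2)
  also have "\<dots> = \<one>" using xG pow_order_eq_1 by simp
  finally have "inv x = x [^] (order G - 1)" using xG inv_equality[of "x [^] (order G - 1)" x]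
    by (metis inv_char nat_pow_closed inv_comm)
  then show "inv x \<in> S" using pw by simp
qed (use assms in auto)

lemma (in group) pow_eq_iff_mod_ord:
  assumes "finite (carrier G)" "x \<in> carrier G"
  shows "x [^] (i::nat) = x [^] (j::nat) \<longleftrightarrow> i mod ord x = j mod ord x"
proof -
  have w: "x [^] i = x [^] j \<longleftrightarrow> i mod ord x = j mod ord x" if "i \<le> j" for i j :: nat
  proof -
    have "x [^] j = x [^] i \<otimes> x [^] (j - i)" using that assms(2) by (simp add: nat_pow_mult)
    then have "x [^] i = x [^] j \<longleftrightarrow> x [^] (j - i) = \<one>"
      using assms(2) by auto
    also have "\<dots> \<longleftrightarrow> ord x dvd j - i" using assms(2) by (simp add: pow_eq_id)
    also have "\<dots> \<longleftrightarrow> i mod ord x = j mod ord x" using mod_eq_dvd_iff_nat[OF that, of "ord x"] by auto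
    finally show ?thesis .
  qed
  show ?thesis using w[of i j] w[of j i] by (metis nat_le_linear)
qed

lemma (in comm_group) span_subgroup:
  assumes "finite (carrier G)" "subgroup K G" "x \<in> carrier G"
  shows "subgroup {k \<otimes> x [^] (i::nat) | k i. k \<in> K} G"
proof (rule finite_subgroupI)
  show "{k \<otimes> x [^] (i::nat) | k i. k \<in> K} \<subseteq> carrier G"
    using assms subgroup.subset by fastforce
  have "\<one> = \<one> \<otimes> x [^] (0::nat)" by simp
  then show "\<one> \<in> {k \<otimes> x [^] (i::nat) | k i. k \<in> K}" using subgroup.one_closed[OF assms(2)] by blast
next
  fix y z assume "y \<in> {k \<otimes> x [^] (i::nat) | k i. k \<in> K}" "z \<in> {k \<otimes> x [^] (i::nat) | k i. k \<in> K}"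
  then obtain k i l j where k: "y = k \<otimes> x [^] (i::nat)" "k \<in> K" "z = l \<otimes> x [^] (j::nat)" "l \<in> K" by auto
  then have c: "k \<in> carrier G" "l \<in> carrier G" using assms(2) subgroup.subset by auto
  have "y \<otimes> z = (k \<otimes> l) \<otimes> (x [^] i \<otimes> x [^] j)"
    using k c assms(3) by (simp add: m_ac)
  also have "\<dots> = (k \<otimes> l) \<otimes> x [^] (i + j)" using assms(3) by (simp add: nat_pow_mult)
  finally show "y \<otimes> z \<in> {k \<otimes> x [^] (i::nat) | k i. k \<in> K}"
    using k subgroup.m_closed[OF assms(2)] by blast
qed (use assms in auto)

text \<open>Take \<open>K\<close> as large as possible among the subgroups meeting the powers of
  \<open>a\<close> trivially. If \<open>K\<close> and \<open>a\<close> did not span the group, some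
  \<open>z\<close> outside the span would have \<open>z [^] p\<close> in \<open>K\<close>, and
  adjoining \<open>z\<close> to \<open>K\<close> would still meet the powers of \<open>a\<close>
  trivially.\<close>

lemma (in comm_group) cyclic_complement:
  assumes p: "Factorial_Ring.prime p" and fin: "finite (carrier G)"
    and a: "a \<in> carrier G" "ord a = p ^ Suc r"
    and ex: "\<And>x. x \<in> carrier G \<Longrightarrow> x [^] (p ^ Suc r) = \<one>"
  shows "\<exists>K. subgroup K G \<and> (\<forall>i::nat. a [^] i \<in> K \<longrightarrow> a [^] i = \<one>) \<and>
    (\<forall>x\<in>carrier G. \<exists>k\<in>K. \<exists>i::nat. x = k \<otimes> a [^] i)"
proof -
  define Q where "Q = (\<lambda>K. subgroup K G \<and> (\<forall>i::nat. a [^] i \<in> K \<longrightarrow> a [^] i = \<one>))"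
  have Q1: "Q {\<one>}" by (simp add: Q_def triv_subgroup)
  have bd: "card K \<le> card (carrier G)" if "Q K" for K
    using that fin by (auto simp: Q_def intro!: card_mono dest: subgroup.subset)
  have "\<exists>K. Q K \<and> (\<forall>L. Q L \<longrightarrow> card L \<le> card K)"
    by (rule ex_has_greatest_nat[of Q "{\<one>}" card "Suc (card (carrier G))"]) (use Q1 bd in \<open>auto simp: less_Suc_eq_le\<close>)
  then obtain K where K: "Q K" "\<And>L. Q L \<Longrightarrow> card L \<le> card K" by auto
  have sK: "subgroup K G" and Ka: "\<And>i::nat. a [^] i \<in> K \<Longrightarrow> a [^] i = \<one>" using K(1) by (auto simp: Q_def)
  note KG = subgroup.mem_carrier[OF sK]
  define S where "S = {k \<otimes> a [^] (i::nat) | k i. k \<in> K}"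
  have sS: "subgroup S G" unfolding S_def by (rule span_subgroup) (use fin sK a in auto)
  have KS: "k \<in> S" if "k \<in> K" for k
  proof -
    have "k = k \<otimes> a [^] (0::nat)" using KG[OF that] by simp
    then show ?thesis using that unfolding S_def by blast
  qed
  have aS: "a [^] (i::nat) \<in> S" for i
  proof -
    have "a [^] i = \<one> \<otimes> a [^] i" using a by simp
    then show ?thesis using subgroup.one_closed[OF sK] unfolding S_def by blast
  qed
  have "x \<in> S" if x: "x \<in> carrier G" for x
  proof (rule ccontr)
    assume "x \<notin> S"
    \<comment> \<open>The element \<open>y\<close> below is the last iterated \<open>p\<close>-th
      power of \<open>x\<close> outside the span, so its own \<open>p\<close>-th power lies in the
      span.\<close>
    define j where "j = (LEAST j. x [^] (p ^ j) \<in> S)"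
    have "x [^] (p ^ Suc r) \<in> S" using ex[OF x] subgroup.one_closed[OF sS] by simp
    then have j1: "x [^] (p ^ j) \<in> S" unfolding j_def by (rule LeastI)
    have "j \<noteq> 0" using j1 \<open>x \<notin> S\<close> x by (metis nat_pow_eone power_0)
    then obtain j' where j': "j = Suc j'" by (cases j) auto
    have "x [^] (p ^ j') \<notin> S" using not_less_Least[of j' "\<lambda>j. x [^] (p ^ j) \<in> S"] j' j_def by auto
    define y where "y = x [^] (p ^ j')"
    have y: "y \<in> carrier G" "y \<notin> S" "y [^] p \<in> S"
      using x j1 \<open>x [^] (p ^ j') \<notin> S\<close> by (auto simp: y_def j' nat_pow_pow mult.commute)
    obtain k i where ki: "y [^] p = k \<otimes> a [^] (i::nat)" "k \<in> K" using y(3) S_def by auto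
    \<comment> \<open>The order of \<open>a\<close> is the exponent of the group, so raising to the
      power \<open>p ^ r\<close> forces \<open>p\<close> to divide \<open>i\<close>. Dividing
      \<open>y\<close> by \<open>a [^] i'\<close> then removes the \<open>a\<close>-part of its
      \<open>p\<close>-th power.\<close>
    have "\<one> = (y [^] p) [^] (p ^ r)" using ex[OF y(1)] y by (simp add: nat_pow_pow)
    also have "\<dots> = k [^] (p ^ r) \<otimes> a [^] (i * p ^ r)"
      using ki KG a by (simp add: nat_pow_distrib nat_pow_pow)
    finally have "a [^] (i * p ^ r) = inv (k [^] (p ^ r))"
      using KG ki a by (metis inv_equality m_comm nat_pow_closed)
    also have "\<dots> \<in> K" using ki sK
      by (metis subgroup.m_inv_closed subgroup_int_pow_closed int_pow_int)
    finally have "a [^] (i * p ^ r) = \<one>" by (rule Ka)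
    then have "p ^ Suc r dvd i * p ^ r" using a pow_eq_id by metis
    then have "p dvd i" using p by (simp add: prime_gt_0_nat mult.commute)
    then obtain i' where i': "i = p * i'" by auto
    define z where "z = y \<otimes> inv (a [^] i')"
    have z: "z \<in> carrier G" using y a by (simp add: z_def)
    have yz: "y = z \<otimes> a [^] i'" using y a by (simp add: z_def m_assoc)
    have zS: "z \<notin> S" using yz y aS subgroup.m_closed[OF sS] by metis
    have "y [^] p = z [^] p \<otimes> a [^] i" unfolding yz using z a
      by (simp add: nat_pow_distrib nat_pow_pow i' mult.commute)
    then have zp: "z [^] p = k" using ki z a KG by (metis nat_pow_closed r_cancel)
    define L where "L = {k \<otimes> z [^] (i::nat) | k i. k \<in> K}"
    have sL: "subgroup L G" unfolding L_def by (rule span_subgroup) (use fin sK z in auto)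
    have KL: "K \<subset> L"
    proof -
      have "h = h \<otimes> z [^] (0::nat)" if "h \<in> K" for h using KG[OF that] by simp
      then have "K \<subseteq> L" unfolding L_def by blast
      moreover have "z = \<one> \<otimes> z [^] (1::nat)" using z by simp
      then have "z \<in> L" using subgroup.one_closed[OF sK] unfolding L_def by blast
      ultimately show ?thesis using zS KS by blast
    qed
    have "finite L" using sL fin by (meson finite_subset subgroup.subset)
    then have "card K < card L" using KL by (rule psubset_card_mono)
    then have "\<not> Q L" using K(2) by (meson not_less)
    then obtain l where l: "a [^] (l::nat) \<in> L" "a [^] l \<noteq> \<one>" using sL Q_def by auto
    then obtain h j where hj: "a [^] l = h \<otimes> z [^] (j::nat)" "h \<in> K" unfolding L_def by auto
    have hjz: "z [^] j = inv h \<otimes> a [^] l" using hj KG z a by (simp add: m_assoc[symmetric])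
    show False
    proof (cases "p dvd j")
      case True
      then obtain j1 where "j = p * j1" by auto
      then have "z [^] j = k [^] j1" using z zp by (simp add: nat_pow_pow[symmetric])
      then have "a [^] l \<in> K" using hj ki sK
        by (metis subgroup.m_closed subgroup_int_pow_closed int_pow_int)
      then show False using Ka l by blast
    next
      case False
      \<comment> \<open>Since \<open>j\<close> is invertible modulo \<open>p\<close>, the element
        \<open>z\<close> is itself a product of elements of the span.\<close>
      then have "coprime j p" using p by (metis coprime_commute prime_imp_coprime)
      then have "gcd j p = 1" by simp
      moreover have "j \<noteq> 0" using False by (cases j) auto
      ultimately have "\<exists>u v. j * u = p * v + 1" using bezout_nat[of j p] by presburger
      then obtain u v where uv: "j * u = p * v + 1" by blast
      have "z [^] (j * u) = (z [^] p) [^] v \<otimes> z" using z uv by (simp add: nat_pow_pow)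
      then have "(inv h \<otimes> a [^] l) [^] u = k [^] v \<otimes> z"
        using z zp hjz by (simp add: nat_pow_pow[symmetric])
      then have "z = inv (k [^] v) \<otimes> (inv h \<otimes> a [^] l) [^] u"
        using z KG[OF ki(2)] by (simp add: m_assoc[symmetric])
      moreover have "inv (k [^] v) \<in> S"
        using KS[OF ki(2)] sS by (metis subgroup.m_inv_closed subgroup_int_pow_closed int_pow_int)
      moreover have "(inv h \<otimes> a [^] l) [^] u \<in> S"
        using KS[OF hj(2)] aS[of l] sS
        by (metis subgroup.m_inv_closed subgroup.m_closed subgroup_int_pow_closed int_pow_int)
      ultimately have "z \<in> S" using subgroup.m_closed[OF sS] by metis
      then show False using zS by simp
    qed
  qed
  then show ?thesis using sK Ka unfolding S_def by blast
qed

section \<open>Torsion counts and the classification of finite abelian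
  \<open>p\<close>-groups\<close>

definition torsion_count :: "('a, 'b) monoid_scheme \<Rightarrow> nat \<Rightarrow> nat" where
  "torsion_count G n = card {x \<in> carrier G. x [^]\<^bsub>G\<^esub> n = \<one>\<^bsub>G\<^esub>}"

locale cyclic_splitting = comm_group G for G (structure) +
  fixes K a
  assumes fin: "finite (carrier G)" and a: "a \<in> carrier G" and K: "subgroup K G"
    and triv: "\<And>i::nat. a [^] i \<in> K \<Longrightarrow> a [^] i = \<one>"
    and all: "\<And>x. x \<in> carrier G \<Longrightarrow> \<exists>k\<in>K. \<exists>i::nat. x = k \<otimes> a [^] i"
begin

lemma K_carrier: "k \<in> K \<Longrightarrow> k \<in> carrier G"
  using subgroup.mem_carrier[OF K] .

lemma split_unique:
  assumes "k \<in> K" "l \<in> K" "k \<otimes> a [^] (i::nat) = l \<otimes> a [^] (j::nat)"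
  shows "k = l \<and> a [^] i = a [^] j"
proof -
  have w: "k = l \<and> a [^] i = a [^] j"
    if "i \<le> j" "k \<in> K" "l \<in> K" "k \<otimes> a [^] i = l \<otimes> a [^] j" for k l and i j :: nat
  proof -
    have e: "a [^] j = a [^] (j - i) \<otimes> a [^] i" using that a by (simp add: nat_pow_mult)
    have "k \<otimes> a [^] i = (l \<otimes> a [^] (j - i)) \<otimes> a [^] i"
      using that e K_carrier a by (simp add: m_assoc)
    then have k: "k = l \<otimes> a [^] (j - i)" using that K_carrier a by (metis m_closed nat_pow_closed r_cancel)
    then have "a [^] (j - i) = inv l \<otimes> k" using that K_carrier a by (simp add: m_assoc[symmetric])
    also have "\<dots> \<in> K" using that K by (simp add: subgroup.m_closed subgroup.m_inv_closed)
    finally have "a [^] (j - i) = \<one>" by (rule triv)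
    then show ?thesis using k e that K_carrier a by simp
  qed
  show ?thesis using w[of i j k l] w[of j i l k] assms by (metis nat_le_linear)
qed

text \<open>Torsion is counted factor by factor. The second factor depends on \<open>a\<close> only
  through its order, so it cancels when two groups with cyclic factors of equal order are
  compared.\<close>

lemma torsion_count_split:
  "torsion_count G n = torsion_count (G\<lparr>carrier := K\<rparr>) n * card {i \<in> {..<ord a}. ord a dvd i * n}"
proof -
  interpret K: group "G\<lparr>carrier := K\<rparr>" using K by (rule subgroup_imp_group)
  have oa: "ord a > 0" using a fin ord_ge_1 by fastforce
  have "bij_betw (\<lambda>(k, i). k \<otimes> a [^] i)
      ({x \<in> K. x [^] n = \<one>} \<times> {i \<in> {..<ord a}. ord a dvd i * n}) {x \<in> carrier G. x [^] n = \<one>}"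
  proof (rule bij_betw_imageI)
    show "inj_on (\<lambda>(k, i). k \<otimes> a [^] i) ({x \<in> K. x [^] n = \<one>} \<times> {i \<in> {..<ord a}. ord a dvd i * n})"
    proof (rule inj_onI, clarify)
      fix k l :: 'a and i j :: nat
      assume h: "k \<in> K" "l \<in> K" "k \<otimes> a [^] i = l \<otimes> a [^] j" "i < ord a" "j < ord a"
      have "k = l" "a [^] i = a [^] j" using split_unique[OF h(1-3)] by auto
      then have "i mod ord a = j mod ord a" using pow_eq_iff_mod_ord[OF fin a] by blast
      then show "k = l \<and> i = j" using h \<open>k = l\<close> by simp
    qed
    show "(\<lambda>(k, i). k \<otimes> a [^] i) ` ({x \<in> K. x [^] n = \<one>} \<times> {i \<in> {..<ord a}. ord a dvd i * n})
      = {x \<in> carrier G. x [^] n = \<one>}" (is "?L = ?R")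
    proof
      have pw: "(k \<otimes> a [^] i) [^] n = k [^] n \<otimes> a [^] (i * n)" if "k \<in> K" for k and i :: nat
        using that K_carrier a by (simp add: nat_pow_distrib nat_pow_pow)
      show "?L \<subseteq> ?R" using pw K_carrier a by (auto simp: pow_eq_id[OF a])
      show "?R \<subseteq> ?L"
      proof
        fix x assume x: "x \<in> ?R"
        then obtain k i where ki: "k \<in> K" "x = k \<otimes> a [^] (i::nat)" using all by blast
        have ai: "a [^] i = a [^] (i mod ord a)" using pow_eq_iff_mod_ord[OF fin a] by simp
        have kn: "k [^] n \<in> K" using ki K by (metis subgroup_int_pow_closed int_pow_int)
        have "k [^] n \<otimes> a [^] ((i mod ord a) * n) = \<one> \<otimes> a [^] (0::nat)"
          using x ki ai pw[OF ki(1)] by simp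
        then have "k [^] n = \<one>" "a [^] ((i mod ord a) * n) = \<one>"
          using split_unique[OF kn subgroup.one_closed[OF K], of "(i mod ord a) * n" 0] by auto
        then show "x \<in> ?L" using ki ai oa pow_eq_id[OF a]
          by (auto intro!: image_eqI[of _ _ "(k, i mod ord a)"])
      qed
    qed
  qed
  then have "torsion_count G n = card ({x \<in> K. x [^] n = \<one>} \<times> {i \<in> {..<ord a}. ord a dvd i * n})"
    unfolding torsion_count_def by (rule bij_betw_same_card[symmetric])
  then show ?thesis by (simp add: torsion_count_def card_cartesian_product nat_pow_consistent[symmetric])
qed

end

lemma iso_of_splittings:
  assumes "cyclic_splitting A K a" "cyclic_splitting B L b"
    and o: "group.ord A a = group.ord B b"
    and iso: "A\<lparr>carrier := K\<rparr> \<cong> B\<lparr>carrier := L\<rparr>"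
  shows "A \<cong> B"
proof -
  interpret A: cyclic_splitting A K a by fact
  interpret B: cyclic_splitting B L b by fact
  obtain f where f: "f \<in> iso (A\<lparr>carrier := K\<rparr>) (B\<lparr>carrier := L\<rparr>)" using iso by (auto simp: is_iso_def)
  then have fb: "bij_betw f K L" and fm: "\<And>x y. x \<in> K \<Longrightarrow> y \<in> K \<Longrightarrow> f (x \<otimes>\<^bsub>A\<^esub> y) = f x \<otimes>\<^bsub>B\<^esub> f y"
    by (auto simp: iso_def hom_def)
  have fL: "k \<in> K \<Longrightarrow> f k \<in> L" for k using fb by (auto simp: bij_betw_def)
  \<comment> \<open>The exponent \<open>i\<close> is determined only modulo the order of
    \<open>a\<close>; as \<open>b\<close> has the same order, the image does not depend on the
    choice.\<close>
  define F where "F = (\<lambda>x. THE y. \<exists>k\<in>K. \<exists>i::nat. x = k \<otimes>\<^bsub>A\<^esub> a [^]\<^bsub>A\<^esub> i \<and> y = f k \<otimes>\<^bsub>B\<^esub> b [^]\<^bsub>B\<^esub> i)"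
  have F: "F (k \<otimes>\<^bsub>A\<^esub> a [^]\<^bsub>A\<^esub> i) = f k \<otimes>\<^bsub>B\<^esub> b [^]\<^bsub>B\<^esub> i" if k: "k \<in> K" for k and i :: nat
    unfolding F_def
  proof (rule the_equality)
    show "\<exists>k'\<in>K. \<exists>i'::nat. k \<otimes>\<^bsub>A\<^esub> a [^]\<^bsub>A\<^esub> i = k' \<otimes>\<^bsub>A\<^esub> a [^]\<^bsub>A\<^esub> i'
        \<and> f k \<otimes>\<^bsub>B\<^esub> b [^]\<^bsub>B\<^esub> i = f k' \<otimes>\<^bsub>B\<^esub> b [^]\<^bsub>B\<^esub> i'" using k by blast
  next
    fix y assume "\<exists>k'\<in>K. \<exists>i'::nat. k \<otimes>\<^bsub>A\<^esub> a [^]\<^bsub>A\<^esub> i = k' \<otimes>\<^bsub>A\<^esub> a [^]\<^bsub>A\<^esub> i' \<and> y = f k' \<otimes>\<^bsub>B\<^esub> b [^]\<^bsub>B\<^esub> i'"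
    then obtain k' i' where h: "k' \<in> K" "k \<otimes>\<^bsub>A\<^esub> a [^]\<^bsub>A\<^esub> i = k' \<otimes>\<^bsub>A\<^esub> a [^]\<^bsub>A\<^esub> (i'::nat)"
      "y = f k' \<otimes>\<^bsub>B\<^esub> b [^]\<^bsub>B\<^esub> i'" by blast
    have "k = k'" "a [^]\<^bsub>A\<^esub> i = a [^]\<^bsub>A\<^esub> i'" using A.split_unique[OF k h(1,2)] by auto
    moreover from this have "b [^]\<^bsub>B\<^esub> i = b [^]\<^bsub>B\<^esub> i'"
      using A.pow_eq_iff_mod_ord[OF A.fin A.a] B.pow_eq_iff_mod_ord[OF B.fin B.a] o by metis
    ultimately show "y = f k \<otimes>\<^bsub>B\<^esub> b [^]\<^bsub>B\<^esub> i" using h by simp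
  qed
  have Fc: "F x \<in> carrier B" if "x \<in> carrier A" for x
    using A.all[OF that] F fL B.K_carrier B.a by fastforce
  have hom: "F \<in> hom A B"
  proof (rule homI)
    fix x y assume "x \<in> carrier A" "y \<in> carrier A"
    then obtain k i l j where h: "k \<in> K" "x = k \<otimes>\<^bsub>A\<^esub> a [^]\<^bsub>A\<^esub> (i::nat)" "l \<in> K" "y = l \<otimes>\<^bsub>A\<^esub> a [^]\<^bsub>A\<^esub> (j::nat)"
      using A.all by meson
    have "x \<otimes>\<^bsub>A\<^esub> y = (k \<otimes>\<^bsub>A\<^esub> l) \<otimes>\<^bsub>A\<^esub> a [^]\<^bsub>A\<^esub> (i + j)"
      using h A.K_carrier A.a by (simp add: A.nat_pow_mult[symmetric] A.m_ac)
    then have "F (x \<otimes>\<^bsub>A\<^esub> y) = (f k \<otimes>\<^bsub>B\<^esub> f l) \<otimes>\<^bsub>B\<^esub> b [^]\<^bsub>B\<^esub> (i + j)"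
      using F[of "k \<otimes>\<^bsub>A\<^esub> l" "i + j"] subgroup.m_closed[OF A.K] h fm by simp
    also have "\<dots> = F x \<otimes>\<^bsub>B\<^esub> F y"
      using h F B.K_carrier[OF fL[OF h(1)]] B.K_carrier[OF fL[OF h(3)]] B.a
      by (simp add: B.nat_pow_mult[symmetric] B.m_ac)
    finally show "F (x \<otimes>\<^bsub>A\<^esub> y) = F x \<otimes>\<^bsub>B\<^esub> F y" .
  qed (rule Fc)
  interpret gh: group_hom A B F by unfold_locales (rule hom)
  have f1: "f \<one>\<^bsub>A\<^esub> = \<one>\<^bsub>B\<^esub>"
    using fm[of "\<one>\<^bsub>A\<^esub>" "\<one>\<^bsub>A\<^esub>"] subgroup.one_closed[OF A.K] B.K_carrier[OF fL] by simp
  have "F \<in> iso A B" unfolding gh.iso_iff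
  proof (intro conjI ballI impI subsetI)
    fix y assume "y \<in> carrier B"
    then obtain l i where "l \<in> L" "y = l \<otimes>\<^bsub>B\<^esub> b [^]\<^bsub>B\<^esub> (i::nat)" using B.all by blast
    moreover then obtain k where "k \<in> K" "f k = l" using fb by (auto simp: bij_betw_def)
    ultimately have "y = F (k \<otimes>\<^bsub>A\<^esub> a [^]\<^bsub>A\<^esub> i)" using F by simp
    then show "y \<in> F ` carrier A" by (rule image_eqI) (use \<open>k \<in> K\<close> A.K_carrier A.a in simp)
  next
    fix x assume x: "x \<in> carrier A" "F x = \<one>\<^bsub>B\<^esub>"
    then obtain k i where h: "k \<in> K" "x = k \<otimes>\<^bsub>A\<^esub> a [^]\<^bsub>A\<^esub> (i::nat)" using A.all by blast
    have "f k \<otimes>\<^bsub>B\<^esub> b [^]\<^bsub>B\<^esub> i = f \<one>\<^bsub>A\<^esub> \<otimes>\<^bsub>B\<^esub> b [^]\<^bsub>B\<^esub> (0::nat)" using F h x f1 by simp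
    then have e: "f k = f \<one>\<^bsub>A\<^esub>" "b [^]\<^bsub>B\<^esub> i = b [^]\<^bsub>B\<^esub> (0::nat)"
      using B.split_unique[OF fL fL] h subgroup.one_closed[OF A.K] by blast+
    have "k = \<one>\<^bsub>A\<^esub>" using e(1) fb h subgroup.one_closed[OF A.K] by (auto simp: bij_betw_def inj_on_def)
    moreover have "a [^]\<^bsub>A\<^esub> i = a [^]\<^bsub>A\<^esub> (0::nat)"
      using e(2) A.pow_eq_iff_mod_ord[OF A.fin A.a] B.pow_eq_iff_mod_ord[OF B.fin B.a] o by metis
    ultimately show "x = \<one>\<^bsub>A\<^esub>" using h by simp
  qed
  then show ?thesis by (auto simp: is_iso_def)
qed

lemma ex_cyclic_splitting:
  fixes G (structure)
  assumes "comm_group G" "Factorial_Ring.prime p" "finite (carrier G)"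
    and ex: "\<And>x. x \<in> carrier G \<Longrightarrow> x [^]\<^bsub>G\<^esub> (p ^ Suc r) = \<one>\<^bsub>G\<^esub>"
    and nex: "x0 \<in> carrier G" "x0 [^]\<^bsub>G\<^esub> (p ^ r) \<noteq> \<one>\<^bsub>G\<^esub>"
  shows "\<exists>K a. cyclic_splitting G K a \<and> group.ord G a = p ^ Suc r"
proof -
  interpret comm_group G by fact
  have "ord x0 dvd p ^ Suc r" using ex[OF nex(1)] nex(1) pow_eq_id by metis
  then obtain i where i: "i \<le> Suc r" "ord x0 = p ^ i" using assms(2) divides_primepow_nat by blast
  have "\<not> ord x0 dvd p ^ r" using nex pow_eq_id by metis
  then have "i = Suc r" using i by (metis le_imp_power_dvd le_Suc_eq)
  then have o: "ord x0 = p ^ Suc r" using i by simp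
  obtain K where "subgroup K G" "\<forall>i::nat. x0 [^] i \<in> K \<longrightarrow> x0 [^] i = \<one>"
    "\<forall>x\<in>carrier G. \<exists>k\<in>K. \<exists>i::nat. x = k \<otimes> x0 [^] i"
    using cyclic_complement[OF assms(2,3) nex(1) o ex] by blast
  then have "cyclic_splitting G K x0" using assms(3) nex(1)
    by (intro cyclic_splitting.intro cyclic_splitting_axioms.intro) (auto intro: comm_group_axioms)
  then show ?thesis using o by blast
qed

lemma exponent_from_torsion_count:
  assumes "group G" "finite (carrier G)"
  shows "torsion_count G n = order G \<longleftrightarrow> (\<forall>x\<in>carrier G. x [^]\<^bsub>G\<^esub> n = \<one>\<^bsub>G\<^esub>)"
proof
  assume "torsion_count G n = order G"
  then have "{x \<in> carrier G. x [^]\<^bsub>G\<^esub> n = \<one>\<^bsub>G\<^esub>} = carrier G"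
    using assms by (intro card_subset_eq) (auto simp: torsion_count_def order_def)
  then show "\<forall>x\<in>carrier G. x [^]\<^bsub>G\<^esub> n = \<one>\<^bsub>G\<^esub>" by auto
next
  assume "\<forall>x\<in>carrier G. x [^]\<^bsub>G\<^esub> n = \<one>\<^bsub>G\<^esub>"
  then have "{x \<in> carrier G. x [^]\<^bsub>G\<^esub> n = \<one>\<^bsub>G\<^esub>} = carrier G" by auto
  then show "torsion_count G n = order G" by (simp add: torsion_count_def order_def)
qed

text \<open>Equal torsion counts force equal orders and equal exponents. A cyclic factor whose order
  is the exponent splits off from both groups, its torsion cancels, and induction applies to the
  smaller complements.\<close>

theorem abelian_p_groups_isomorphic:
  assumes "comm_group A" "comm_group B" "Factorial_Ring.prime p"
    and "order A = p ^ m" "order B = p ^ n"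
    and "\<And>k. torsion_count A (p ^ k) = torsion_count B (p ^ k)"
  shows "A \<cong> B"
  using assms
proof (induction m arbitrary: A B n rule: less_induct)
  case (less m)
  interpret A: comm_group A by fact
  interpret B: comm_group B by fact
  have p1: "p > 1" using less.prems(3) prime_gt_1_nat by blast
  have fA: "finite (carrier A)" and fB: "finite (carrier B)"
    using less.prems(4,5) p1 by (metis A.order_gt_0_iff_finite zero_less_power zero_less_one order.strict_trans,
      metis B.order_gt_0_iff_finite zero_less_power zero_less_one order.strict_trans)
  \<comment> \<open>The number \<open>p ^ (m + n)\<close> kills both groups, before their orders are
    known to agree.\<close>
  have powA: "x [^]\<^bsub>A\<^esub> (p ^ (m + n)) = \<one>\<^bsub>A\<^esub>" if "x \<in> carrier A" for x
    using that less.prems(4) A.pow_order_eq_1[OF that] by (simp add: power_add A.nat_pow_pow[symmetric])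
  have powB: "x [^]\<^bsub>B\<^esub> (p ^ (m + n)) = \<one>\<^bsub>B\<^esub>" if "x \<in> carrier B" for x
    using that less.prems(5) B.pow_order_eq_1[OF that]
    by (simp add: power_add mult.commute[of "p ^ m"] B.nat_pow_pow[symmetric])
  note eA = exponent_from_torsion_count[OF A.group_axioms fA]
  note eB = exponent_from_torsion_count[OF B.group_axioms fB]
  have oAB: "order A = order B" using eA eB powA powB less.prems(6) by metis
  define r where "r = (LEAST r. \<forall>x\<in>carrier A. x [^]\<^bsub>A\<^esub> (p ^ r) = \<one>\<^bsub>A\<^esub>)"
  have r1: "\<forall>x\<in>carrier A. x [^]\<^bsub>A\<^esub> (p ^ r) = \<one>\<^bsub>A\<^esub>"
    unfolding r_def by (rule LeastI_ex) (use powA in blast)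
  have r2: "\<not> (\<forall>x\<in>carrier A. x [^]\<^bsub>A\<^esub> (p ^ s) = \<one>\<^bsub>A\<^esub>)" if "s < r" for s
    using that not_less_Least unfolding r_def by blast
  show ?case
  proof (cases r)
    case 0
    then have "carrier A = {\<one>\<^bsub>A\<^esub>}" using r1 by auto
    moreover have "carrier B = {\<one>\<^bsub>B\<^esub>}"
      using oAB calculation B.order_one_triv_iff by (simp add: order_def)
    ultimately have "(\<lambda>x. \<one>\<^bsub>B\<^esub>) \<in> iso A B" by (auto simp: iso_def hom_def bij_betw_def)
    then show ?thesis by (auto simp: is_iso_def)
  next
    case (Suc s)
    obtain x0 where x0: "x0 \<in> carrier A" "x0 [^]\<^bsub>A\<^esub> (p ^ s) \<noteq> \<one>\<^bsub>A\<^esub>" using r2 Suc by blast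
    obtain K a where K: "cyclic_splitting A K a" "A.ord a = p ^ Suc s"
      using ex_cyclic_splitting[OF less.prems(1,3) fA _ x0] r1 Suc by blast
    have rB: "\<forall>x\<in>carrier B. x [^]\<^bsub>B\<^esub> (p ^ Suc s) = \<one>\<^bsub>B\<^esub>"
      using r1 Suc eA eB oAB less.prems(6) by metis
    have "\<not> (\<forall>x\<in>carrier B. x [^]\<^bsub>B\<^esub> (p ^ s) = \<one>\<^bsub>B\<^esub>)"
      using x0 eA eB oAB less.prems(6) by metis
    then obtain y0 where y0: "y0 \<in> carrier B" "y0 [^]\<^bsub>B\<^esub> (p ^ s) \<noteq> \<one>\<^bsub>B\<^esub>" by blast
    obtain L b where L: "cyclic_splitting B L b" "B.ord b = p ^ Suc s"
      using ex_cyclic_splitting[OF less.prems(2,3) fB _ y0] rB by blast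
    interpret AK: cyclic_splitting A K a by fact
    interpret BL: cyclic_splitting B L b by fact
    define c where "c = (\<lambda>k. card {i \<in> {..<p ^ Suc s}. p ^ Suc s dvd i * p ^ k})"
    \<comment> \<open>The index 0 is always counted, so this factor can be cancelled.\<close>
    have c0: "c k > 0" for k using p1 unfolding c_def by (subst card_gt_0_iff) (auto intro: exI[of _ 0])
    let ?K = "A\<lparr>carrier := K\<rparr>" and ?L = "B\<lparr>carrier := L\<rparr>"
    have tc: "torsion_count ?K (p ^ k) = torsion_count ?L (p ^ k)" for k
    proof -
      have "torsion_count ?K (p ^ k) * c k = torsion_count ?L (p ^ k) * c k"
        using AK.torsion_count_split[of "p ^ k"] BL.torsion_count_split[of "p ^ k"] less.prems(6)[of k]
        unfolding K(2) L(2) c_def by metis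
      then show ?thesis using c0[of k] by (metis mult_right_cancel not_less_zero)
    qed
    have cK: "comm_group ?K" 
      using A.subgroup_imp_group[OF AK.K] AK.K_carrier A.m_comm
      by (intro group.group_comm_groupI) auto
    have cL: "comm_group ?L" 
      using B.subgroup_imp_group[OF BL.K] BL.K_carrier B.m_comm
      by (intro group.group_comm_groupI) auto
    have "order ?K dvd p ^ m" using A.lagrange[OF AK.K] less.prems(4) by (simp add: order_def) (metis dvd_triv_right)
    then obtain m' where m': "m' \<le> m" "order ?K = p ^ m'" using less.prems(3) divides_primepow_nat by blast
    have "order ?L dvd p ^ n" using B.lagrange[OF BL.K] less.prems(5) by (simp add: order_def) (metis dvd_triv_right)
    then obtain n' where n': "order ?L = p ^ n'" using less.prems(3) divides_primepow_nat by blast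
    have "m' \<noteq> m"
    proof
      assume "m' = m"
      then have "K = carrier A" using m' less.prems(4) fA subgroup.subset[OF AK.K]
        by (intro card_subset_eq) (auto simp: order_def)
      then have "a [^]\<^bsub>A\<^esub> (1::nat) = \<one>\<^bsub>A\<^esub>" using AK.triv[of 1] AK.a by simp
      then have "A.ord a = 1" using AK.a by (simp add: A.ord_eq_1)
      then show False using K(2) p1 one_less_power[OF p1, of "Suc s"] by simp
    qed
    then have "?K \<cong> ?L" using less.IH[of m' ?K ?L n'] m' n' cK cL tc less.prems(3) by simp
    then show ?thesis using iso_of_splittings[OF K(1) L(1)] K(2) L(2) by simp
  qed
qed

section \<open>Groups with cyclic commutator subgroup\<close>

definition conj_by :: "('a, 'b) monoid_scheme \<Rightarrow> 'a \<Rightarrow> 'a \<Rightarrow> 'a" where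
  "conj_by G g x = g \<otimes>\<^bsub>G\<^esub> x \<otimes>\<^bsub>G\<^esub> inv\<^bsub>G\<^esub> g"

context group
begin

lemma conj_by_closed [simp]: "g \<in> carrier G \<Longrightarrow> x \<in> carrier G \<Longrightarrow> conj_by G g x \<in> carrier G"
  by (simp add: conj_by_def)

lemma conj_by_mult:
  assumes "g \<in> carrier G" "x \<in> carrier G" "y \<in> carrier G"
  shows "conj_by G g (x \<otimes> y) = conj_by G g x \<otimes> conj_by G g y"
proof -
  have "conj_by G g x \<otimes> conj_by G g y = g \<otimes> x \<otimes> (inv g \<otimes> g) \<otimes> y \<otimes> inv g"
    unfolding conj_by_def using assms by (simp only: m_assoc m_closed inv_closed)
  then show ?thesis using assms by (simp add: conj_by_def m_assoc)
qed

lemma conj_by_pow: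
  assumes "g \<in> carrier G" "x \<in> carrier G"
  shows "conj_by G g (x [^] (i::nat)) = conj_by G g x [^] i"
  by (induction i) (use assms in \<open>auto simp: conj_by_mult\<close>, simp add: conj_by_def)

lemma conj_by_compose:
  assumes "g \<in> carrier G" "h \<in> carrier G" "x \<in> carrier G"
  shows "conj_by G (g \<otimes> h) x = conj_by G g (conj_by G h x)"
  using assms by (simp add: conj_by_def m_assoc inv_mult_group)

lemma conj_by_commute_iff:
  assumes "g \<in> carrier G" "x \<in> carrier G"
  shows "conj_by G g x = x \<longleftrightarrow> g \<otimes> x = x \<otimes> g"
  unfolding conj_by_def using assms by (metis inv_solve_right m_closed)

lemma conj_by_move:
  assumes "g \<in> carrier G" "x \<in> carrier G"
  shows "g \<otimes> x = conj_by G g x \<otimes> g"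
  unfolding conj_by_def using assms by (simp add: m_assoc)

lemma conj_by_cancel:
  assumes "g \<in> carrier G" "x \<in> carrier G" "y \<in> carrier G" "conj_by G g x = conj_by G g y"
  shows "x = y"
  using assms unfolding conj_by_def by (metis inv_closed l_cancel m_closed r_cancel)

lemma centralizer_subgroup:
  assumes "S \<subseteq> carrier G"
  shows "subgroup (centralizer G S) G"
proof (rule subgroupI)
  fix x y assume x: "x \<in> centralizer G S" and y: "y \<in> centralizer G S"
  { fix s assume s: "s \<in> S"
    have "x \<otimes> s = s \<otimes> x" "y \<otimes> s = s \<otimes> y" "x \<in> carrier G" "y \<in> carrier G" "s \<in> carrier G"
      using x y s assms by (auto simp: centralizer_def)
    then have "x \<otimes> y \<otimes> s = s \<otimes> (x \<otimes> y)" by (metis m_assoc) }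
  then show "x \<otimes> y \<in> centralizer G S" using x y by (auto simp: centralizer_def)
next
  fix x assume x: "x \<in> centralizer G S"
  { fix s assume s: "s \<in> S"
    have h: "x \<otimes> s = s \<otimes> x" "x \<in> carrier G" "s \<in> carrier G"
      using x s assms by (auto simp: centralizer_def)
    then have "s = inv x \<otimes> (s \<otimes> x)" by (metis inv_closed inv_solve_left m_closed)
    then have "inv x \<otimes> s = s \<otimes> inv x" using h by (metis inv_closed inv_solve_right m_assoc m_closed) }
  then show "inv x \<in> centralizer G S" using x by (auto simp: centralizer_def)
qed (use assms in \<open>auto simp: centralizer_def intro!: exI[of _ "\<one>"]\<close>)

lemma subgroup_pow_closed: "subgroup S G \<Longrightarrow> x \<in> S \<Longrightarrow> x [^] (i::nat) \<in> S"
  by (metis subgroup_int_pow_closed int_pow_int)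

lemma comm_derived:
  assumes "g \<in> carrier G" "x \<in> carrier G"
  shows "inv x \<otimes> conj_by G g x \<in> derived G (carrier G)"
proof -
  have "inv x \<otimes> conj_by G g x = inv x \<otimes> g \<otimes> inv (inv x) \<otimes> inv g"
    using assms by (simp add: conj_by_def m_assoc)
  then show ?thesis unfolding derived_def using assms by (intro generate.incl) blast
qed

lemma center_conj_by_iff:
  assumes "x \<in> carrier G"
  shows "x \<in> centralizer G (carrier G) \<longleftrightarrow> (\<forall>g\<in>carrier G. conj_by G g x = x)"
  using assms conj_by_commute_iff by (auto simp: centralizer_def eq_commute)

end

section \<open>Conjugation and power maps when the commutator subgroup is generated by
  \<open>a\<close>\<close>

locale cyclic_derived = group G for G (structure) +
  fixes p n :: nat and a
  assumes p: "Factorial_Ring.prime p" and podd: "odd p"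
    and fin: "finite (carrier G)" and p_group: "\<exists>N. order G = p ^ N"
    and a [simp]: "a \<in> carrier G" and ord_a: "ord a = p ^ n"
    and derived_eq: "derived G (carrier G) = {a [^] i | i :: nat. True}"
begin

abbreviation "D \<equiv> derived G (carrier G)"
abbreviation "C \<equiv> centralizer G D"
abbreviation "Z \<equiv> centralizer G (carrier G)"

lemma p1: "p > 1" using p prime_gt_1_nat by blast

lemma D_subgroup: "subgroup D G" by (rule derived_is_subgroup) simp

lemma D_carrier: "x \<in> D \<Longrightarrow> x \<in> carrier G"
  using subgroup.mem_carrier[OF D_subgroup] .

lemma a_pow_eq_iff: "a [^] (i::nat) = a [^] (j::nat) \<longleftrightarrow> i mod p ^ n = j mod p ^ n"
  using pow_eq_iff_mod_ord[OF fin a] ord_a by simp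

lemma a_pow_one_iff: "a [^] (i::nat) = \<one> \<longleftrightarrow> p ^ n dvd i"
  using pow_eq_id[OF a] ord_a by simp

lemma a_pow_D: "a [^] (i::nat) \<in> D" unfolding derived_eq by blast

lemma D_commute:
  assumes "x \<in> D" "y \<in> D" shows "x \<otimes> y = y \<otimes> x"
proof -
  obtain i j :: nat where "x = a [^] i" "y = a [^] j" using assms derived_eq by auto
  then show ?thesis by (simp add: nat_pow_mult add.commute)
qed

lemma C_iff: "g \<in> C \<longleftrightarrow> g \<in> carrier G \<and> conj_by G g a = a"
proof
  assume "g \<in> C"
  then show "g \<in> carrier G \<and> conj_by G g a = a"
    using a_pow_D[of 1] by (simp add: centralizer_def conj_by_commute_iff)
next
  assume g: "g \<in> carrier G \<and> conj_by G g a = a"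
  { fix x assume "x \<in> D"
    then obtain i where i: "x = a [^] (i::nat)" using derived_eq by auto
    then have "conj_by G g x = x" using g by (simp add: conj_by_pow)
    then have "g \<otimes> x = x \<otimes> g" using g i by (simp add: conj_by_commute_iff) }
  then show "g \<in> C" using g by (auto simp: centralizer_def)
qed

lemma C_subgroup: "subgroup C G"
  by (rule centralizer_subgroup) (use D_carrier in auto)

lemma C_carrier: "x \<in> C \<Longrightarrow> x \<in> carrier G" by (simp add: centralizer_def)

lemma C_D_commute: "x \<in> C \<Longrightarrow> y \<in> D \<Longrightarrow> x \<otimes> y = y \<otimes> x" by (simp add: centralizer_def)

lemma D_C: "x \<in> D \<Longrightarrow> x \<in> C" using D_carrier D_commute by (auto simp: centralizer_def)

lemma Z_subgroup: "subgroup Z G" by (rule centralizer_subgroup) simp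

lemma conj_by_D: "g \<in> carrier G \<Longrightarrow> x \<in> D \<Longrightarrow> conj_by G g x \<in> D"
  unfolding conj_by_def by (metis derived_self_is_normal normal.inv_op_closed2)

lemma conj_by_C:
  assumes "g \<in> carrier G" "c \<in> C"
  obtains b where "b \<in> D" "conj_by G g c = c \<otimes> b"
proof -
  have "conj_by G g c = c \<otimes> (inv c \<otimes> conj_by G g c)"
    using assms C_carrier by (simp add: m_assoc[symmetric])
  then show ?thesis using comm_derived[OF assms(1) C_carrier[OF assms(2)]] that by blast
qed

text \<open>As \<open>g\<close> has \<open>p\<close>-power order, some \<open>p\<close>-power of
  \<open>r\<close> is 1 modulo \<open>p ^ n\<close>. By Fermat's little theorem \<open>r\<close> is
  congruent modulo \<open>p\<close> to all its \<open>p\<close>-powers, hence to 1.\<close>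

lemma action_exponent:
  assumes g: "g \<in> carrier G"
  shows "\<exists>r. conj_by G g a = a [^] r \<and> r mod p = 1 mod p"
proof (cases "n = 0")
  case True
  then have "a = \<one>" using ord_a ord_eq_1[OF a] by simp
  \<comment> \<open>For trivial \<open>D\<close> every exponent describes the action, and 1 has the
    right residue.\<close>
  then have "conj_by G g a = a [^] (1::nat)" using g by (simp add: conj_by_def)
  then show ?thesis by (intro exI[of _ 1]) auto
next
  case False
  obtain r where r: "conj_by G g a = a [^] (r::nat)"
    using conj_by_D[OF g a_pow_D[of 1]] derived_eq by auto
  obtain N where N: "order G = p ^ N" using p_group by blast
  have it: "conj_by G (g [^] v) a = a [^] (r ^ v)" for v :: nat
  proof (induction v)
    case 0 show ?case by (simp add: conj_by_def)
  next
    case (Suc v)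
    have "conj_by G (g [^] Suc v) a = conj_by G (g [^] v) (conj_by G g a)" using g by (simp add: conj_by_compose)
    also have "\<dots> = a [^] (r ^ v * r)" using g by (simp add: r conj_by_pow Suc nat_pow_pow)
    finally show ?case by (simp add: mult.commute)
  qed
  have "g [^] (p ^ N) = \<one>" using pow_order_eq_1[OF g] N by simp
  then have "a [^] (r ^ (p ^ N)) = a [^] (1::nat)" using it[of "p ^ N"] by (simp add: conj_by_def)
  then have "r ^ (p ^ N) mod p ^ n = 1 mod p ^ n" by (simp only: a_pow_eq_iff)
  then have "r ^ (p ^ N) mod p = 1 mod p"
    using False by (metis dvd_power mod_mod_cancel neq0_conv)
  moreover have "r ^ (p ^ M) mod p = r mod p" for M
  proof (induction M)
    case (Suc M)
    \<comment> \<open>Fermat's little theorem, from the binomial expansion of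
      \<open>(x + 1) ^ p\<close>.\<close>
    have "x ^ p mod p = x mod p" for x :: nat
    proof (induction x)
      case (Suc x)
      have "p dvd (p choose j) * x ^ j" if "j \<in> {0<..<p}" for j
        using dvd_choose_prime[of j p] that p by simp
      then have "p dvd (\<Sum>j\<in>{0<..<p}. (p choose j) * x ^ j)" by (rule dvd_sum)
      moreover have "{..p} = insert 0 (insert p {0<..<p})" using p1 by auto
      then have "(\<Sum>j\<le>p. (p choose j) * x ^ j) = 1 + x ^ p + (\<Sum>j\<in>{0<..<p}. (p choose j) * x ^ j)"
        using p1 by simp
      moreover have "(x + 1) ^ p = (\<Sum>j\<le>p. (p choose j) * x ^ j)"
        using binomial_ring[of x 1 p] by simp
      ultimately have "(x + 1) ^ p mod p = (1 + x ^ p) mod p" by (auto simp: mod_add_right_eq[symmetric])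
      then show ?case using Suc by (metis Suc_eq_plus1 add.commute mod_add_right_eq)
    qed (use p1 in \<open>simp add: power_0_left\<close>)
    then show ?case using Suc by (simp add: mult.commute[of p] power_mult)
  qed simp
  ultimately show ?thesis using r by auto
qed

text \<open>One more conjugation takes a new \<open>b\<close> from \<open>c\<close> and raises the
  old power of \<open>b\<close> to \<open>r\<close>, so the exponent obeys
  \<open>1 + r * geo r v = geo r (Suc v)\<close>.\<close>

lemma iterate_conj_by:
  assumes g: "g \<in> carrier G" and c: "c \<in> C" and b: "b \<in> D"
    and cg: "conj_by G g c = c \<otimes> b" and bg: "conj_by G g b = b [^] r"
  shows "conj_by G (g [^] (v::nat)) c = c \<otimes> b [^] geo r v"
proof (induction v)
  case 0 show ?case using C_carrier[OF c] by (simp add: conj_by_def)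
next
  case (Suc v)
  note cc = C_carrier[OF c] D_carrier[OF b]
  have "conj_by G (g [^] Suc v) c = conj_by G (g \<otimes> g [^] v) c" using g by (metis nat_pow_Suc2)
  also have "\<dots> = conj_by G g (c \<otimes> b [^] geo r v)" using g cc Suc by (simp add: conj_by_compose)
  also have "\<dots> = (c \<otimes> b) \<otimes> (b [^] r) [^] geo r v" using g cc by (simp add: conj_by_mult conj_by_pow cg bg)
  also have "\<dots> = c \<otimes> b [^] (1 + r * geo r v)" using cc by (simp add: m_assoc nat_pow_pow nat_pow_Suc2[symmetric] del: nat_pow_Suc)
  also have "1 + r * geo r v = geo r (Suc v)" using pow_eq_1_plus[of r v] by simp
  finally show ?case .
qed

text \<open>Moving the next \<open>c\<close> to the left past \<open>g [^] v\<close> leaves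
  \<open>b [^] geo r v\<close>. These powers commute with \<open>c\<close>, so their exponents add
  up to \<open>geo2\<close>.\<close>

lemma pow_product:
  assumes g: "g \<in> carrier G" and c: "c \<in> C" and b: "b \<in> D"
    and cg: "conj_by G g c = c \<otimes> b" and bg: "conj_by G g b = b [^] r"
  shows "(c \<otimes> g) [^] (v::nat) = c [^] v \<otimes> b [^] geo2 r v \<otimes> g [^] v"
proof (induction v)
  case (Suc v)
  note cc = C_carrier[OF c] D_carrier[OF b]
  have cb: "b [^] i \<otimes> c = c \<otimes> b [^] i" for i :: nat
    using C_D_commute[OF c subgroup_pow_closed[OF D_subgroup b]] by simp
  have "(c \<otimes> g) [^] Suc v = c [^] v \<otimes> b [^] geo2 r v \<otimes> (g [^] v \<otimes> c) \<otimes> g"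
    using Suc cc g by (simp add: m_assoc)
  also have "g [^] v \<otimes> c = c \<otimes> b [^] geo r v \<otimes> g [^] v"
    using conj_by_move[of "g [^] v" c] iterate_conj_by[OF assms, of v] g cc by simp
  also have "c [^] v \<otimes> b [^] geo2 r v \<otimes> (c \<otimes> b [^] geo r v \<otimes> g [^] v) \<otimes> g
    = c [^] v \<otimes> (b [^] geo2 r v \<otimes> c) \<otimes> b [^] geo r v \<otimes> g [^] Suc v"
    using cc g by (simp add: m_assoc)
  also have "\<dots> = c [^] Suc v \<otimes> (b [^] geo2 r v \<otimes> b [^] geo r v) \<otimes> g [^] Suc v"
    unfolding cb using cc g by (simp add: m_assoc)
  also have "\<dots> = c [^] Suc v \<otimes> b [^] geo2 r (Suc v) \<otimes> g [^] Suc v"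
    using cc by (simp add: nat_pow_mult)
  finally show ?case .
qed (use g c b in simp)

text \<open>The subgroup \<open>M m\<close> of the overview; the powers form a subgroup because
  \<open>D\<close> is cyclic.\<close>

definition Dpow :: "nat \<Rightarrow> 'a set" where
  "Dpow m = {x [^] (p ^ m) | x. x \<in> D}"

lemma Dpow_eq: "Dpow m = {a [^] (p ^ m * i) | i. True}"
  unfolding Dpow_def derived_eq using a by (auto simp: nat_pow_pow mult.commute) (metis mult.commute nat_pow_pow a)

lemma Dpow_D: "x \<in> Dpow m \<Longrightarrow> x \<in> D"
  using Dpow_eq a_pow_D by auto

lemma Dpow_subgroup: "subgroup (Dpow m) G"
proof (rule finite_subgroupI)
  show "\<one> \<in> Dpow m" unfolding Dpow_eq by (auto intro!: exI[of _ 0])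
  fix x y assume "x \<in> Dpow m" "y \<in> Dpow m"
  then obtain i j where "x = a [^] (p ^ m * i)" "y = a [^] (p ^ m * j)" unfolding Dpow_eq by auto
  then have "x \<otimes> y = a [^] (p ^ m * (i + j))" by (simp add: nat_pow_mult distrib_left)
  then show "x \<otimes> y \<in> Dpow m" unfolding Dpow_eq by blast
qed (use fin Dpow_D D_carrier in auto)

lemma Dpow_normal: "Dpow m \<lhd> G"
proof -
  { fix g x assume g: "g \<in> carrier G" and "x \<in> Dpow m"
    then obtain y where y: "y \<in> D" "x = y [^] (p ^ m)" by (auto simp: Dpow_def)
    then have "conj_by G g x = conj_by G g y [^] (p ^ m)" using g D_carrier by (simp add: conj_by_pow)
    then have "conj_by G g x \<in> Dpow m" using conj_by_D[OF g y(1)] by (auto simp: Dpow_def) }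
  then show ?thesis unfolding normal_inv_iff using Dpow_subgroup by (simp add: conj_by_def)
qed

lemma card_Dpow: assumes "m \<le> n" shows "card (Dpow m) = p ^ (n - m)"
proof -
  have "Dpow m = (\<lambda>i. a [^] (p ^ m * i)) ` {..<p ^ (n - m)}"
  proof
    show "Dpow m \<subseteq> (\<lambda>i. a [^] (p ^ m * i)) ` {..<p ^ (n - m)}"
    proof
      fix x assume "x \<in> Dpow m"
      then obtain i where "x = a [^] (p ^ m * i)" unfolding Dpow_eq by auto
      moreover have "p ^ n = p ^ m * p ^ (n - m)" using assms by (simp add: power_add[symmetric])
      then have "p ^ m * (i mod p ^ (n - m)) = p ^ m * i mod p ^ n" by (metis mult_mod_right)
      then have "a [^] (p ^ m * i) = a [^] (p ^ m * (i mod p ^ (n - m)))"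
        unfolding a_pow_eq_iff by simp
      ultimately show "x \<in> (\<lambda>i. a [^] (p ^ m * i)) ` {..<p ^ (n - m)}" using p1 by auto
    qed
  qed (auto simp: Dpow_eq)
  moreover have "inj_on (\<lambda>i. a [^] (p ^ m * i)) {..<p ^ (n - m)}"
  proof (rule inj_onI)
    fix i j assume ij: "i \<in> {..<p ^ (n - m)}" "j \<in> {..<p ^ (n - m)}" "a [^] (p ^ m * i) = a [^] (p ^ m * j)"
    have e: "p ^ n = p ^ m * p ^ (n - m)" using assms by (simp add: power_add[symmetric])
    have "p ^ m * i < p ^ n" "p ^ m * j < p ^ n" using ij p1 e by auto
    then have "p ^ m * i = p ^ m * j" using ij(3) by (simp add: a_pow_eq_iff)
    then show "i = j" using p1 by simp
  qed
  ultimately show ?thesis by (simp add: card_image)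
qed

lemma Dpow_0: "Dpow 0 = D" unfolding Dpow_eq derived_eq by simp

lemma Dpow_ge_n:
  assumes "n \<le> m" shows "Dpow m = {\<one>}"
proof -
  have "a [^] (p ^ m * i) = \<one>" for i
    unfolding a_pow_one_iff by (rule dvd_mult2) (rule le_imp_power_dvd[OF assms])
  then show ?thesis unfolding Dpow_eq by simp
qed

lemma D_pow_Dpow: assumes "b \<in> D" "p ^ k dvd i" "m \<le> k" shows "b [^] i \<in> Dpow m"
proof -
  have "p ^ m dvd i" using dvd_trans[OF le_imp_power_dvd[OF assms(3)] assms(2)] .
  then obtain j where j: "i = p ^ m * j" unfolding dvd_def by blast
  obtain l where l: "b = a [^] (l::nat)" using assms(1) derived_eq by auto
  have "b [^] i = a [^] (p ^ m * (l * j))" using l j by (simp add: nat_pow_pow mult_ac)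
  then show ?thesis unfolding Dpow_eq by blast
qed

lemma conj_by_D_pow:
  assumes "g \<in> carrier G" "conj_by G g a = a [^] r" "b \<in> D"
  shows "conj_by G g b = b [^] (r::nat)"
proof -
  obtain l where l: "b = a [^] (l::nat)" using assms(3) derived_eq by auto
  then show ?thesis using assms by (simp add: conj_by_pow nat_pow_pow mult.commute)
qed

text \<open>The discrepancies in the three claims are \<open>b\<close> raised to
  \<open>geo2 r (p ^ k)\<close>, \<open>geo r (p ^ k)\<close> and \<open>p ^ k\<close>. All three
  exponents are divisible by \<open>p ^ k\<close>, so for \<open>m \<le> k\<close> the discrepancies
  vanish modulo \<open>Dpow m\<close>.\<close>

lemma pow_mod_Dpow:
  assumes "m \<le> k" "c \<in> C" "g \<in> carrier G"
  shows "Dpow m #> ((c \<otimes> g) [^] (p ^ k)) = Dpow m #> (c [^] (p ^ k) \<otimes> g [^] (p ^ k))"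
    and "Dpow m #> (g [^] (p ^ k) \<otimes> c) = Dpow m #> (c \<otimes> g [^] (p ^ k))"
    and "Dpow m #> (g \<otimes> c [^] (p ^ k)) = Dpow m #> (c [^] (p ^ k) \<otimes> g)"
proof -
  interpret M: normal "Dpow m" G by (rule Dpow_normal)
  obtain b where b: "b \<in> D" "conj_by G g c = c \<otimes> b" using conj_by_C assms by blast
  obtain r where r: "conj_by G g a = a [^] r" "r mod p = 1 mod p" using action_exponent assms by blast
  have bg: "conj_by G g b = b [^] r" using conj_by_D_pow[OF assms(3) r(1) b(1)] .
  note cc = C_carrier[OF assms(2)] D_carrier[OF b(1)] assms(3)
  let ?P = "p ^ k"
  have swap: "c' \<otimes> x = x \<otimes> c'" if "c' \<in> C" "x \<in> Dpow m" for c' x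
    using C_D_commute[OF that(1) Dpow_D[OF that(2)]] .
  have cP: "c [^] ?P \<in> C" using subgroup_pow_closed[OF C_subgroup assms(2)] .
  have abs: "Dpow m #> (x \<otimes> y) = Dpow m #> y" if "x \<in> Dpow m" "y \<in> carrier G" for x y
    using coset_mult_assoc[OF M.subset M.mem_carrier[OF that(1)] that(2)]
      coset_join2[OF M.mem_carrier[OF that(1)] M.subgroup_axioms that(1)] by simp
  have x1: "b [^] geo2 r ?P \<in> Dpow m"
    by (rule D_pow_Dpow[OF b(1) geo2_prime_power_dvd[OF p podd r(2)] assms(1)])
  have "(c \<otimes> g) [^] ?P = b [^] geo2 r ?P \<otimes> (c [^] ?P \<otimes> g [^] ?P)"
    using pow_product[OF assms(3,2) b bg, of ?P] swap[OF cP x1] cc by (simp add: m_assoc[symmetric])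
  then show "Dpow m #> ((c \<otimes> g) [^] ?P) = Dpow m #> (c [^] ?P \<otimes> g [^] ?P)"
    using abs[OF x1] cc by simp
  have x2: "b [^] geo r ?P \<in> Dpow m"
    by (rule D_pow_Dpow[OF b(1) _ assms(1)]) (use prime_power_dvd_geo[OF p podd r(2)] in simp)
  have "g [^] ?P \<otimes> c = b [^] geo r ?P \<otimes> (c \<otimes> g [^] ?P)"
    using conj_by_move[of "g [^] ?P" c] iterate_conj_by[OF assms(3,2) b bg, of ?P] swap[OF assms(2) x2] cc
    by (simp add: m_assoc)
  then show "Dpow m #> (g [^] ?P \<otimes> c) = Dpow m #> (c \<otimes> g [^] ?P)"
    using abs[OF x2] cc by simp
  have x3: "b [^] ?P \<in> Dpow m" by (rule D_pow_Dpow[OF b(1) _ assms(1)]) simp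
  have "(c \<otimes> b) [^] ?P = c [^] ?P \<otimes> b [^] ?P"
    by (rule pow_mult_distrib[OF C_D_commute[OF assms(2) b(1)] cc(1,2)])
  then have "g \<otimes> c [^] ?P = b [^] ?P \<otimes> (c [^] ?P \<otimes> g)"
    using conj_by_move[of g "c [^] ?P"] conj_by_pow[of g c ?P] b(2) swap[OF cP x3] cc
    by (simp add: m_assoc[symmetric])
  then show "Dpow m #> (g \<otimes> c [^] ?P) = Dpow m #> (c [^] ?P \<otimes> g)"
    using abs[OF x3] cc by simp
qed

end

section \<open>Exponents of the conjugation action as residues modulo \<open>p ^ n\<close>\<close>

lemma power_eq_1_plus_geo: "r = 1 + x \<Longrightarrow> r ^ u = 1 + x * geo r u" for r x :: nat
  using pow_eq_1_plus[of r u] by (simp add: distrib_right)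

text \<open>For \<open>r = 1 + p ^ e * t\<close> the number on the left is \<open>r ^ u - 1\<close>,
  so the claim computes the order of \<open>r\<close> modulo \<open>p ^ n\<close>.\<close>

lemma dvd_power_minus_one_iff:
  assumes "Factorial_Ring.prime p" "odd p" "r mod p = 1 mod p" "e \<le> n" "coprime t p"
  shows "p ^ n dvd p ^ e * t * geo r u \<longleftrightarrow> p ^ (n - e) dvd (u::nat)"
proof -
  have p0: "p > 0" using assms(1) prime_gt_0_nat by blast
  have "p ^ n = p ^ e * p ^ (n - e)" using assms(4) by (simp add: power_add[symmetric])
  then have "p ^ n dvd p ^ e * t * geo r u \<longleftrightarrow> p ^ (n - e) dvd t * geo r u"
    using p0 by (simp add: mult.assoc)
  also have "\<dots> \<longleftrightarrow> p ^ (n - e) dvd geo r u"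
    by (rule coprime_dvd_mult_right_iff) (use assms(5) in \<open>simp add: coprime_commute\<close>)
  also have "\<dots> \<longleftrightarrow> p ^ (n - e) dvd u" by (rule prime_power_dvd_geo[OF assms(1-3)])
  finally show ?thesis .
qed

text \<open>There are \<open>p ^ (n - e)\<close> residues congruent to 1 modulo \<open>p ^ e\<close>, and as many distinct powers of \<open>r\<close>.\<close>
lemma ex_power_residue:
  assumes "Factorial_Ring.prime p" "odd p" "0 < e" "e \<le> n" "coprime t p"
    and r: "r = 1 + p ^ e * t" and s: "s mod p ^ e = 1 mod p ^ e"
  shows "\<exists>v. r ^ v mod p ^ n = s mod (p ^ n :: nat)"
proof -
  have p1: "p > 1" using assms(1) prime_gt_1_nat by blast
  have pe1: "p ^ e > 1" using p1 assms(3) by (rule one_less_power)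
  have rp: "r mod p = 1 mod p" using assms(3) 
  proof (cases e)
    case (Suc k)
    then have "r = 1 + p * (p ^ k * t)" by (simp add: r)
    then show ?thesis by (metis mod_mult_self2)
  qed simp
  have pn: "p ^ n = p ^ e * p ^ (n - e)" using assms(4) by (simp add: power_add[symmetric])
  define T where "T = {s. s < p ^ n \<and> s mod p ^ e = 1}"
  define f where "f = (\<lambda>v. r ^ v mod p ^ n)"
  have dv: "p ^ e dvd p ^ n" using assms(4) by (rule le_imp_power_dvd)
  have "T \<subseteq> (\<lambda>i. 1 + p ^ e * i) ` {..<p ^ (n - e)}"
  proof
    fix x assume "x \<in> T"
    then have x: "x < p ^ n" "x mod p ^ e = 1" by (auto simp: T_def)
    then have e: "x = 1 + p ^ e * (x div p ^ e)" by (metis add.commute mult_div_mod_eq)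
    moreover have "x div p ^ e < p ^ (n - e)" using x pn p1 by (metis less_mult_imp_div_less mult.commute)
    ultimately show "x \<in> (\<lambda>i. 1 + p ^ e * i) ` {..<p ^ (n - e)}" by (metis imageI lessThan_iff)
  qed
  then have cT: "card T \<le> p ^ (n - e)" by (metis card_image_le card_lessThan card_mono finite_imageI finite_lessThan le_trans)
  have fT: "f v \<in> T" for v
  proof -
    have "r mod p ^ e = 1" using pe1 unfolding r mod_mult_self2 by (rule mod_less)
    then have "r ^ v mod p ^ e = 1" using pe1 by (metis power_mod power_one mod_less)
    then show ?thesis using p1 dv by (simp add: f_def T_def mod_mod_cancel)
  qed
  have ne: "f v \<noteq> f w" if vw: "v < w" "w < p ^ (n - e)" for v w
  proof
    assume "f v = f w"
    then have "p ^ n dvd r ^ w - r ^ v" using vw p1 r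
      by (simp add: f_def mod_eq_dvd_iff_nat[symmetric] power_increasing)
    moreover have "r ^ w = r ^ v * r ^ (w - v)" using vw by (simp add: power_add[symmetric])
    moreover have "r ^ (w - v) = 1 + p ^ e * t * geo r (w - v)" by (rule power_eq_1_plus_geo[OF r])
    ultimately have "p ^ n dvd r ^ v * (p ^ e * t * geo r (w - v))" by (simp add: distrib_left)
    moreover have "coprime (p ^ n) (r ^ v)"
    proof -
      have "\<not> p dvd r" using rp p1 by (simp add: dvd_eq_mod_eq_0)
      then have "coprime p r" using assms(1) prime_imp_coprime by blast
      then show ?thesis by simp
    qed
    ultimately have "p ^ n dvd p ^ e * t * geo r (w - v)" by (simp add: coprime_dvd_mult_right_iff)
    then have "p ^ (n - e) dvd w - v" using dvd_power_minus_one_iff[OF assms(1,2) rp assms(4,5)] by simp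
    then show False using vw by (simp add: nat_dvd_not_less)
  qed
  have "inj_on f {..<p ^ (n - e)}"
    by (rule linorder_inj_onI') (use ne in auto)
  then have "card (f ` {..<p ^ (n - e)}) = p ^ (n - e)" by (simp add: card_image)
  moreover have "finite T" by (simp add: T_def)
  moreover have "f ` {..<p ^ (n - e)} \<subseteq> T" using fT by auto
  ultimately have "f ` {..<p ^ (n - e)} = T" using cT by (intro card_seteq) auto
  moreover have "s mod p ^ n \<in> T" using s p1 pe1 dv assms(3) by (simp add: T_def mod_mod_cancel)
  ultimately show ?thesis unfolding f_def by auto
qed

text \<open>Let \<open>e\<close> be the largest number up to \<open>n\<close> such that all
  conjugation exponents are 1 modulo \<open>p ^ e\<close>. If \<open>e < n\<close>, an element
  \<open>g0\<close> witnessing maximality has exponent \<open>1 + p ^ e * t\<close> with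
  \<open>t\<close> prime to \<open>p\<close>. Its powers realize every exponent that occurs, so each
  element differs from a power of \<open>g0\<close> by an element of \<open>C\<close>.\<close>

lemma (in cyclic_derived) ex_action_generator:
  "\<exists>g0 r e t. g0 \<in> carrier G \<and> conj_by G g0 a = a [^] r \<and> r = 1 + p ^ e * t \<and> r mod p = 1 mod p
    \<and> e \<le> n \<and> (e < n \<longrightarrow> coprime t p) \<and> (\<forall>g\<in>carrier G. \<exists>c\<in>C. \<exists>v::nat. g = c \<otimes> g0 [^] v)"
proof -
  define R where "R = (\<lambda>g. SOME r. conj_by G g a = a [^] r \<and> r mod p = 1 mod p)"
  have R: "conj_by G g a = a [^] R g" "R g mod p = 1 mod p" if "g \<in> carrier G" for g
    using someI_ex[OF action_exponent[OF that]] by (auto simp: R_def)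
  define S where "S = {e. e \<le> n \<and> (\<forall>g\<in>carrier G. R g mod p ^ e = 1 mod p ^ e)}"
  have fS: "finite S" by (rule finite_subset[of _ "{..n}"]) (auto simp: S_def)
  have "0 \<in> S" by (simp add: S_def)
  then have "Max S \<in> S" using fS Max_in by blast
  define e where "e = Max S"
  have e: "e \<le> n" "\<And>g. g \<in> carrier G \<Longrightarrow> R g mod p ^ e = 1 mod p ^ e"
    using \<open>Max S \<in> S\<close> by (auto simp: S_def e_def)
  show ?thesis
  proof (cases "e = n")
    case True
    { fix g assume g: "g \<in> carrier G"
      have "conj_by G g a = a [^] (1::nat)" using R(1)[OF g] e(2)[OF g] True a_pow_eq_iff by metis
      then have "g \<in> C" using g by (simp add: C_iff)
      moreover have "g = g \<otimes> \<one> [^] (0::nat)" using g by simp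
      ultimately have "\<exists>c\<in>C. \<exists>v::nat. g = c \<otimes> \<one> [^] v" by blast }
    moreover have "conj_by G \<one> a = a [^] (1::nat)" by (simp add: conj_by_def)
    \<comment> \<open>Here \<open>C\<close> is the whole group, and \<open>\<one>\<close> with
      exponent 1, hence with \<open>t = 0\<close>, serves as \<open>g0\<close>.\<close>
    ultimately show ?thesis using True
      by (intro exI[of _ "\<one>"] exI[of _ "1::nat"] exI[of _ n] exI[of _ "0::nat"]) auto
  next
    case False
    then have en: "e < n" using e by simp
    have "Suc e \<notin> S" using Max_ge[OF fS, of "Suc e"] by (auto simp: e_def)
    then obtain g0 where g0: "g0 \<in> carrier G" "R g0 mod p ^ Suc e \<noteq> 1 mod p ^ Suc e"
      using en unfolding S_def by auto
    \<comment> \<open>All exponents are 1 modulo \<open>p\<close>, so \<open>e\<close> is positive,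
      as \<open>ex_power_residue\<close> requires.\<close>
    have "1 \<in> S" using en R(2) by (simp add: S_def)
    then have e0: "0 < e" using Max_ge[OF fS, of 1] by (simp add: e_def)
    define r where "r = R g0"
    have rp: "r mod p = 1 mod p" using R(2) g0 by (simp add: r_def)
    have r1: "1 \<le> r" using rp p1 by (cases r) auto
    then have "p ^ e dvd r - 1" using e(2)[OF g0(1)] by (simp add: mod_eq_dvd_iff_nat[symmetric] r_def)
    then obtain t where "r - 1 = p ^ e * t" unfolding dvd_def by auto
    then have t: "r = 1 + p ^ e * t" using r1 by simp
    have "\<not> p dvd t"
    proof
      assume "p dvd t"
      then obtain u where "t = p * u" unfolding dvd_def by auto
      then have "r = 1 + p ^ Suc e * u" using t by simp
      then have "r mod p ^ Suc e = 1 mod p ^ Suc e" by (simp only: mod_mult_self2)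
      then show False using g0(2) unfolding r_def[symmetric] by blast
    qed
    then have ct: "coprime t p" using p prime_imp_coprime coprime_commute by blast
    { fix g assume g: "g \<in> carrier G"
      obtain v where v: "r ^ v mod p ^ n = R g mod p ^ n"
        using ex_power_residue[OF p podd e0 e(1) ct t e(2)[OF g]] by auto
      have it: "conj_by G (g0 [^] v) a = a [^] (r ^ v)" for v :: nat
      proof (induction v)
        case (Suc v)
        have "conj_by G (g0 [^] Suc v) a = conj_by G (g0 [^] v) (conj_by G g0 a)" using g0 by (simp add: conj_by_compose)
        also have "\<dots> = a [^] (r ^ v * r)" using g0 R(1)[OF g0(1)] by (simp add: conj_by_pow Suc nat_pow_pow r_def)
        finally show ?case by (simp add: mult.commute)
      qed (simp add: conj_by_def)
      have "conj_by G (g0 [^] v) a = conj_by G g a"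
        using it[of v] R(1)[OF g] v a_pow_eq_iff by metis
      define h where "h = g0 [^] v"
      define c where "c = inv h \<otimes> g"
      have h: "h \<in> carrier G" "c \<in> carrier G" "g = h \<otimes> c"
        using g g0 by (auto simp: c_def h_def m_assoc[symmetric])
      have "conj_by G h (conj_by G c a) = conj_by G h a"
        using \<open>conj_by G (g0 [^] v) a = conj_by G g a\<close> h by (simp add: conj_by_compose h_def)
      then have "conj_by G c a = a" using h by (metis a conj_by_cancel conj_by_closed)
      then have cC: "c \<in> C" using h by (simp add: C_iff)
      obtain b where "b \<in> D" "conj_by G h c = c \<otimes> b" using conj_by_C[OF h(1) cC] by blast
      then have "conj_by G h c \<in> C" using subgroup.m_closed[OF C_subgroup cC D_C] by simp
      moreover have "g = conj_by G h c \<otimes> g0 [^] v" using conj_by_move[OF h(1,2)] h by (simp add: h_def)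
      ultimately have "\<exists>c\<in>C. \<exists>v::nat. g = c \<otimes> g0 [^] v" by blast }
    then show ?thesis using g0(1) R(1)[OF g0(1)] t rp e(1) ct unfolding r_def[symmetric] by blast
  qed
qed

section \<open>The structure of the centralizer of the commutator subgroup\<close>

lemma centralizer_singleton:
  "x \<in> centralizer G {s} \<longleftrightarrow> x \<in> carrier G \<and> x \<otimes>\<^bsub>G\<^esub> s = s \<otimes>\<^bsub>G\<^esub> x"
  by (simp add: centralizer_def)

lemma (in group) conj_by_conj_by:
  assumes "g \<in> carrier G" "h \<in> carrier G" "x \<in> carrier G"
  shows "conj_by G g (conj_by G h x) = conj_by G (conj_by G g h) (conj_by G g x)"
proof -
  have "conj_by G g h \<otimes> g = g \<otimes> h" by (rule conj_by_move[OF assms(1,2), symmetric])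
  then show ?thesis using assms by (simp add: conj_by_compose[symmetric])
qed

lemma (in group) normal_coset_absorb:
  assumes "N \<lhd> G" "n \<in> N" "y \<in> carrier G"
  shows "N #> (y \<otimes> n) = N #> y"
proof -
  interpret N: normal N G by fact
  have "N #> (y \<otimes> n) = (N #> y) <#> (N #> n)"
    by (rule N.rcos_sum[OF assms(3) N.mem_carrier[OF assms(2)], symmetric])
  also have "N #> n = N #> \<one>"
    using coset_join2[OF N.mem_carrier[OF assms(2)] N.subgroup_axioms assms(2)] N.subset by simp
  also have "(N #> y) <#> (N #> \<one>) = N #> y"
    unfolding N.rcos_sum[OF assms(3) one_closed] using assms(3) by simp
  finally show ?thesis .
qed

text \<open>The group is \<open>C\<close> times the powers of \<open>g0\<close>. The case
  \<open>e = n\<close> means that \<open>D\<close> is central; in general the intersection of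
  \<open>Z\<close> with \<open>D\<close> turns out to have order \<open>p ^ e\<close>.\<close>

locale cyclic_derived_gen = cyclic_derived +
  fixes g0 and r e t :: nat
  assumes g0 [simp]: "g0 \<in> carrier G" and conj_a: "conj_by G g0 a = a [^] r" and r: "r = 1 + p ^ e * t"
    and r_mod: "r mod p = 1 mod p" and en: "e \<le> n" and ct: "e < n \<Longrightarrow> coprime t p"
    and all_C: "g \<in> carrier G \<Longrightarrow> \<exists>c\<in>C. \<exists>v::nat. g = c \<otimes> g0 [^] v"
begin

lemma dvd_iff: "p ^ n dvd p ^ e * t * geo r u \<longleftrightarrow> p ^ (n - e) dvd u"
proof (cases "e = n")
  case False
  then show ?thesis using dvd_power_minus_one_iff[OF p podd r_mod en ct] en by simp
qed (simp add: mult.assoc)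

lemma r_pow: "r ^ v = 1 + p ^ e * t * geo r v"
  by (rule power_eq_1_plus_geo[OF r])

lemma conj_D: "b \<in> D \<Longrightarrow> conj_by G g0 b = b [^] r"
  by (rule conj_by_D_pow[OF g0 conj_a])

lemma conj_pow_a: "conj_by G (g0 [^] (v::nat)) (a [^] (i::nat)) = a [^] (r ^ v * i)"
proof (induction v arbitrary: i)
  case (Suc v)
  have "conj_by G (g0 [^] Suc v) (a [^] i) = conj_by G (g0 [^] v) (conj_by G g0 (a [^] i))"
    by (simp add: conj_by_compose)
  also have "\<dots> = a [^] (r ^ v * (i * r))" using conj_D[OF a_pow_D] by (simp add: nat_pow_pow Suc)
  finally show ?case by (simp add: mult_ac)
qed (simp add: conj_by_def)

lemma g0_pow_C_iff: "g0 [^] (v::nat) \<in> C \<longleftrightarrow> p ^ (n - e) dvd v"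
proof -
  have "g0 [^] v \<in> C \<longleftrightarrow> a [^] (r ^ v) = a [^] (1::nat)"
    using conj_pow_a[of v 1] by (simp add: C_iff)
  also have "\<dots> \<longleftrightarrow> p ^ n dvd r ^ v - 1"
    unfolding a_pow_eq_iff by (rule mod_eq_dvd_iff_nat) (simp add: r_pow)
  finally show ?thesis using dvd_iff by (simp add: r_pow)
qed

lemma C_all: "e = n \<Longrightarrow> C = carrier G"
proof -
  assume "e = n"
  then have g: "g0 [^] v \<in> C" for v :: nat using g0_pow_C_iff by simp
  { fix x assume "x \<in> carrier G"
    then obtain c v where "c \<in> C" "x = c \<otimes> g0 [^] (v::nat)" using all_C by blast
    then have "x \<in> C" using g subgroup.m_closed[OF C_subgroup] by simp }
  then show ?thesis using C_carrier by blast
qed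

lemma conj_g0_fixes_iff: "conj_by G g0 (a [^] i) = a [^] i \<longleftrightarrow> p ^ (n - e) dvd (i::nat)"
proof -
  have "conj_by G g0 (a [^] i) = a [^] i \<longleftrightarrow> a [^] (i * r) = a [^] i"
    using conj_D[OF a_pow_D] by (simp add: nat_pow_pow)
  also have "\<dots> \<longleftrightarrow> p ^ n dvd i * r - i"
    unfolding a_pow_eq_iff by (rule mod_eq_dvd_iff_nat) (simp add: r)
  also have "i * r - i = p ^ e * t * i" by (simp add: r algebra_simps)
  also have "p ^ n dvd p ^ e * t * i \<longleftrightarrow> p ^ (n - e) dvd i"
  proof (cases "e = n")
    case False
    have "p ^ n = p ^ e * p ^ (n - e)" using en by (simp add: power_add[symmetric])
    then have "p ^ n dvd p ^ e * t * i \<longleftrightarrow> p ^ (n - e) dvd t * i" using p1 by (simp add: mult.assoc)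
    also have "\<dots> \<longleftrightarrow> p ^ (n - e) dvd i"
      by (rule coprime_dvd_mult_right_iff) (use ct False en in \<open>simp add: coprime_commute\<close>)
    finally show ?thesis .
  qed (simp add: mult.assoc)
  finally show ?thesis .
qed

lemma ZI:
  assumes x: "x \<in> carrier G" and c: "\<And>c. c \<in> C \<Longrightarrow> c \<otimes> x = x \<otimes> c" and g: "conj_by G g0 x = x"
  shows "x \<in> Z"
proof -
  have s: "subgroup (centralizer G {x}) G" by (rule centralizer_subgroup) (use x in simp)
  have g0c: "g0 \<in> centralizer G {x}" using g x by (simp add: centralizer_def conj_by_commute_iff)
  have Cc: "y \<in> centralizer G {x}" if "y \<in> C" for y using c[OF that] C_carrier[OF that] by (simp add: centralizer_def)
  { fix y assume "y \<in> carrier G"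
    then obtain d v where "d \<in> C" "y = d \<otimes> g0 [^] (v::nat)" using all_C by blast
    then have "y \<in> centralizer G {x}"
      using subgroup.m_closed[OF s Cc subgroup_pow_closed[OF s g0c]] by simp
    then have "x \<otimes> y = y \<otimes> x" by (simp add: centralizer_def) }
  then show ?thesis using x by (auto simp: centralizer_def)
qed

text \<open>An element of \<open>D\<close> already commutes with \<open>C\<close>, so it is central
  as soon as \<open>g0\<close> fixes it; for \<open>a [^] i\<close> this is a condition on
  \<open>i * (r - 1)\<close> modulo \<open>p ^ n\<close>.\<close>

lemma Z_Int_D: "Z \<inter> D = Dpow (n - e)"
proof
  show "Z \<inter> D \<subseteq> Dpow (n - e)"
  proof
    fix x assume x: "x \<in> Z \<inter> D"
    then obtain i where i: "x = a [^] (i::nat)" using derived_eq by auto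
    have "conj_by G g0 x = x" using x center_conj_by_iff[OF D_carrier, of x] g0 by blast
    then obtain j where "i = p ^ (n - e) * j" using conj_g0_fixes_iff i unfolding dvd_def by auto
    then show "x \<in> Dpow (n - e)" using i unfolding Dpow_eq by blast
  qed
  show "Dpow (n - e) \<subseteq> Z \<inter> D"
  proof
    fix x assume x: "x \<in> Dpow (n - e)"
    then obtain j where j: "x = a [^] (p ^ (n - e) * j)" unfolding Dpow_eq by auto
    then have g: "conj_by G g0 x = x" using conj_g0_fixes_iff by simp
    have "x \<in> D" using Dpow_D[OF x] .
    then show "x \<in> Z \<inter> D" using ZI[OF D_carrier _ g] C_D_commute by auto
  qed
qed

text \<open>Conjugation by \<open>g0\<close> multiplies \<open>c\<close> and \<open>d\<close> by
  elements of \<open>D\<close>, which commute with all of \<open>C\<close>. So \<open>g0\<close>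
  fixes the commutator of \<open>c\<close> and \<open>d\<close>, which lies in \<open>D\<close> and
  is therefore central.\<close>

lemma C_commutator:
  assumes c: "c \<in> C" and d: "d \<in> C"
  obtains b where "b \<in> Z \<inter> D" "conj_by G d c = c \<otimes> b"
proof -
  obtain b where b: "b \<in> D" "conj_by G d c = c \<otimes> b" using conj_by_C[OF C_carrier[OF d] c] by blast
  obtain x where x: "x \<in> D" "conj_by G g0 c = c \<otimes> x" using conj_by_C[OF g0 c] by blast
  obtain y where y: "y \<in> D" "conj_by G g0 d = d \<otimes> y" using conj_by_C[OF g0 d] by blast
  have fixD: "conj_by G z w = w" if "z \<in> C" "w \<in> D" for z w
    using C_D_commute[OF that] C_carrier[OF that(1)] D_carrier[OF that(2)] by (simp add: conj_by_commute_iff)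
  note cc = C_carrier[OF c] C_carrier[OF d] D_carrier[OF b(1)] D_carrier[OF x(1)] D_carrier[OF y(1)]
  have cx: "c \<otimes> x \<in> C" using subgroup.m_closed[OF C_subgroup c D_C[OF x(1)]] .
  have "conj_by G g0 (c \<otimes> b) = conj_by G (d \<otimes> y) (c \<otimes> x)"
    using conj_by_conj_by[OF g0 cc(2,1)] b x y by simp
  also have "\<dots> = conj_by G d (conj_by G y (c \<otimes> x))" using cc by (simp add: conj_by_compose)
  also have "conj_by G y (c \<otimes> x) = c \<otimes> x"
    using C_D_commute[OF cx y(1)] cc by (simp add: conj_by_commute_iff)
  also have "conj_by G d (c \<otimes> x) = (c \<otimes> b) \<otimes> x"
    using cc fixD[OF d x(1)] b(2) by (simp add: conj_by_mult)
  finally have "(c \<otimes> x) \<otimes> conj_by G g0 b = (c \<otimes> b) \<otimes> x"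
    using cc x(2) by (simp add: conj_by_mult)
  also have "\<dots> = (c \<otimes> x) \<otimes> b" using cc D_commute[OF b(1) x(1)] by (simp add: m_assoc)
  finally have "conj_by G g0 b = b" using cc by simp
  then have "b \<in> Z" using ZI[OF cc(3)] C_D_commute b by blast
  then show ?thesis using that b by blast
qed

text \<open>Otherwise \<open>g0\<close> commutes with \<open>C\<close> modulo
  \<open>Dpow (Suc 0)\<close>. Commutators inside \<open>C\<close> lie in
  \<open>Dpow (n - e)\<close>, hence in \<open>Dpow (Suc 0)\<close> because \<open>e < n\<close>.
  The quotient by \<open>Dpow (Suc 0)\<close> would then be abelian, which puts \<open>a\<close>
  into \<open>Dpow (Suc 0)\<close>.\<close>

lemma ex_c0:
  assumes "e < n"
  shows "\<exists>c0\<in>C. \<exists>j. coprime j p \<and> conj_by G g0 c0 = c0 \<otimes> a [^] (j::nat)"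
proof (rule ccontr)
  assume neg: "\<not> ?thesis"
  let ?N = "Dpow (Suc 0)"
  interpret N: normal ?N G by (rule Dpow_normal)
  interpret Q: group "G Mod ?N" by (rule N.factorgroup_is_group)
  note abs = normal_coset_absorb[OF Dpow_normal]
  have step: "?N #> (g \<otimes> c) = ?N #> (c \<otimes> g)" if "g \<in> carrier G" "c \<in> C" "b \<in> ?N" "conj_by G g c = c \<otimes> b" for g c b
  proof -
    have cc: "c \<in> carrier G" "b \<in> carrier G" using that C_carrier N.mem_carrier by auto
    have "?N #> (g \<otimes> c) = (?N #> (c \<otimes> b)) <#> (?N #> g)"
      using conj_by_move[of g c] that cc by (simp add: N.rcos_sum)
    also have "\<dots> = ?N #> (c \<otimes> g)" using abs[OF that(3)] cc that by (simp add: N.rcos_sum)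
    finally show ?thesis .
  qed
  have CC: "?N #> (d \<otimes> c) = ?N #> (c \<otimes> d)" if "c \<in> C" "d \<in> C" for c d
  proof -
    obtain b where b: "b \<in> Z \<inter> D" "conj_by G d c = c \<otimes> b" using C_commutator \<open>c \<in> C\<close> \<open>d \<in> C\<close> by blast
    have "b \<in> Dpow (n - e)" using b Z_Int_D by simp
    then obtain j where "b = a [^] (p ^ (n - e) * j)" unfolding Dpow_eq by auto
    moreover obtain k where "n - e = Suc k" using assms by (cases "n - e") auto
    ultimately have "b = a [^] (p ^ Suc 0 * (p ^ k * j))" by (simp add: mult.assoc)
    then have "b \<in> ?N" unfolding Dpow_eq by blast
    then show ?thesis using step[OF C_carrier[OF that(2)] that(1) _ b(2)] by blast
  qed
  have g0C: "?N #> (g0 \<otimes> c) = ?N #> (c \<otimes> g0)" if cC: "c \<in> C" for c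
  proof -
    obtain b where b: "b \<in> D" "conj_by G g0 c = c \<otimes> b" using conj_by_C[OF g0 cC] by blast
    then obtain j where j: "b = a [^] (j::nat)" using derived_eq by auto
    have "\<not> coprime j p" using neg b that j by blast
    then have "p dvd j" using p prime_imp_coprime coprime_commute by blast
    then obtain k where "j = p ^ Suc 0 * k" unfolding dvd_def by auto
    then have "b \<in> ?N" using j unfolding Dpow_eq by blast
    then show ?thesis using step[OF g0 that _ b(2)] by blast
  qed
  let ?\<pi> = "\<lambda>x. ?N #> x"
  have pim: "?\<pi> (x \<otimes> y) = ?\<pi> x \<otimes>\<^bsub>G Mod ?N\<^esub> ?\<pi> y" if "x \<in> carrier G" "y \<in> carrier G" for x y
    using that by (simp add: N.rcos_sum)
  have pic: "?\<pi> x \<in> carrier (G Mod ?N)" if "x \<in> carrier G" for x using that by (auto simp: carrier_FactGroup)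
  have com: "?\<pi> x \<otimes>\<^bsub>G Mod ?N\<^esub> ?\<pi> y = ?\<pi> y \<otimes>\<^bsub>G Mod ?N\<^esub> ?\<pi> x"
    if x: "x \<in> carrier G" and y: "y \<in> carrier G" for x y
  proof -
    \<comment> \<open>A subgroup of the quotient containing the images of \<open>C\<close> and of
      \<open>g0\<close> is everything. Commutation is checked on these generators and extended in
      one argument after the other.\<close>
    have gen: "?\<pi> z \<in> S"
      if z: "z \<in> carrier G" and S: "subgroup S (G Mod ?N)" and c: "\<And>c. c \<in> C \<Longrightarrow> ?\<pi> c \<in> S" and g: "?\<pi> g0 \<in> S" for z S
    proof -
      obtain c' v where z': "c' \<in> C" "z = c' \<otimes> g0 [^] (v::nat)" using all_C[OF z] by blast
      have "?\<pi> (g0 [^] v) \<in> S" for v :: nat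
      proof (induction v)
        case 0
        have "?\<pi> \<one> = \<one>\<^bsub>G Mod ?N\<^esub>" using N.subset by simp
        then show ?case using subgroup.one_closed[OF S] by simp
      next
        case (Suc v) then show ?case using pim[of "g0 [^] v" g0] subgroup.m_closed[OF S] g by simp
      qed
      then show ?thesis using z' pim[of c' "g0 [^] v"] C_carrier[OF z'(1)] subgroup.m_closed[OF S c[OF z'(1)]] by simp
    qed
    have "?\<pi> w \<in> centralizer (G Mod ?N) {?\<pi> c}" if w: "w \<in> carrier G" and c: "c \<in> C" for w c
    proof (rule gen[OF w])
      show "subgroup (centralizer (G Mod ?N) {?\<pi> c}) (G Mod ?N)"
        by (rule Q.centralizer_subgroup) (use pic C_carrier[OF c] in simp)
    next
      fix d assume d: "d \<in> C"
      show "?\<pi> d \<in> centralizer (G Mod ?N) {?\<pi> c}"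
        unfolding centralizer_singleton using CC[OF c d] pim[of d c] pim[of c d] pic C_carrier[OF c] C_carrier[OF d] by simp
    next
      show "?\<pi> g0 \<in> centralizer (G Mod ?N) {?\<pi> c}"
        unfolding centralizer_singleton using g0C[OF c] pim[of g0 c] pim[of c g0] pic C_carrier[OF c] by simp
    qed
    then have 1: "?\<pi> w \<otimes>\<^bsub>G Mod ?N\<^esub> ?\<pi> c = ?\<pi> c \<otimes>\<^bsub>G Mod ?N\<^esub> ?\<pi> w" if "w \<in> carrier G" "c \<in> C" for w c
      using that unfolding centralizer_singleton by blast
    have "?\<pi> y \<in> centralizer (G Mod ?N) {?\<pi> g0}"
    proof (rule gen[OF y])
      show "subgroup (centralizer (G Mod ?N) {?\<pi> g0}) (G Mod ?N)"
        by (rule Q.centralizer_subgroup) (use pic in simp)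
    next
      fix d assume d: "d \<in> C"
      show "?\<pi> d \<in> centralizer (G Mod ?N) {?\<pi> g0}"
        unfolding centralizer_singleton using 1[OF g0 d] pic[OF C_carrier[OF d]] by simp
    next
      show "?\<pi> g0 \<in> centralizer (G Mod ?N) {?\<pi> g0}"
        unfolding centralizer_singleton using pic[OF g0] by simp
    qed
    then have 2: "?\<pi> y \<otimes>\<^bsub>G Mod ?N\<^esub> ?\<pi> g0 = ?\<pi> g0 \<otimes>\<^bsub>G Mod ?N\<^esub> ?\<pi> y" by (simp only: centralizer_singleton)
    have "?\<pi> x \<in> centralizer (G Mod ?N) {?\<pi> y}"
    proof (rule gen[OF x])
      show "subgroup (centralizer (G Mod ?N) {?\<pi> y}) (G Mod ?N)"
        by (rule Q.centralizer_subgroup) (use pic y in simp)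
    next
      fix d assume d: "d \<in> C"
      show "?\<pi> d \<in> centralizer (G Mod ?N) {?\<pi> y}"
        unfolding centralizer_singleton using 1[OF y d] pic[OF C_carrier[OF d]] by simp
    next
      show "?\<pi> g0 \<in> centralizer (G Mod ?N) {?\<pi> y}"
        unfolding centralizer_singleton using pic[OF g0] 2 by simp
    qed
    then show ?thesis by (simp only: centralizer_singleton)
  qed
  have "comm_group (G Mod ?N)"
    by (rule Q.group_comm_groupI) (use com in \<open>auto simp: carrier_FactGroup\<close>)
  then have "D \<subseteq> ?N" by (rule derived_minimal[OF Dpow_normal])
  then have "a [^] (1::nat) \<in> ?N" using a_pow_D by blast
  then obtain i where "a [^] (1::nat) = a [^] (p * i)" unfolding Dpow_eq by auto
  then have "1 mod p ^ n = p * i mod p ^ n" by (simp only: a_pow_eq_iff)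
  then have "1 mod p = p * i mod p" using assms by (metis dvd_power mod_mod_cancel not_less_zero bot_nat_0.not_eq_extremum)
  then show False using p1 by simp
qed

end

lemma coprime_inverse_nat:
  assumes "coprime x p" "Suc 0 < p"
  shows "\<exists>w z. x * w = p ^ n * z + (1::nat)"
proof -
  have "x \<noteq> 0" using assms by (cases x) auto
  moreover have "gcd x (p ^ n) = 1" using assms(1) by simp
  ultimately show ?thesis using bezout_nat[of x "p ^ n"] by presburger
qed

context cyclic_derived_gen
begin

text \<open>One inclusion is \<open>C_commutator\<close>. For the other, the power
  \<open>v = p ^ (n - e)\<close> of \<open>g0\<close> lies in \<open>C\<close>, and its commutator
  with the element of \<open>ex_c0\<close> is \<open>a\<close> to the power \<open>v\<close> times a
  number prime to \<open>p\<close>, which generates \<open>Dpow (n - e)\<close>.\<close>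

lemma derived_C: "derived G C = Dpow (n - e)"
proof
  have "derived_set G C \<subseteq> Dpow (n - e)"
  proof
    fix x assume "x \<in> derived_set G C"
    then obtain d c where dc: "d \<in> C" "c \<in> C" "x = d \<otimes> c \<otimes> inv d \<otimes> inv c" by auto
    obtain b where b: "b \<in> Z \<inter> D" "conj_by G d c = c \<otimes> b" using C_commutator[OF dc(2,1)] by blast
    have "x = conj_by G d c \<otimes> inv c" using dc by (simp add: conj_by_def)
    also have "\<dots> = b \<otimes> c \<otimes> inv c" using b C_D_commute[OF dc(2)] by simp
    also have "\<dots> = b" using b D_carrier C_carrier[OF dc(2)] by (simp add: m_assoc)
    finally show "x \<in> Dpow (n - e)" using b Z_Int_D by simp
  qed
  then show "derived G C \<subseteq> Dpow (n - e)"
    unfolding derived_def[of G C] by (rule generate_subgroup_incl) (rule Dpow_subgroup)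
  show "Dpow (n - e) \<subseteq> derived G C"
  proof (cases "e = n")
    case True
    then show ?thesis using C_all Dpow_0 by simp
  next
    case False
    then have lt: "e < n" using en by simp
    obtain c0 j where c0: "c0 \<in> C" "coprime j p" "conj_by G g0 c0 = c0 \<otimes> a [^] (j::nat)"
      using ex_c0[OF lt] by blast
    define v where "v = p ^ (n - e)"
    obtain y where y: "coprime y p" "geo r v = v * y"
      using geo_prime_power[OF p podd r_mod] unfolding v_def by blast
    have sD: "subgroup (derived G C) G" by (rule derived_is_subgroup) (use C_carrier in auto)
    have dC: "g0 [^] v \<in> C" by (simp add: g0_pow_C_iff v_def)
    have "conj_by G (g0 [^] v) c0 = c0 \<otimes> (a [^] j) [^] geo r v"
      by (rule iterate_conj_by[OF g0 c0(1) a_pow_D c0(3) conj_D[OF a_pow_D]])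
    then have cj: "conj_by G (g0 [^] v) c0 = a [^] (v * (j * y)) \<otimes> c0"
      using C_D_commute[OF c0(1) a_pow_D] by (simp add: nat_pow_pow y mult_ac)
    have "g0 [^] v \<otimes> c0 \<otimes> inv (g0 [^] v) \<otimes> inv c0 \<in> derived G C"
      unfolding derived_def[of G C] by (rule generate.incl) (use dC c0(1) in blast)
    moreover have "g0 [^] v \<otimes> c0 \<otimes> inv (g0 [^] v) \<otimes> inv c0 = a [^] (v * (j * y))"
      unfolding cj[unfolded conj_by_def] using C_carrier[OF c0(1)] by (simp add: m_assoc)
    ultimately have aw: "a [^] (v * (j * y)) \<in> derived G C" by simp
    \<comment> \<open>\<open>w\<close> inverts the cofactor \<open>j * y\<close> modulo
      \<open>p ^ n\<close>.\<close>
    obtain w z where wz: "(j * y) * w = p ^ n * z + 1"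
      using coprime_inverse_nat[of "j * y" p n] c0(2) y(1) p1 by auto
    show ?thesis
    proof
      fix x assume "x \<in> Dpow (n - e)"
      then obtain i where i: "x = a [^] (v * i)" unfolding Dpow_eq v_def by auto
      have "v * (j * y) * (w * i) = v * i + p ^ n * (z * v * i)"
      proof -
        have "v * (j * y) * (w * i) = (j * y * w) * (v * i)" by (simp only: mult_ac)
        also have "\<dots> = v * i + p ^ n * (z * v * i)"
          unfolding wz by (simp only: distrib_right distrib_left mult_1 mult_1_right mult_ac add_ac)
        finally show ?thesis .
      qed
      then have "a [^] (v * (j * y) * (w * i)) = x" using i by (simp only: a_pow_eq_iff mod_mult_self2)
      then have "x = (a [^] (v * (j * y))) [^] (w * i)" by (simp only: nat_pow_pow[OF a])
      then show "x \<in> derived G C" using subgroup_pow_closed[OF sD aw] by simp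
    qed
  qed
qed

lemma Z_C: "z \<in> Z \<Longrightarrow> z \<in> C" using D_carrier by (auto simp: centralizer_def)

text \<open>Commutators inside \<open>C\<close> have order dividing \<open>p ^ e\<close>, so the
  power already commutes with \<open>C\<close>. A suitable \<open>a [^] j\<close> corrects it to an
  element that \<open>g0\<close> fixes as well.\<close>

lemma pow_C_mem:
  assumes c: "c \<in> C"
  shows "c [^] (p ^ e) \<in> Z <#> D"
proof -
  let ?q = "p ^ e"
  have b_one: "b [^] ?q = \<one>" if "b \<in> Z \<inter> D" for b
  proof -
    have "b \<in> Dpow (n - e)" using that Z_Int_D by simp
    then obtain i where "b = a [^] (p ^ (n - e) * i)" unfolding Dpow_eq by auto
    moreover have "p ^ n = p ^ (n - e) * p ^ e" using en by (simp add: power_add[symmetric])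
    then have "p ^ n dvd p ^ (n - e) * i * p ^ e" by simp
    then have "a [^] (p ^ (n - e) * i * p ^ e) = \<one>" by (simp only: a_pow_one_iff)
    ultimately show ?thesis by (simp add: nat_pow_pow)
  qed
  have pd: "(c \<otimes> b) [^] ?q = c [^] ?q \<otimes> b [^] ?q" if "b \<in> D" for b
    by (rule pow_mult_distrib[OF C_D_commute[OF c that] C_carrier[OF c] D_carrier[OF that]])
  obtain b where b: "b \<in> D" "conj_by G g0 c = c \<otimes> b" using conj_by_C[OF g0 c] by blast
  then obtain i where i: "b = a [^] (i::nat)" using derived_eq by auto
  \<comment> \<open>Conjugation by \<open>g0\<close> multiplies
    \<open>c [^] ?q \<otimes> a [^] j\<close> by \<open>a\<close> to the power
    \<open>?q * (i + t * j)\<close>, which has to vanish.\<close>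
  have "\<exists>j. p ^ n dvd ?q * (i + t * j)"
  proof (cases "e = n")
    case True then show ?thesis by simp
  next
    case False
    then have "coprime t p" using ct en by simp
    then obtain w z where wz: "t * w = p ^ n * z + 1" using coprime_inverse_nat[of t p n] p1 by auto
    \<comment> \<open>The witness is \<open>- i / t\<close> modulo \<open>p ^ n\<close>:
      \<open>w\<close> inverts \<open>t\<close>, and \<open>p ^ n - 1\<close> stands for -1.\<close>
    have "i + t * (w * ((p ^ n - 1) * i)) = i + (t * w) * ((p ^ n - 1) * i)" by (simp only: mult_ac)
    also have "\<dots> = p ^ n * (i + z * ((p ^ n - 1) * i))"
    proof -
      have "p ^ n = Suc (p ^ n - 1)" using p1 by simp
      then have "p ^ n * i = i + (p ^ n - 1) * i" by (metis mult_Suc)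
      then show ?thesis unfolding wz distrib_left distrib_right by simp
    qed
    finally show ?thesis by (metis dvd_mult dvd_triv_left)
  qed
  then obtain j where j: "p ^ n dvd ?q * (i + t * j)" by blast
  define z where "z = c [^] ?q \<otimes> a [^] j"
  have cq: "c [^] ?q \<in> C" using subgroup_pow_closed[OF C_subgroup c] .
  have zc: "z = c [^] ?q \<otimes> a [^] j" "z \<in> carrier G" using C_carrier[OF cq] by (auto simp: z_def)
  have zC: "z \<in> C" unfolding zc(1) using subgroup.m_closed[OF C_subgroup cq D_C[OF a_pow_D]] .
  have "z \<in> Z"
  proof (rule ZI[OF zc(2)])
    fix d assume d: "d \<in> C"
    obtain b' where b': "b' \<in> Z \<inter> D" "conj_by G d c = c \<otimes> b'" using C_commutator[OF c d] by blast
    have "conj_by G d (c [^] ?q) = c [^] ?q"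
      using b' pd[of b'] b_one[OF b'(1)] C_carrier[OF c] C_carrier[OF d] by (simp add: conj_by_pow)
    moreover have "conj_by G d (a [^] j) = a [^] j"
      using C_D_commute[OF d a_pow_D] C_carrier[OF d] by (simp add: conj_by_commute_iff)
    ultimately have "conj_by G d z = z" using C_carrier[OF d] C_carrier[OF cq] by (simp add: zc(1) conj_by_mult)
    then show "d \<otimes> z = z \<otimes> d" using C_carrier[OF d] zc(2) by (simp add: conj_by_commute_iff)
  next
    have "conj_by G g0 z = conj_by G g0 c [^] ?q \<otimes> conj_by G g0 (a [^] j)"
      using C_carrier[OF c] by (simp add: zc(1) conj_by_mult conj_by_pow)
    also have "\<dots> = c [^] ?q \<otimes> (a [^] i) [^] ?q \<otimes> (a [^] j) [^] r"
      using b(2) pd[OF b(1)] conj_D[OF a_pow_D] i by simp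
    also have "\<dots> = c [^] ?q \<otimes> a [^] (i * ?q + j * r)"
      using C_carrier[OF c] by (simp add: m_assoc nat_pow_pow nat_pow_mult)
    also have "i * ?q + j * r = j + ?q * (i + t * j)" by (simp add: r algebra_simps)
    also have "a [^] (j + ?q * (i + t * j)) = a [^] j"
      using j unfolding a_pow_eq_iff dvd_def by auto
    finally show "conj_by G g0 z = z" by (simp add: zc(1))
  qed
  moreover have "c [^] ?q = z \<otimes> inv (a [^] j)" using C_carrier[OF c] by (simp add: zc(1) m_assoc)
  moreover have "inv (a [^] j) \<in> D" using subgroup.m_inv_closed[OF D_subgroup a_pow_D] .
  ultimately show ?thesis unfolding set_mult_def by auto
qed

text \<open>The element \<open>c0\<close> of \<open>ex_c0\<close> detects membership. If
  \<open>g = c \<otimes> g0 [^] v\<close> multiplies \<open>c0\<close> by \<open>a [^] s\<close>,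
  then \<open>g [^] (p ^ e)\<close> multiplies it by \<open>a\<close> to the power
  \<open>p ^ e * s\<close> times a number prime to \<open>p\<close>. As \<open>Z <#> D\<close>
  commutes with \<open>c0\<close>, \<open>p ^ (n - e)\<close> divides \<open>s\<close>, hence
  \<open>v\<close>, and \<open>g0 [^] v\<close> lies in \<open>C\<close>.\<close>

lemma mem_C_if_pow:
  assumes g: "g \<in> carrier G" and gq: "g [^] (p ^ e) \<in> Z <#> D"
  shows "g \<in> C"
proof (cases "e = n")
  case True then show ?thesis using C_all g by simp
next
  case False
  then have lt: "e < n" using en by simp
  let ?q = "p ^ e"
  obtain c0 j where c0: "c0 \<in> C" "coprime j p" "conj_by G g0 c0 = c0 \<otimes> a [^] (j::nat)"
    using ex_c0[OF lt] by blast
  obtain c v where cv: "c \<in> C" "g = c \<otimes> g0 [^] (v::nat)" using all_C[OF g] by blast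
  obtain b where b: "b \<in> Z \<inter> D" "conj_by G c c0 = c0 \<otimes> b" using C_commutator[OF c0(1) cv(1)] by blast
  then have "b \<in> Dpow (n - e)" using Z_Int_D by simp
  then obtain u where u: "b = a [^] (p ^ (n - e) * u)" unfolding Dpow_eq by auto
  note cc = C_carrier[OF c0(1)] C_carrier[OF cv(1)] g
  \<comment> \<open>The first summand comes from the commutator of \<open>c\<close> and
    \<open>c0\<close> inside \<open>C\<close>, the second from conjugation by
    \<open>g0 [^] v\<close>.\<close>
  define s where "s = p ^ (n - e) * u + j * geo r v"
  have "conj_by G (g0 [^] v) c0 = c0 \<otimes> (a [^] j) [^] geo r v"
    by (rule iterate_conj_by[OF g0 c0(1) a_pow_D c0(3) conj_D[OF a_pow_D]])
  then have "conj_by G g c0 = conj_by G c (c0 \<otimes> a [^] (j * geo r v))"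
    using cc by (simp add: cv(2) conj_by_compose nat_pow_pow)
  also have "\<dots> = c0 \<otimes> b \<otimes> a [^] (j * geo r v)"
    using C_D_commute[OF cv(1) a_pow_D] cc by (simp add: conj_by_mult b(2) conj_by_commute_iff[THEN iffD2])
  also have "\<dots> = c0 \<otimes> a [^] s" using cc by (simp add: u s_def m_assoc nat_pow_mult)
  finally have gc0: "conj_by G g c0 = c0 \<otimes> a [^] s" .
  have "conj_by G g a = conj_by G c (conj_by G (g0 [^] v) (a [^] (1::nat)))"
    using cc by (simp add: cv(2) conj_by_compose)
  also have "\<dots> = conj_by G c (a [^] (r ^ v))" using conj_pow_a[of v 1] by simp
  also have "\<dots> = a [^] (r ^ v)" using C_D_commute[OF cv(1) a_pow_D] cc by (simp add: conj_by_commute_iff)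
  finally have "conj_by G g a = a [^] (r ^ v)" .
  then have bg: "conj_by G g (a [^] s) = (a [^] s) [^] (r ^ v)"
    using conj_by_D_pow[OF g _ a_pow_D] by blast
  have rv: "(r ^ v) mod p = 1 mod p" by (rule power_mod_1[OF r_mod])
  obtain y where y: "coprime y p" "geo (r ^ v) ?q = ?q * y" using geo_prime_power[OF p podd rv] by blast
  obtain z d where zd: "z \<in> Z" "d \<in> D" "g [^] ?q = z \<otimes> d" using gq unfolding set_mult_def by auto
  have zdC: "z \<otimes> d \<in> C" using subgroup.m_closed[OF C_subgroup Z_C[OF zd(1)] D_C[OF zd(2)]] .
  have "z \<otimes> d \<otimes> c0 = c0 \<otimes> (z \<otimes> d)"
  proof -
    have "z \<otimes> d \<otimes> c0 = z \<otimes> (c0 \<otimes> d)"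
      using zd cc C_D_commute[OF c0(1) zd(2)] D_carrier C_carrier[OF Z_C] by (simp add: m_assoc)
    also have "\<dots> = z \<otimes> c0 \<otimes> d" using zd cc D_carrier C_carrier[OF Z_C] by (simp add: m_assoc)
    also have "z \<otimes> c0 = c0 \<otimes> z" using zd cc by (simp add: centralizer_def)
    finally show ?thesis using zd cc D_carrier C_carrier[OF Z_C] by (simp add: m_assoc)
  qed
  then have "conj_by G (g [^] ?q) c0 = c0" using cc zd(3) C_carrier[OF zdC] by (simp add: conj_by_commute_iff)
  moreover have "conj_by G (g [^] ?q) c0 = c0 \<otimes> (a [^] s) [^] geo (r ^ v) ?q"
    by (rule iterate_conj_by[OF g c0(1) a_pow_D gc0 bg])
  ultimately have "a [^] (s * (?q * y)) = \<one>" using cc y(2) by (simp add: nat_pow_pow)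
  then have "p ^ n dvd ?q * (s * y)" by (simp add: a_pow_one_iff mult_ac)
  moreover have "p ^ n = ?q * p ^ (n - e)" using en by (simp add: power_add[symmetric])
  ultimately have "p ^ (n - e) dvd s * y" using p1 by simp
  then have "p ^ (n - e) dvd s" using y(1) by (metis coprime_commute coprime_dvd_mult_left_iff coprime_power_left_iff)
  then have "p ^ (n - e) dvd j * geo r v" unfolding s_def by (simp add: dvd_add_right_iff)
  then have "p ^ (n - e) dvd geo r v"
    using c0(2) by (metis coprime_commute coprime_dvd_mult_right_iff coprime_power_left_iff)
  then have "p ^ (n - e) dvd v" using prime_power_dvd_geo[OF p podd r_mod] by simp
  then have "g0 [^] v \<in> C" by (simp add: g0_pow_C_iff)
  then show ?thesis using subgroup.m_closed[OF C_subgroup cv(1)] cv(2) by simp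
qed

lemma C_eq_pow: "C = {g \<in> carrier G. g [^] (p ^ e) \<in> Z <#> D}"
  using pow_C_mem mem_C_if_pow C_carrier by blast

text \<open>Write \<open>x = c \<otimes> g\<close> and \<open>y = d \<otimes> h\<close> with
  commuting powers \<open>g\<close> and \<open>h\<close> of \<open>g0\<close>; then
  \<open>pow_mod_Dpow\<close> handles each exchange. Moving \<open>g\<close> past \<open>d\<close>
  replaces \<open>d\<close> by \<open>d \<otimes> b\<close>, whose power is the same modulo
  \<open>Dpow m\<close>. The second claim will turn indicators of cosets of powers into
  traces.\<close>

lemma pow_hom_mod:
  assumes m: "m \<le> k" and x: "x \<in> carrier G" and y: "y \<in> carrier G"
  shows "Dpow m #> ((x \<otimes> y) [^] (p ^ k)) = Dpow m #> (x [^] (p ^ k) \<otimes> y [^] (p ^ k))"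
    and "Dpow m #> (x [^] (p ^ k) \<otimes> y) = Dpow m #> (y \<otimes> x [^] (p ^ k))"
proof -
  interpret N: normal "Dpow m" G by (rule Dpow_normal)
  let ?\<pi> = "\<lambda>x. Dpow m #> x"
  let ?P = "p ^ k"
  note rs = N.rcos_sum[symmetric]
  note pm = pow_mod_Dpow[OF m]
  obtain c i where c: "c \<in> C" "x = c \<otimes> g0 [^] (i::nat)" using all_C[OF x] by blast
  obtain d j where d: "d \<in> C" "y = d \<otimes> g0 [^] (j::nat)" using all_C[OF y] by blast
  define g h where "g = g0 [^] i" and "h = g0 [^] j"
  have gh: "g \<in> carrier G" "h \<in> carrier G" "g \<otimes> h = h \<otimes> g" by (auto simp: g_def h_def nat_pow_mult add.commute)
  obtain b where b: "b \<in> D" "conj_by G g d = d \<otimes> b" using conj_by_C[OF gh(1) d(1)] by blast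
  have dbC: "d \<otimes> b \<in> C" using subgroup.m_closed[OF C_subgroup d(1) D_C[OF b(1)]] .
  note cc = C_carrier[OF c(1)] C_carrier[OF d(1)] C_carrier[OF dbC] D_carrier[OF b(1)] gh(1,2)
  have xg: "x = c \<otimes> g" and yh: "y = d \<otimes> h" using c d by (auto simp: g_def h_def)
  have ghP: "(g \<otimes> h) [^] ?P = g [^] ?P \<otimes> h [^] ?P" by (rule pow_mult_distrib[OF gh(3,1,2)])
  have xP: "?\<pi> (x [^] ?P) = ?\<pi> (c [^] ?P) <#> ?\<pi> (g [^] ?P)"
    unfolding xg using pm(1)[OF c(1) gh(1)] cc by (simp add: rs)
  have yP: "?\<pi> (y [^] ?P) = ?\<pi> (d [^] ?P) <#> ?\<pi> (h [^] ?P)"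
    unfolding yh using pm(1)[OF d(1) gh(2)] cc by (simp add: rs)
  have "?\<pi> (b [^] ?P) = Dpow m"
    using D_pow_Dpow[OF b(1) dvd_refl m] cc Dpow_subgroup by (intro coset_join2) auto
  then have bP: "?\<pi> (b [^] ?P) = ?\<pi> \<one>" using N.subset by simp
  have dbP: "?\<pi> ((d \<otimes> b) [^] ?P) = ?\<pi> (d [^] ?P)"
  proof -
    have "?\<pi> ((d \<otimes> b) [^] ?P) = ?\<pi> (d [^] ?P) <#> ?\<pi> (b [^] ?P)"
      using pm(1)[OF d(1) cc(4)] cc by (simp add: rs)
    also have "\<dots> = ?\<pi> (d [^] ?P \<otimes> \<one>)" unfolding bP using cc by (simp add: N.rcos_sum)
    finally show ?thesis using cc by simp
  qed
  have comm: "?\<pi> u <#> ?\<pi> v = ?\<pi> v <#> ?\<pi> u" if "?\<pi> (u \<otimes> v) = ?\<pi> (v \<otimes> u)" "u \<in> carrier G" "v \<in> carrier G" for u v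
    using that by (simp add: N.rcos_sum)
  have dg: "?\<pi> (d [^] ?P) <#> ?\<pi> (g [^] ?P) = ?\<pi> (g [^] ?P) <#> ?\<pi> (d [^] ?P)"
    by (rule comm) (use pm(3)[OF d(1), of "g [^] ?P"] cc in auto)
  have "x \<otimes> y = c \<otimes> (g \<otimes> d) \<otimes> h" unfolding xg yh using cc by (simp add: m_assoc)
  also have "g \<otimes> d = (d \<otimes> b) \<otimes> g" using conj_by_move[OF gh(1) cc(2)] b(2) by simp
  also have "c \<otimes> ((d \<otimes> b) \<otimes> g) \<otimes> h = c \<otimes> ((d \<otimes> b) \<otimes> (g \<otimes> h))" using cc by (simp add: m_assoc)
  finally have xy: "x \<otimes> y = c \<otimes> ((d \<otimes> b) \<otimes> (g \<otimes> h))" .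
  have "?\<pi> ((x \<otimes> y) [^] ?P) = ?\<pi> (c [^] ?P) <#> ?\<pi> (((d \<otimes> b) \<otimes> (g \<otimes> h)) [^] ?P)"
    unfolding xy using pm(1)[OF c(1), of "(d \<otimes> b) \<otimes> (g \<otimes> h)"] cc by (simp add: rs)
  also have "?\<pi> (((d \<otimes> b) \<otimes> (g \<otimes> h)) [^] ?P) = ?\<pi> (d [^] ?P) <#> (?\<pi> (g [^] ?P) <#> ?\<pi> (h [^] ?P))"
    using pm(1)[OF dbC, of "g \<otimes> h"] cc dbP ghP by (simp add: rs)
  also have "?\<pi> (c [^] ?P) <#> (?\<pi> (d [^] ?P) <#> (?\<pi> (g [^] ?P) <#> ?\<pi> (h [^] ?P)))
    = ?\<pi> (c [^] ?P) <#> ((?\<pi> (d [^] ?P) <#> ?\<pi> (g [^] ?P)) <#> ?\<pi> (h [^] ?P))"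
    using cc by (simp add: N.rcos_sum m_assoc)
  also have "\<dots> = ?\<pi> (x [^] ?P) <#> ?\<pi> (y [^] ?P)"
    unfolding dg xP yP using cc by (simp add: N.rcos_sum m_assoc)
  also have "\<dots> = ?\<pi> (x [^] ?P \<otimes> y [^] ?P)" using x y by (simp add: N.rcos_sum)
  finally show "?\<pi> ((x \<otimes> y) [^] ?P) = ?\<pi> (x [^] ?P \<otimes> y [^] ?P)" .
  have 1: "?\<pi> (x [^] ?P) <#> ?\<pi> d = ?\<pi> d <#> ?\<pi> (x [^] ?P)"
    by (rule comm) (use pm(2)[OF d(1) x] x cc in auto)
  have ch: "?\<pi> (c [^] ?P) <#> ?\<pi> h = ?\<pi> h <#> ?\<pi> (c [^] ?P)"
    by (rule comm[symmetric]) (use pm(3)[OF c(1) gh(2)] cc in auto)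
  have gh': "g [^] ?P \<otimes> h = h \<otimes> g [^] ?P" by (simp add: g_def h_def nat_pow_pow nat_pow_mult add.commute)
  have 2: "?\<pi> (x [^] ?P) <#> ?\<pi> h = ?\<pi> h <#> ?\<pi> (x [^] ?P)"
  proof -
    have "?\<pi> (x [^] ?P) <#> ?\<pi> h = ?\<pi> (c [^] ?P) <#> ?\<pi> (g [^] ?P \<otimes> h)"
      unfolding xP using cc by (simp add: N.rcos_sum m_assoc)
    also have "\<dots> = (?\<pi> (c [^] ?P) <#> ?\<pi> h) <#> ?\<pi> (g [^] ?P)"
      unfolding gh' using cc by (simp add: N.rcos_sum m_assoc)
    also have "\<dots> = ?\<pi> h <#> ?\<pi> (x [^] ?P)" unfolding ch xP using cc by (simp add: N.rcos_sum m_assoc)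
    finally show ?thesis .
  qed
  have "?\<pi> (x [^] ?P \<otimes> y) = (?\<pi> (x [^] ?P) <#> ?\<pi> d) <#> ?\<pi> h"
    unfolding yh using cc x by (simp add: N.rcos_sum m_assoc)
  also have "\<dots> = ?\<pi> d <#> (?\<pi> (x [^] ?P) <#> ?\<pi> h)"
    unfolding 1 using cc x by (simp add: N.rcos_sum m_assoc)
  also have "\<dots> = ?\<pi> (y \<otimes> x [^] ?P)"
    unfolding 2 yh using cc x by (simp add: N.rcos_sum m_assoc)
  finally show "?\<pi> (x [^] ?P \<otimes> y) = ?\<pi> (y \<otimes> x [^] ?P)" .
qed

end

section \<open>Linear functionals on group algebras\<close>

text \<open>A function on the group stands for the linear functional with these values on the basis
  of group elements; \<open>ga_delta x\<close> is the basis element \<open>x\<close>.\<close>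

definition lf :: "('a, 'b) monoid_scheme \<Rightarrow> ('a \<Rightarrow> 'k::field) \<Rightarrow> ('a \<Rightarrow> 'k) \<Rightarrow> 'k" where
  "lf G \<tau> f = (\<Sum>x\<in>carrier G. f x * \<tau> x)"

definition ga_delta :: "'a \<Rightarrow> 'a \<Rightarrow> 'k::field" where
  "ga_delta x = (\<lambda>y. if y = x then 1 else 0)"

text \<open>For normal \<open>N\<close> these are the functionals that factor through the group
  algebra of the quotient by \<open>N\<close>.\<close>

definition coset_const :: "('a, 'b) monoid_scheme \<Rightarrow> 'a set \<Rightarrow> ('a \<Rightarrow> 'k) \<Rightarrow> bool" where
  "coset_const G N \<tau> \<longleftrightarrow> (\<forall>x\<in>carrier G. \<forall>n\<in>N. \<tau> (x \<otimes>\<^bsub>G\<^esub> n) = \<tau> x)"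

definition trace_fun :: "('a, 'b) monoid_scheme \<Rightarrow> ('a \<Rightarrow> 'k) \<Rightarrow> bool" where
  "trace_fun G \<tau> \<longleftrightarrow> (\<forall>x\<in>carrier G. \<forall>y\<in>carrier G. \<tau> (x \<otimes>\<^bsub>G\<^esub> y) = \<tau> (y \<otimes>\<^bsub>G\<^esub> x))"

lemma coset_constD: "coset_const G N \<tau> \<Longrightarrow> x \<in> carrier G \<Longrightarrow> n \<in> N \<Longrightarrow> \<tau> (x \<otimes>\<^bsub>G\<^esub> n) = \<tau> x"
  by (simp add: coset_const_def)

lemma ga_mult_carrier [simp]: "ga_mult G f g \<in> ga_carrier G"
  by (simp add: ga_mult_def ga_carrier_def)

lemma ga_delta_carrier [simp]: "x \<in> carrier G \<Longrightarrow> ga_delta x \<in> ga_carrier G"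
  by (auto simp: ga_delta_def ga_carrier_def)

lemma lf_cong: "(\<And>x. x \<in> carrier G \<Longrightarrow> \<tau> x = \<sigma> x) \<Longrightarrow> lf G \<tau> f = lf G \<sigma> f"
  by (simp add: lf_def)

locale finite_group = group G for G (structure) +
  assumes fin [simp]: "finite (carrier G)"
begin

lemma lf_delta: "x \<in> carrier G \<Longrightarrow> lf G \<tau> (ga_delta x) = \<tau> x"
  unfolding lf_def ga_delta_def by (simp add: if_distrib[of "\<lambda>c. c * _"] sum.delta cong: if_cong)

lemma lf_delta_left: "x \<in> carrier G \<Longrightarrow> lf G (ga_delta x) f = f x"
  by (simp add: lf_def ga_delta_def if_distrib sum.delta cong: if_cong)

lemma lf_mult: "lf G \<tau> (ga_mult G f g) = lf G (\<lambda>x. lf G (\<lambda>y. \<tau> (x \<otimes> y)) g) f"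
proof -
  have "lf G \<tau> (ga_mult G f g) = (\<Sum>z\<in>carrier G. \<Sum>x\<in>carrier G. f x * g (inv x \<otimes> z) * \<tau> z)"
    by (simp add: lf_def ga_mult_def sum_distrib_right)
  also have "\<dots> = (\<Sum>x\<in>carrier G. \<Sum>z\<in>carrier G. f x * g (inv x \<otimes> z) * \<tau> z)" by (rule sum.swap)
  also have "\<dots> = (\<Sum>x\<in>carrier G. \<Sum>y\<in>carrier G. f x * g y * \<tau> (x \<otimes> y))"
  proof (rule sum.cong[OF refl])
    fix x assume x: "x \<in> carrier G"
    show "(\<Sum>z\<in>carrier G. f x * g (inv x \<otimes> z) * \<tau> z) = (\<Sum>y\<in>carrier G. f x * g y * \<tau> (x \<otimes> y))"
      by (rule sum.reindex_bij_witness[of _ "\<lambda>y. x \<otimes> y" "\<lambda>z. inv x \<otimes> z"])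
        (use x in \<open>auto simp: m_assoc[symmetric]\<close>)
  qed
  also have "\<dots> = lf G (\<lambda>x. lf G (\<lambda>y. \<tau> (x \<otimes> y)) g) f"
    by (simp add: lf_def sum_distrib_left mult.assoc)
  finally show ?thesis .
qed

text \<open>Together with \<open>lf_mult\<close> this allows either factor to be summed first.
  Comparing the two orders carries identities between group elements over to arbitrary elements of
  the algebra.\<close>

lemma lf_mult': "lf G \<tau> (ga_mult G f g) = lf G (\<lambda>y. lf G (\<lambda>x. \<tau> (x \<otimes> y)) f) g"
proof -
  have "lf G \<tau> (ga_mult G f g) = (\<Sum>x\<in>carrier G. \<Sum>y\<in>carrier G. f x * (g y * \<tau> (x \<otimes> y)))"
    unfolding lf_mult by (simp add: lf_def sum_distrib_right mult_ac sum_distrib_left)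
  also have "\<dots> = (\<Sum>y\<in>carrier G. \<Sum>x\<in>carrier G. f x * (g y * \<tau> (x \<otimes> y)))" by (rule sum.swap)
  also have "\<dots> = lf G (\<lambda>y. lf G (\<lambda>x. \<tau> (x \<otimes> y)) f) g"
    by (simp add: lf_def sum_distrib_left mult_ac)
  finally show ?thesis .
qed

lemma lf_separates:
  assumes "f \<in> ga_carrier G" "g \<in> ga_carrier G" "\<And>\<tau>. lf G \<tau> f = lf G \<tau> g"
  shows "f = g"
proof
  fix x show "f x = g x"
    using assms lf_delta_left[of x f] lf_delta_left[of x g]
    by (cases "x \<in> carrier G") (auto simp: ga_carrier_def)
qed

lemma delta_mult: "x \<in> carrier G \<Longrightarrow> y \<in> carrier G \<Longrightarrow> ga_mult G (ga_delta x) (ga_delta y) = ga_delta (x \<otimes> y)"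
  by (rule lf_separates) (simp_all add: lf_mult lf_delta)

lemma ga_one_delta: "ga_one G = ga_delta \<one>"
  by (simp add: ga_one_def ga_delta_def)

text \<open>The right side says that \<open>\<tau>\<close> vanishes on the ideal generated by all
  differences \<open>x y - y x\<close>. It mentions only multiplication, so it survives an algebra
  isomorphism.\<close>

lemma coset_const_derived_iff:
  "coset_const G (derived G (carrier G)) \<tau> \<longleftrightarrow>
    (\<forall>x\<in>carrier G. \<forall>y\<in>carrier G. \<forall>u\<in>carrier G. \<tau> (x \<otimes> y \<otimes> u) = \<tau> (y \<otimes> x \<otimes> u))" (is "?L \<longleftrightarrow> ?R")
proof
  assume L: ?L
  show ?R
  proof (intro ballI)
    fix x y u assume c: "x \<in> carrier G" "y \<in> carrier G" "u \<in> carrier G"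
    define w where "w = inv (y \<otimes> x \<otimes> u) \<otimes> (x \<otimes> y \<otimes> u)"
    have "w = conj_by G (inv u) (inv x \<otimes> conj_by G (inv y) x)"
      using c by (simp add: w_def conj_by_def m_assoc inv_mult_group)
    moreover have "inv x \<otimes> conj_by G (inv y) x \<in> derived G (carrier G)"
      by (rule comm_derived) (use c in auto)
    ultimately have "w \<in> derived G (carrier G)"
      using normal.inv_op_closed2[OF derived_self_is_normal inv_closed[OF c(3)]]
      unfolding conj_by_def[of G "inv u"] by simp
    then have "\<tau> (y \<otimes> x \<otimes> u \<otimes> w) = \<tau> (y \<otimes> x \<otimes> u)" using L c by (simp add: coset_const_def)
    moreover have "y \<otimes> x \<otimes> u \<otimes> w = x \<otimes> y \<otimes> u" using c by (simp add: w_def m_assoc[symmetric])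
    ultimately show "\<tau> (x \<otimes> y \<otimes> u) = \<tau> (y \<otimes> x \<otimes> u)" by simp
  qed
next
  assume R: ?R
  \<comment> \<open>The right translations preserving \<open>\<tau>\<close> form a subgroup, so only
    commutators have to be tested.\<close>
  define N where "N = {n \<in> carrier G. \<forall>x\<in>carrier G. \<tau> (x \<otimes> n) = \<tau> x}"
  have "subgroup N G"
    by (rule finite_subgroupI) (auto simp: N_def m_assoc[symmetric])
  moreover have "derived_set G (carrier G) \<subseteq> N"
  proof
    fix w assume "w \<in> derived_set G (carrier G)"
    then obtain x y where xy: "x \<in> carrier G" "y \<in> carrier G" "w = x \<otimes> y \<otimes> inv x \<otimes> inv y" by auto
    { fix u assume u: "u \<in> carrier G"
      have "\<tau> (u \<otimes> w) = \<tau> ((u \<otimes> x) \<otimes> y \<otimes> (inv x \<otimes> inv y))" using xy u by (simp add: m_assoc)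
      also have "\<dots> = \<tau> (y \<otimes> (u \<otimes> x) \<otimes> (inv x \<otimes> inv y))" using R xy u by simp
      also have "y \<otimes> (u \<otimes> x) \<otimes> (inv x \<otimes> inv y) = y \<otimes> u \<otimes> (x \<otimes> inv x) \<otimes> inv y"
        using xy u by (simp only: m_assoc m_closed inv_closed)
      also have "\<dots> = y \<otimes> u \<otimes> inv y" using xy u by simp
      also have "\<tau> (y \<otimes> u \<otimes> inv y) = \<tau> (u \<otimes> y \<otimes> inv y)" using R xy u by simp
      also have "u \<otimes> y \<otimes> inv y = u" using xy u by (simp add: m_assoc)
      finally have "\<tau> (u \<otimes> w) = \<tau> u" . }
    then show "w \<in> N" using xy by (simp add: N_def)
  qed
  ultimately have "derived G (carrier G) \<subseteq> N" unfolding derived_def by (intro generate_subgroup_incl)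
  then show ?L by (auto simp: coset_const_def N_def)
qed

lemma coset_const_mult:
  assumes "N \<subseteq> carrier G" "M \<subseteq> carrier G"
    "coset_const G N \<tau>" "coset_const G M \<tau>"
  shows "coset_const G (N <#> M) \<tau>"
  unfolding coset_const_def
proof (intro ballI)
  fix x y assume x: "x \<in> carrier G" and "y \<in> N <#> M"
  then obtain n m where nm: "n \<in> N" "m \<in> M" "y = n \<otimes> m" by (auto simp: set_mult_def)
  then have "x \<otimes> y = (x \<otimes> n) \<otimes> m" using x assms(1,2) by (simp add: m_assoc subset_iff)
  then show "\<tau> (x \<otimes> y) = \<tau> x"
    using coset_constD[OF assms(4), of "x \<otimes> n" m] coset_constD[OF assms(3) x, of n] nm x assms(1) by auto
qed

lemma coset_const_mono: "coset_const G N \<tau> \<Longrightarrow> M \<subseteq> N \<Longrightarrow> coset_const G M \<tau>"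
  by (auto simp: coset_const_def)

text \<open>Compare the coefficients of the two products at \<open>h \<otimes> v\<close>.\<close>

lemma central_element_class_function:
  assumes f: "f \<in> ga_carrier G" and h: "h \<in> carrier G" and v: "v \<in> carrier G"
    and c: "ga_mult G f (ga_delta h) = ga_mult G (ga_delta h) f"
  shows "f (conj_by G h v) = f v"
proof -
  have "ga_mult G f (ga_delta h) (h \<otimes> v) = f (conj_by G h v)"
  proof -
    have "ga_mult G f (ga_delta h) (h \<otimes> v) = lf G (\<lambda>x. ga_delta (h \<otimes> v) (x \<otimes> h)) f"
      using lf_delta_left[of "h \<otimes> v" "ga_mult G f (ga_delta h)"] h v by (simp add: lf_mult lf_delta)
    also have "\<dots> = lf G (ga_delta (conj_by G h v)) f"
      by (rule lf_cong) (use h v in \<open>auto simp: ga_delta_def conj_by_def m_assoc, (metis inv_solve_right m_assoc m_closed inv_closed)\<close>)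
    finally show ?thesis using h v by (simp add: lf_delta_left)
  qed
  moreover have "ga_mult G (ga_delta h) f (h \<otimes> v) = f v"
  proof -
    have "ga_mult G (ga_delta h) f (h \<otimes> v) = lf G (\<lambda>y. ga_delta (h \<otimes> v) (h \<otimes> y)) f"
      using lf_delta_left[of "h \<otimes> v" "ga_mult G (ga_delta h) f"] h v by (simp add: lf_mult' lf_delta)
    also have "\<dots> = lf G (ga_delta v) f"
      by (rule lf_cong) (use h v in \<open>auto simp: ga_delta_def\<close>)
    finally show ?thesis using h v by (simp add: lf_delta_left)
  qed
  ultimately show ?thesis using c by simp
qed

end

section \<open>Pulling back functionals: the transpose of an algebra isomorphism\<close>

definition pull :: "('c, 'd) monoid_scheme \<Rightarrow> (('a \<Rightarrow> 'k::field) \<Rightarrow> ('c \<Rightarrow> 'k)) \<Rightarrow> ('c \<Rightarrow> 'k) \<Rightarrow> 'a \<Rightarrow> 'k" where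
  "pull H \<phi> \<tau> = (\<lambda>x. lf H \<tau> (\<phi> (ga_delta x)))"

lemma ga_iso_inverse:
  fixes \<phi> :: "('a \<Rightarrow> 'k::field) \<Rightarrow> ('c \<Rightarrow> 'k)"
  assumes "ga_iso G H \<phi>" "group G"
  shows "ga_iso H G (inv_into (ga_carrier G) \<phi>)"
proof -
  let ?\<psi> = "inv_into (ga_carrier G) \<phi>"
  have b: "bij_betw \<phi> (ga_carrier G) (ga_carrier H)" using assms by (simp add: ga_iso_def)
  have bi: "bij_betw ?\<psi> (ga_carrier H) (ga_carrier G)" by (rule bij_betw_inv_into[OF b])
  have c: "?\<psi> y \<in> ga_carrier G" "\<phi> (?\<psi> y) = y" if "y \<in> ga_carrier H" for y
    using bij_betwE[OF bi] that bij_betw_inv_into_right[OF b that] by auto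
  have l: "?\<psi> (\<phi> x) = x" if "x \<in> ga_carrier G" for x using bij_betw_inv_into_left[OF b that] .
  have sm: "ga_smult a f \<in> ga_carrier G" if "f \<in> ga_carrier G" for a and f :: "'a \<Rightarrow> 'k"
    using that by (simp add: ga_carrier_def ga_smult_def)
  have ad: "(\<lambda>x. f x + g x) \<in> ga_carrier G" if "f \<in> ga_carrier G" "g \<in> ga_carrier G" for f g :: "'a \<Rightarrow> 'k"
    using that by (simp add: ga_carrier_def)
  have one: "\<phi> (ga_one G) = ga_one H" using assms by (simp add: ga_iso_def)
  have one': "?\<psi> (\<phi> (ga_one G)) = ga_one G"
    by (rule l) (use group.is_monoid[OF assms(2)] monoid.one_closed in \<open>auto simp: ga_one_def ga_carrier_def\<close>)
  show ?thesis unfolding ga_iso_def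
  proof (intro conjI ballI allI)
    fix f g :: "'c \<Rightarrow> 'k" assume fg: "f \<in> ga_carrier H" "g \<in> ga_carrier H"
    have "\<phi> (\<lambda>x. ?\<psi> f x + ?\<psi> g x) = (\<lambda>y. f y + g y)"
      using assms c[OF fg(1)] c[OF fg(2)] by (simp add: ga_iso_def)
    then show "?\<psi> (\<lambda>x. f x + g x) = (\<lambda>y. ?\<psi> f y + ?\<psi> g y)"
      using l[OF ad[OF c(1)[OF fg(1)] c(1)[OF fg(2)]]] by simp
    have "\<phi> (ga_mult G (?\<psi> f) (?\<psi> g)) = ga_mult H f g"
      using assms c[OF fg(1)] c[OF fg(2)] by (simp add: ga_iso_def)
    then show "?\<psi> (ga_mult H f g) = ga_mult G (?\<psi> f) (?\<psi> g)"
      using l[OF ga_mult_carrier] by metis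
  next
    fix a and f :: "'c \<Rightarrow> 'k" assume f: "f \<in> ga_carrier H"
    have "\<phi> (ga_smult a (?\<psi> f)) = ga_smult a f" using assms c[OF f] by (simp add: ga_iso_def)
    then show "?\<psi> (ga_smult a f) = ga_smult a (?\<psi> f)" using l[OF sm[OF c(1)[OF f]]] by metis
  next
    show "bij_betw ?\<psi> (ga_carrier H) (ga_carrier G)" by (rule bi)
  next
    show "?\<psi> (ga_one H) = ga_one G" using one one' by simp
  qed
qed

locale ga_iso_pair = G: finite_group G + H: finite_group H
  for G (structure) and H (structure) +
  fixes \<phi> :: "('a \<Rightarrow> 'k::field) \<Rightarrow> ('c \<Rightarrow> 'k)" and p :: nat
  assumes iso: "ga_iso G H \<phi>"
    and p: "Factorial_Ring.prime p" and podd: "odd p" and char: "CHAR('k) = p"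
    and pG: "\<exists>N. order G = p ^ N" and pH: "\<exists>N. order H = p ^ N"
begin

abbreviation "\<psi> \<equiv> inv_into (ga_carrier G) \<phi>"

lemma p1: "p > 1" using p prime_gt_1_nat by blast

lemma bij: "bij_betw \<phi> (ga_carrier G) (ga_carrier H)" using iso by (simp add: ga_iso_def)

lemma phi_closed [simp]: "f \<in> ga_carrier G \<Longrightarrow> \<phi> f \<in> ga_carrier H"
  using bij by (auto simp: bij_betw_def)

lemma phi_mult: "f \<in> ga_carrier G \<Longrightarrow> g \<in> ga_carrier G \<Longrightarrow> \<phi> (ga_mult G f g) = ga_mult H (\<phi> f) (\<phi> g)"
  using iso by (simp add: ga_iso_def)

lemma phi_add:
  "f \<in> ga_carrier G \<Longrightarrow> g \<in> ga_carrier G \<Longrightarrow> \<phi> (\<lambda>x. f x + g x) = (\<lambda>y. \<phi> f y + \<phi> g y)"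
  using iso by (simp add: ga_iso_def)

lemma phi_one: "\<phi> (ga_one G) = ga_one H"
  using iso by (simp add: ga_iso_def)

lemma iso_sym: "ga_iso_pair H G \<psi> p"
  using ga_iso_inverse[OF iso G.group_axioms] p podd char pG pH
  by unfold_locales auto

lemma phi_sum:
  assumes "finite S" "S \<subseteq> carrier G"
  shows "\<phi> (\<lambda>y. \<Sum>x\<in>S. c x * ga_delta x y) = (\<lambda>y. \<Sum>x\<in>S. c x * \<phi> (ga_delta x) y)"
  using assms
proof (induction S rule: finite_induct)
  case empty
  \<comment> \<open>The zero function is written as a scalar multiple of the unit, to which the
    linearity of \<open>\<phi>\<close> applies.\<close>
  have "ga_smult 0 (ga_one G) = (\<lambda>_. 0 :: 'k)" by (simp add: ga_smult_def)
  moreover have "\<phi> (ga_smult 0 (ga_one G)) = ga_smult 0 (\<phi> (ga_one G))"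
    using iso by (auto simp: ga_iso_def ga_one_def ga_carrier_def)
  ultimately show ?case by (simp add: ga_smult_def)
next
  case (insert x S)
  have x: "ga_delta x \<in> ga_carrier G" using insert by simp
  have S: "(\<lambda>y. \<Sum>x\<in>S. c x * ga_delta x y) \<in> ga_carrier G"
    using insert by (auto simp: ga_carrier_def ga_delta_def intro!: sum.neutral)
  have sx: "ga_smult (c x) (ga_delta x) \<in> ga_carrier G"
    using x by (auto simp: ga_carrier_def ga_smult_def)
  have "\<phi> (\<lambda>y. ga_smult (c x) (ga_delta x) y + (\<Sum>x\<in>S. c x * ga_delta x y))
    = (\<lambda>y. \<phi> (ga_smult (c x) (ga_delta x)) y + \<phi> (\<lambda>y. \<Sum>x\<in>S. c x * ga_delta x y) y)"
    by (rule phi_add[OF sx S])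
  also have "\<phi> (ga_smult (c x) (ga_delta x)) = ga_smult (c x) (\<phi> (ga_delta x))"
    using iso x unfolding ga_iso_def by blast
  finally show ?case using insert by (simp add: ga_smult_def)
qed

lemma ga_expand:
  assumes "f \<in> ga_carrier G"
  shows "f = (\<lambda>y. \<Sum>x\<in>carrier G. f x * ga_delta x y)"
proof
  fix y
  have "(\<Sum>x\<in>carrier G. f x * ga_delta x y) = (\<Sum>x\<in>carrier G. if y = x then f x else 0)"
    by (rule sum.cong) (auto simp: ga_delta_def)
  also have "\<dots> = f y" using assms by (auto simp: ga_carrier_def)
  finally show "f y = (\<Sum>x\<in>carrier G. f x * ga_delta x y)" by simp
qed

lemma lf_comb: "lf H \<tau> (\<lambda>y. \<Sum>x\<in>S. c x * F x y) = (\<Sum>x\<in>S. c x * lf H \<tau> (F x))"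
  unfolding lf_def by (simp add: sum_distrib_right sum_distrib_left mult.assoc) (rule sum.swap)

lemma lf_phi: "f \<in> ga_carrier G \<Longrightarrow> lf H \<tau> (\<phi> f) = lf G (pull H \<phi> \<tau>) f"
  by (subst ga_expand, assumption)
    (simp add: phi_sum lf_comb, simp add: lf_def pull_def)

lemma phi_psi: "f \<in> ga_carrier H \<Longrightarrow> \<phi> (\<psi> f) = f"
  using bij_betw_inv_into_right[OF bij] .

lemma psi_closed: "f \<in> ga_carrier H \<Longrightarrow> \<psi> f \<in> ga_carrier G"
  using bij_betwE[OF bij_betw_inv_into[OF bij]] by blast

lemma pull_pull: "y \<in> carrier H \<Longrightarrow> pull G \<psi> (pull H \<phi> \<tau>) y = \<tau> y"
  using lf_phi[of "\<psi> (ga_delta y)" \<tau>, symmetric]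
  by (simp add: pull_def[of G] psi_closed phi_psi H.lf_delta)

lemma pull_pull': "x \<in> carrier G \<Longrightarrow> pull H \<phi> (pull G \<psi> \<tau>) x = \<tau> x"
proof -
  assume x: "x \<in> carrier G"
  interpret S: ga_iso_pair H G \<psi> p by (rule iso_sym)
  have "pull H \<phi> (pull G \<psi> \<tau>) x = lf G \<tau> (\<psi> (\<phi> (ga_delta x)))"
    using x by (simp add: pull_def[of H] S.lf_phi)
  also have "\<psi> (\<phi> (ga_delta x)) = ga_delta x"
    using bij_betw_inv_into_left[OF bij] x by simp
  finally show ?thesis using x by (simp add: G.lf_delta)
qed

lemma pull_mult:
  assumes "x \<in> carrier G" "y \<in> carrier G"
  shows "pull H \<phi> \<tau> (x \<otimes> y) = lf H \<tau> (ga_mult H (\<phi> (ga_delta x)) (\<phi> (ga_delta y)))"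
  using assms by (simp add: pull_def G.delta_mult[symmetric] phi_mult)

lemma pull_trace:
  assumes "trace_fun H \<tau>"
  shows "trace_fun G (pull H \<phi> \<tau>)"
  unfolding trace_fun_def
proof (intro ballI)
  fix x y assume "x \<in> carrier G" "y \<in> carrier G"
  then show "pull H \<phi> \<tau> (x \<otimes> y) = pull H \<phi> \<tau> (y \<otimes> x)"
    using assms unfolding pull_mult[OF \<open>x \<in> carrier G\<close> \<open>y \<in> carrier G\<close>] pull_mult[OF \<open>y \<in> carrier G\<close> \<open>x \<in> carrier G\<close>]
      H.lf_mult[of _ "\<phi> (ga_delta x)"] H.lf_mult'[of _ "\<phi> (ga_delta y)"]
    by (intro lf_cong) (auto simp: trace_fun_def intro!: lf_cong)
qed

lemma pull_derived:
  assumes "coset_const H (derived H (carrier H)) \<tau>"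
  shows "coset_const G (derived G (carrier G)) (pull H \<phi> \<tau>)"
  unfolding G.coset_const_derived_iff
proof (intro ballI)
  fix x y u assume c: "x \<in> carrier G" "y \<in> carrier G" "u \<in> carrier G"
  let ?f = "\<phi> (ga_delta x)" and ?g = "\<phi> (ga_delta y)" and ?h = "\<phi> (ga_delta u)"
  have e: "\<phi> (ga_delta (v \<otimes> w)) = ga_mult H (\<phi> (ga_delta v)) (\<phi> (ga_delta w))"
    if "v \<in> carrier G" "w \<in> carrier G" for v w
    using that by (simp add: G.delta_mult[symmetric] phi_mult)
  define T where "T = (\<lambda>s. lf H (\<lambda>z. \<tau> (s \<otimes>\<^bsub>H\<^esub> z)) ?h)"
  have T: "T (s \<otimes>\<^bsub>H\<^esub> s') = T (s' \<otimes>\<^bsub>H\<^esub> s)" if "s \<in> carrier H" "s' \<in> carrier H" for s s'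
    unfolding T_def using assms[unfolded H.coset_const_derived_iff] that by (intro lf_cong) blast
  have "pull H \<phi> \<tau> (x \<otimes> y \<otimes> u) = lf H T (ga_mult H ?f ?g)"
    unfolding T_def using c by (simp add: pull_mult e H.lf_mult[of _ "ga_mult H ?f ?g"])
  also have "\<dots> = lf H T (ga_mult H ?g ?f)"
    unfolding H.lf_mult[of T ?f] H.lf_mult'[of T ?g] using T by (intro lf_cong) blast
  also have "\<dots> = pull H \<phi> \<tau> (y \<otimes> x \<otimes> u)"
    unfolding T_def using c by (simp add: pull_mult e H.lf_mult[of _ "ga_mult H ?g ?f"])
  finally show "pull H \<phi> \<tau> (x \<otimes> y \<otimes> u) = pull H \<phi> \<tau> (y \<otimes> x \<otimes> u)" .
qed

text \<open>The isomorphism respects augmentations automatically: composed with the augmentation of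
  the second algebra it is multiplicative on \<open>G\<close>, and in characteristic
  \<open>p\<close> the only \<open>p ^ N\<close>-th root of 1 is 1.\<close>

lemma pull_one:
  assumes "x \<in> carrier G"
  shows "pull H \<phi> (\<lambda>_. 1) x = 1"
proof -
  let ?c = "pull H \<phi> (\<lambda>_. 1 :: 'k)"
  have m: "?c (x \<otimes> y) = ?c x * ?c y" if "x \<in> carrier G" "y \<in> carrier G" for x y
    unfolding pull_mult[OF that] H.lf_mult by (simp add: pull_def lf_def sum_distrib_right)
  have one: "?c \<one> = 1"
    by (simp add: pull_def G.ga_one_delta[symmetric] phi_one) (simp add: H.ga_one_delta H.lf_delta)
  have pw: "?c (x [^] n) = ?c x ^ n" for n :: nat
    by (induction n) (use assms in \<open>auto simp: one m\<close>)
  obtain N where N: "order G = p ^ N" using pG by blast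
  have "?c x ^ p ^ N = 1" using pw[of "p ^ N"] G.pow_order_eq_1[OF assms] N one by simp
  moreover have "(?c x - 1) ^ p ^ N + 1 ^ p ^ N = (?c x - 1 + 1) ^ p ^ N"
    using freshmans_dream'[where 'a = 'k] p char by metis
  ultimately have "(?c x - 1) ^ p ^ N = 0" by simp
  then show ?thesis by simp
qed

lemma phi_central:
  assumes z: "z \<in> ga_carrier G" and c: "\<And>x. x \<in> carrier G \<Longrightarrow> ga_mult G z (ga_delta x) = ga_mult G (ga_delta x) z"
    and h: "h \<in> carrier H" and v: "v \<in> carrier H"
  shows "\<phi> z (conj_by H h v) = \<phi> z v"
proof (rule H.central_element_class_function)
  have c': "ga_mult G z f = ga_mult G f z" if f: "f \<in> ga_carrier G" for f
  proof (rule G.lf_separates)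
    fix \<tau> :: "'a \<Rightarrow> 'k"
    have "lf G (\<lambda>y. \<tau> (x \<otimes> y)) z = lf G (\<lambda>y. \<tau> (y \<otimes> x)) z" if x: "x \<in> carrier G" for x
      using arg_cong[OF c[OF x], of "lf G \<tau>"] x by (simp add: G.lf_mult[of _ "ga_delta x"] G.lf_mult'[of _ _ "ga_delta x"] G.lf_delta)
    then show "lf G \<tau> (ga_mult G z f) = lf G \<tau> (ga_mult G f z)"
      unfolding G.lf_mult[of \<tau> f] G.lf_mult'[of \<tau> z f] by - (rule lf_cong, simp)
  qed simp_all
  have "\<phi> (ga_mult G z (\<psi> (ga_delta h))) = \<phi> (ga_mult G (\<psi> (ga_delta h)) z)"
    using c'[OF psi_closed] h by simp
  then show "ga_mult H (\<phi> z) (ga_delta h) = ga_mult H (ga_delta h) (\<phi> z)"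
    using h z by (simp add: phi_mult psi_closed phi_psi)
qed (use z h v in auto)

lemma sum_center:
  assumes "\<And>h v. h \<in> carrier H \<Longrightarrow> v \<in> carrier H \<Longrightarrow> w (conj_by H h v) = w v"
  shows "(\<Sum>v\<in>carrier H. w v) = (\<Sum>v\<in>centralizer H (carrier H). w v :: 'k)"
proof -
  obtain N where N: "order H = p ^ N" using pH by blast
  have "(\<Sum>v\<in>carrier H. w v) = (\<Sum>v | v \<in> carrier H \<and> (\<forall>h\<in>carrier H. conj_by H h v = v). w v)"
    by (rule sum_fixed_points_p_group[OF H.group_axioms N p char])
      (use assms H.conj_by_compose in \<open>auto simp: conj_by_def[of H "\<one>\<^bsub>H\<^esub>"]\<close>)
  also have "{v. v \<in> carrier H \<and> (\<forall>h\<in>carrier H. conj_by H h v = v)} = centralizer H (carrier H)"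
    using H.center_conj_by_iff by (auto simp: centralizer_def)
  finally show ?thesis .
qed

lemma center_delta_central:
  assumes "z \<in> centralizer G (carrier G)" "x \<in> carrier G"
  shows "ga_mult G (ga_delta z) (ga_delta x) = ga_mult G (ga_delta x) (ga_delta z :: 'a \<Rightarrow> 'k)"
  using assms by (simp add: centralizer_def G.delta_mult)

text \<open>The image of a central group element is a class function whose coefficients on the
  center sum to 1, by \<open>pull_one\<close>. The function
  \<open>v \<mapsto> \<tau> (u \<otimes> v)\<close> is a class function too, because conjugation
  changes \<open>v\<close> by an element of the commutator subgroup. In the pairing of the two only
  the center contributes, and there the value is \<open>\<tau> u\<close>.\<close>

lemma pull_center_derived:
  assumes t: "coset_const H (centralizer H (carrier H) <#>\<^bsub>H\<^esub> derived H (carrier H)) \<tau>"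
  shows "coset_const G (centralizer G (carrier G) <#> derived G (carrier G)) (pull H \<phi> \<tau>)"
proof (rule G.coset_const_mult)
  have tD: "coset_const H (derived H (carrier H)) \<tau>"
  proof (rule H.coset_const_mono[OF t])
    have "\<one>\<^bsub>H\<^esub> \<in> centralizer H (carrier H)" by (simp add: centralizer_def)
    moreover have "derived H (carrier H) \<subseteq> carrier H" by (rule H.derived_in_carrier) simp
    ultimately show "derived H (carrier H) \<subseteq> centralizer H (carrier H) <#>\<^bsub>H\<^esub> derived H (carrier H)"
      unfolding set_mult_def by force
  qed
  have tZ: "coset_const H (centralizer H (carrier H)) \<tau>"
  proof (rule H.coset_const_mono[OF t])
    have "\<one>\<^bsub>H\<^esub> \<in> derived H (carrier H)" using H.derived_is_subgroup[of "carrier H"] subgroup.one_closed by blast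
    then show "centralizer H (carrier H) \<subseteq> centralizer H (carrier H) <#>\<^bsub>H\<^esub> derived H (carrier H)"
      unfolding set_mult_def by (force simp: centralizer_def)
  qed
  show "coset_const G (derived G (carrier G)) (pull H \<phi> \<tau>)" by (rule pull_derived[OF tD])
  show "coset_const G (centralizer G (carrier G)) (pull H \<phi> \<tau>)"
    unfolding coset_const_def
  proof (intro ballI)
    fix x z assume x: "x \<in> carrier G" and z: "z \<in> centralizer G (carrier G)"
    then have zc: "z \<in> carrier G" by (simp add: centralizer_def)
    let ?f = "\<phi> (ga_delta x)" and ?g = "\<phi> (ga_delta z)"
    have cl: "?g (conj_by H h v) = ?g v" if "h \<in> carrier H" "v \<in> carrier H" for h v
      by (rule phi_central) (use that zc center_delta_central[OF z] in auto)
    have aug: "(\<Sum>v\<in>centralizer H (carrier H). ?g v) = 1"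
      using sum_center[of ?g] cl pull_one[OF zc] by (simp add: pull_def lf_def)
    have "lf H (\<lambda>v. \<tau> (u \<otimes>\<^bsub>H\<^esub> v)) ?g = \<tau> u" if u: "u \<in> carrier H" for u
    proof -
      have tc: "\<tau> (u \<otimes>\<^bsub>H\<^esub> conj_by H h v) = \<tau> (u \<otimes>\<^bsub>H\<^esub> v)" if "h \<in> carrier H" "v \<in> carrier H" for h v
      proof -
        have "u \<otimes>\<^bsub>H\<^esub> conj_by H h v = (u \<otimes>\<^bsub>H\<^esub> v) \<otimes>\<^bsub>H\<^esub> (inv\<^bsub>H\<^esub> v \<otimes>\<^bsub>H\<^esub> conj_by H h v)"
          using u that by (simp add: H.m_assoc[symmetric]) (simp add: H.m_assoc)
        then show ?thesis using coset_constD[OF tD _ H.comm_derived[OF that]] u that by simp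
      qed
      have "lf H (\<lambda>v. \<tau> (u \<otimes>\<^bsub>H\<^esub> v)) ?g = (\<Sum>v\<in>centralizer H (carrier H). ?g v * \<tau> (u \<otimes>\<^bsub>H\<^esub> v))"
        unfolding lf_def by (rule sum_center) (use cl tc in simp)
      also have "\<dots> = (\<Sum>v\<in>centralizer H (carrier H). ?g v * \<tau> u)"
        using coset_constD[OF tZ u] by simp
      also have "\<dots> = \<tau> u" unfolding sum_distrib_right[symmetric] aug by simp
      finally show ?thesis .
    qed
    then have "lf H \<tau> (ga_mult H ?f ?g) = lf H \<tau> ?f" unfolding H.lf_mult by (intro lf_cong)
    then show "pull H \<phi> \<tau> (x \<otimes> z) = pull H \<phi> \<tau> x"
      unfolding pull_mult[OF x zc] by (simp add: pull_def)
  qed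
qed (auto simp: centralizer_def intro: subsetD[OF G.derived_in_carrier])

text \<open>If \<open>G\<close> had more central elements than \<open>H\<close>, a nontrivial
  combination of them would have an image vanishing on the center of \<open>H\<close>. This image
  and every trace are class functions, so every trace kills it. But the coefficient at a central
  element \<open>g\<close> is a trace on the first algebra, and some coefficient is nonzero.\<close>

lemma card_center_le: "card (centralizer G (carrier G)) \<le> card (centralizer H (carrier H))"
proof (rule ccontr)
  let ?ZG = "centralizer G (carrier G)" and ?ZH = "centralizer H (carrier H)"
  assume neg: "\<not> ?thesis"
  have sub: "?ZG \<subseteq> carrier G" "?ZH \<subseteq> carrier H" by (auto simp: centralizer_def)
  then have fin: "finite ?ZG" "finite ?ZH" using finite_subset G.fin H.fin by blast+
  have "\<exists>c. (\<exists>g\<in>?ZG. c g \<noteq> 0) \<and> (\<forall>h\<in>?ZH. (\<Sum>g\<in>?ZG. \<phi> (ga_delta g) h * c g) = 0)"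
    by (rule homogeneous_system_nontrivial) (use fin neg in auto)
  then obtain c where c: "\<exists>g\<in>?ZG. c g \<noteq> 0" "\<And>h. h \<in> ?ZH \<Longrightarrow> (\<Sum>g\<in>?ZG. \<phi> (ga_delta g) h * c g) = 0" by blast
  then obtain g where g: "g \<in> ?ZG" "c g \<noteq> 0" by blast
  define w where "w = (\<lambda>h. \<Sum>g\<in>?ZG. c g * \<phi> (ga_delta g) h)"
  interpret S: ga_iso_pair H G \<psi> p by (rule iso_sym)
  define \<tau> where "\<tau> = pull G \<psi> (ga_delta g :: 'a \<Rightarrow> 'k)"
  have "trace_fun G (ga_delta g :: 'a \<Rightarrow> 'k)"
    unfolding trace_fun_def ga_delta_def
  proof (intro ballI)
    fix x y assume x: "x \<in> carrier G" and y: "y \<in> carrier G"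
    have "x \<otimes> y = g \<longleftrightarrow> y \<otimes> x = g" if "x \<in> carrier G" "y \<in> carrier G" for x y
    proof -
      have gc: "g \<in> carrier G" "y \<otimes> g = g \<otimes> y" "x \<otimes> g = g \<otimes> x" using g that by (auto simp: centralizer_def)
      show ?thesis
      proof
        assume "x \<otimes> y = g"
        then have "y \<otimes> x = y \<otimes> g \<otimes> inv y" using that by (auto simp: G.m_assoc)
        then show "y \<otimes> x = g" unfolding gc(2) using that gc(1) by (simp add: G.m_assoc)
      next
        assume "y \<otimes> x = g"
        then have "x \<otimes> y = x \<otimes> g \<otimes> inv x" using that by (auto simp: G.m_assoc)
        then show "x \<otimes> y = g" unfolding gc(3) using that gc(1) by (simp add: G.m_assoc)
      qed
    qed
    then show "(if x \<otimes> y = g then 1 else 0) = (if y \<otimes> x = g then 1 else (0::'k))" using x y by simp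
  qed
  then have tr: "trace_fun H \<tau>" unfolding \<tau>_def by (rule S.pull_trace)
  have cl: "w (conj_by H h v) = w v" if "h \<in> carrier H" "v \<in> carrier H" for h v
    unfolding w_def using that sub center_delta_central
    by (intro sum.cong refl arg_cong[where f = "\<lambda>z. _ * z"] phi_central) auto
  have tc: "\<tau> (conj_by H h v) = \<tau> v" if "h \<in> carrier H" "v \<in> carrier H" for h v
    using tr that unfolding trace_fun_def conj_by_def
    by (metis H.inv_closed H.inv_solve_left H.m_assoc H.m_closed H.l_inv H.l_one)
  have "lf H \<tau> w = (\<Sum>v\<in>?ZH. w v * \<tau> v)"
    unfolding lf_def by (rule sum_center) (use cl tc in simp)
  also have "\<dots> = 0" using c(2) by (simp add: w_def mult.commute)
  finally have "(\<Sum>x\<in>?ZG. c x * pull H \<phi> \<tau> x) = 0" unfolding w_def lf_comb by (simp add: pull_def)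
  moreover have "pull H \<phi> \<tau> x = ga_delta g x" if "x \<in> ?ZG" for x
    unfolding \<tau>_def using pull_pull' that sub by blast
  ultimately have "(\<Sum>x\<in>?ZG. if x = g then c x else 0) = 0" by (simp add: ga_delta_def if_distrib cong: if_cong)
  then show False using fin g by simp
qed

text \<open>The dimension count in elementary form: with more functionals than test points, a
  nontrivial combination would have a pullback vanishing at all of them.\<close>

lemma pull_dimension_bound:
  assumes "finite J" "finite P"
    and inj: "\<And>c. (\<And>x. x \<in> P \<Longrightarrow> pull H \<phi> (\<lambda>y. \<Sum>j\<in>J. c j * \<tau> j y) x = 0) \<Longrightarrow> \<forall>j\<in>J. c j = 0"
  shows "card J \<le> card P"
proof (rule ccontr)
  assume "\<not> ?thesis"
  then obtain c where c: "\<exists>j\<in>J. c j \<noteq> 0" "\<And>x. x \<in> P \<Longrightarrow> (\<Sum>j\<in>J. pull H \<phi> (\<tau> j) x * c j) = 0"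
    using homogeneous_system_nontrivial[OF assms(2,1), of "\<lambda>x j. pull H \<phi> (\<tau> j) x"] by auto
  have "pull H \<phi> (\<lambda>y. \<Sum>j\<in>J. c j * \<tau> j y) x = (\<Sum>j\<in>J. pull H \<phi> (\<tau> j) x * c j)" for x
    unfolding pull_def lf_def sum_distrib_left sum_distrib_right
    by (subst sum.swap) (simp add: mult_ac)
  then show False using inj[of c] c by auto
qed

end

section \<open>Corresponding normal subgroups\<close>

lemma (in group) normal_coset_eqD:
  assumes "N \<lhd> G" "N #> x = N #> y" "x \<in> carrier G" "y \<in> carrier G"
  obtains n where "n \<in> N" "y = x \<otimes> n"
proof -
  interpret N: normal N G by fact
  have "y \<in> N #> x" using assms(2) rcos_self[OF assms(4) N.subgroup_axioms] by simp
  then obtain m where m: "m \<in> N" "y = m \<otimes> x" by (auto simp: r_coset_def)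
  have "inv x \<otimes> m \<otimes> x \<in> N" using N.inv_op_closed1[OF assms(3) m(1)] .
  moreover have "y = x \<otimes> (inv x \<otimes> m \<otimes> x)"
    using m assms(3) N.mem_carrier[OF m(1)] by (simp add: m_assoc[symmetric])
  ultimately show ?thesis using that by blast
qed

lemma (in finite_group) coset_const_cong_coset:
  assumes "coset_const G N \<tau>" "N \<lhd> G" "N #> x = N #> y" "x \<in> carrier G" "y \<in> carrier G"
  shows "\<tau> y = \<tau> x"
proof -
  obtain n where "n \<in> N" "y = x \<otimes> n" using normal_coset_eqD[OF assms(2-5)] by blast
  then show ?thesis using coset_constD[OF assms(1,4)] by simp
qed

lemma (in finite_group) coset_representatives:
  assumes "N \<lhd> G"
  obtains rep where "\<And>x. x \<in> carrier G \<Longrightarrow> rep (N #> x) \<in> carrier G"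
    "\<And>x. x \<in> carrier G \<Longrightarrow> \<exists>n\<in>N. x = rep (N #> x) \<otimes> n"
proof -
  define rep where "rep = (\<lambda>B. SOME x. x \<in> carrier G \<and> B = N #> x)"
  have rep: "rep (N #> x) \<in> carrier G \<and> N #> x = N #> rep (N #> x)" if "x \<in> carrier G" for x
    unfolding rep_def by (rule someI_ex) (use that in blast)
  have "\<exists>n\<in>N. x = rep (N #> x) \<otimes> n" if "x \<in> carrier G" for x
    using normal_coset_eqD[OF assms, of "rep (N #> x)" x] rep[OF that] that by metis
  then show ?thesis using that[of rep] rep by blast
qed

context ga_iso_pair
begin

text \<open>One half of the correspondence in the overview; the other half, and with it equality of
  orders, comes from \<open>\<psi>\<close>.\<close>

definition pulls_back :: "'a set \<Rightarrow> 'c set \<Rightarrow> bool" where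
  "pulls_back N N' \<longleftrightarrow> (\<forall>\<tau> :: 'c \<Rightarrow> 'k. coset_const H N' \<tau> \<longrightarrow> coset_const G N (pull H \<phi> \<tau>))"

lemma pull_zero:
  assumes "\<And>x. x \<in> carrier G \<Longrightarrow> pull H \<phi> \<tau> x = 0" "y \<in> carrier H"
  shows "\<tau> y = 0"
proof -
  have "\<tau> y = lf G (pull H \<phi> \<tau>) (\<psi> (ga_delta y))"
    using pull_pull[OF assms(2), of \<tau>] by (simp add: pull_def[of G])
  also have "\<dots> = 0" unfolding lf_def using assms(1) by simp
  finally show ?thesis .
qed

text \<open>The indicators of the cosets of \<open>N'\<close> are independent, and the pullbacks of
  their combinations are determined by one value on each coset of \<open>N\<close>.\<close>

lemma pulls_back_index:
  assumes N: "N \<lhd> G" and N': "N' \<lhd> H" and pb: "pulls_back N N'"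
  shows "card (rcosets\<^bsub>H\<^esub> N') \<le> card (rcosets\<^bsub>G\<^esub> N)"
proof -
  interpret N: normal N G by fact
  interpret N': normal N' H by fact
  obtain rep where rep: "\<And>x. x \<in> carrier G \<Longrightarrow> rep (N #> x) \<in> carrier G"
    "\<And>x. x \<in> carrier G \<Longrightarrow> \<exists>n\<in>N. x = rep (N #> x) \<otimes> n"
    using G.coset_representatives[OF N] by blast
  define P where "P = rep ` (rcosets\<^bsub>G\<^esub> N)"
  have finG: "finite (rcosets\<^bsub>G\<^esub> N)" and finH: "finite (rcosets\<^bsub>H\<^esub> N')"
    by (auto simp: RCOSETS_def)
  have "card (rcosets\<^bsub>H\<^esub> N') \<le> card P"
  proof (rule pull_dimension_bound[where \<tau> = "\<lambda>B y. if N' #>\<^bsub>H\<^esub> y = B then 1 else 0"])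
    fix c assume c: "\<And>x. x \<in> P \<Longrightarrow> pull H \<phi> (\<lambda>y. \<Sum>B\<in>rcosets\<^bsub>H\<^esub> N'. c B * (if N' #>\<^bsub>H\<^esub> y = B then 1 else 0)) x = 0"
    define \<sigma> where "\<sigma> = (\<lambda>y. \<Sum>B\<in>rcosets\<^bsub>H\<^esub> N'. c B * (if N' #>\<^bsub>H\<^esub> y = B then 1 else 0))"
    have \<sigma>: "\<sigma> y = c (N' #>\<^bsub>H\<^esub> y)" if "y \<in> carrier H" for y
    proof -
      have "\<sigma> y = (\<Sum>B\<in>rcosets\<^bsub>H\<^esub> N'. if N' #>\<^bsub>H\<^esub> y = B then c B else 0)"
        unfolding \<sigma>_def by (rule sum.cong) auto
      also have "\<dots> = c (N' #>\<^bsub>H\<^esub> y)" using finH that by (auto simp: RCOSETS_def)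
      finally show ?thesis .
    qed
    have "coset_const H N' \<sigma>"
      unfolding coset_const_def using \<sigma> H.normal_coset_absorb[OF N'] N'.mem_carrier by simp
    then have pc: "coset_const G N (pull H \<phi> \<sigma>)" using pb by (simp add: pulls_back_def)
    have "pull H \<phi> \<sigma> x = 0" if x: "x \<in> carrier G" for x
    proof -
      have "rep (N #> x) \<in> P" using x by (auto simp: P_def RCOSETS_def)
      then have "pull H \<phi> \<sigma> (rep (N #> x)) = 0" using c unfolding \<sigma>_def by blast
      moreover obtain n where "n \<in> N" "x = rep (N #> x) \<otimes> n" using rep(2)[OF x] by blast
      ultimately show ?thesis using coset_constD[OF pc rep(1)[OF x], of n] by simp
    qed
    then have z: "\<sigma> y = 0" if "y \<in> carrier H" for y using pull_zero that by blast
    show "\<forall>B\<in>rcosets\<^bsub>H\<^esub> N'. c B = 0"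
    proof
      fix B assume "B \<in> rcosets\<^bsub>H\<^esub> N'"
      then obtain y where "y \<in> carrier H" "B = N' #>\<^bsub>H\<^esub> y" by (auto simp: RCOSETS_def)
      then show "c B = 0" using \<sigma> z by metis
    qed
  qed (use finG finH in \<open>auto simp: P_def\<close>)
  also have "card P \<le> card (rcosets\<^bsub>G\<^esub> N)" unfolding P_def by (rule card_image_le[OF finG])
  finally show ?thesis .
qed

lemma pulls_back_mult:
  assumes "subgroup N G" "subgroup M G" "subgroup N' H" "subgroup M' H" "pulls_back N N'" "pulls_back M M'"
  shows "pulls_back (N <#> M) (N' <#>\<^bsub>H\<^esub> M')"
  unfolding pulls_back_def
proof (intro allI impI)
  fix \<tau> :: "'c \<Rightarrow> 'k" assume t: "coset_const H (N' <#>\<^bsub>H\<^esub> M') \<tau>"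
  have "N' \<subseteq> N' <#>\<^bsub>H\<^esub> M'" "M' \<subseteq> N' <#>\<^bsub>H\<^esub> M'"
    using subgroup.one_closed[OF assms(3)] subgroup.one_closed[OF assms(4)]
      subgroup.mem_carrier[OF assms(3)] subgroup.mem_carrier[OF assms(4)]
    unfolding set_mult_def by force+
  then have "coset_const H N' \<tau>" "coset_const H M' \<tau>" using H.coset_const_mono[OF t] by auto
  then show "coset_const G (N <#> M) (pull H \<phi> \<tau>)"
    using subgroup.subset[OF assms(1)] subgroup.subset[OF assms(2)] assms(5,6)
    by (intro G.coset_const_mult) (auto simp: pulls_back_def)
qed

end

section \<open>Power maps\<close>

primrec ga_pow :: "('a, 'b) monoid_scheme \<Rightarrow> ('a \<Rightarrow> 'k::field) \<Rightarrow> nat \<Rightarrow> ('a \<Rightarrow> 'k)" where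
  "ga_pow G f 0 = ga_one G"
| "ga_pow G f (Suc n) = ga_mult G f (ga_pow G f n)"

context finite_group
begin

definition tuples :: "nat \<Rightarrow> 'a list set" where
  "tuples n = {xs. set xs \<subseteq> carrier G \<and> length xs = n}"

definition list_mult :: "'a list \<Rightarrow> 'a" where "list_mult xs = foldr (\<otimes>) xs \<one>"

lemma finite_tuples [simp]: "finite (tuples n)"
  unfolding tuples_def by (rule finite_lists_length_eq) simp

lemma list_mult_closed: "set xs \<subseteq> carrier G \<Longrightarrow> list_mult xs \<in> carrier G"
  by (induction xs) (auto simp: list_mult_def)

lemma list_mult_append: "set xs \<subseteq> carrier G \<Longrightarrow> y \<in> carrier G \<Longrightarrow> list_mult (xs @ [y]) = list_mult xs \<otimes> y"
  by (induction xs) (auto simp: list_mult_def m_assoc list_mult_closed[unfolded list_mult_def])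

lemma lf_ga_pow:
  "lf G \<tau> (ga_pow G f n) = (\<Sum>xs\<in>tuples n. prod_list (map f xs) * \<tau> (list_mult xs))"
proof (induction n arbitrary: \<tau>)
  case 0
  have "tuples 0 = {[]}" by (auto simp: tuples_def)
  then show ?case by (simp add: ga_one_delta lf_delta list_mult_def)
next
  case (Suc n)
  have img: "tuples (Suc n) = (\<lambda>(x, xs). x # xs) ` (carrier G \<times> tuples n)"
    by (auto simp: tuples_def length_Suc_conv image_iff)
  have inj: "inj_on (\<lambda>(x, xs). x # xs) (carrier G \<times> tuples n)" by (auto simp: inj_on_def)
  have "(\<Sum>xs\<in>tuples (Suc n). prod_list (map f xs) * \<tau> (list_mult xs))
    = (\<Sum>(x, xs)\<in>carrier G \<times> tuples n. f x * prod_list (map f xs) * \<tau> (x \<otimes> list_mult xs))"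
    unfolding img by (subst sum.reindex[OF inj]) (auto simp: list_mult_def intro!: sum.cong)
  also have "\<dots> = (\<Sum>x\<in>carrier G. f x * (\<Sum>xs\<in>tuples n. prod_list (map f xs) * \<tau> (x \<otimes> list_mult xs)))"
    by (simp add: sum.cartesian_product[symmetric] sum_distrib_left mult.assoc)
  also have "\<dots> = lf G \<tau> (ga_pow G f (Suc n))"
    unfolding ga_pow.simps lf_mult Suc by (simp add: lf_def)
  finally show ?case by simp
qed

lemma rotate1_fixed_replicate:
  assumes "rotate1 xs = xs" "xs \<noteq> []"
  shows "xs = replicate (length xs) (hd xs)"
proof -
  have "xs ! i = hd xs" if "i < length xs" for i
    using that
  proof (induction i)
    case 0 then show ?case using assms(2) by (simp add: hd_conv_nth)
  next
    case (Suc i)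
    have "rotate1 xs ! i = xs ! Suc i" using nth_rotate1[of i xs] Suc.prems by simp
    then show ?case using assms(1) Suc by simp
  qed
  then show ?thesis by (intro nth_equalityI) auto
qed

lemma list_mult_replicate: "x \<in> carrier G \<Longrightarrow> list_mult (replicate n x) = x [^] n"
proof (induction n)
  case (Suc n)
  then have "list_mult (replicate (Suc n) x) = x \<otimes> x [^] n" by (simp add: list_mult_def)
  then show ?case using Suc.prems nat_pow_Suc2 by metis
qed (simp add: list_mult_def)

text \<open>Rotating the factors does not change the trace of a product, so only constant tuples survive.\<close>
lemma trace_ga_pow:
  fixes f :: "'a \<Rightarrow> 'k::field"
  assumes "Factorial_Ring.prime p" "CHAR('k) = p" "trace_fun G \<tau>"
  shows "lf G \<tau> (ga_pow G f (p ^ k)) = (\<Sum>x\<in>carrier G. f x ^ (p ^ k) * \<tau> (x [^] (p ^ k)))"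
proof -
  let ?P = "p ^ k"
  have P0: "?P > 0" using assms(1) prime_gt_0_nat by simp
  have "(\<Sum>xs\<in>tuples ?P. prod_list (map f xs) * \<tau> (list_mult xs))
    = (\<Sum>xs | xs \<in> tuples ?P \<and> rotate1 xs = xs. prod_list (map f xs) * \<tau> (list_mult xs))"
  proof (rule sum_fixed_points_permutation[OF assms(1,2), where N = k])
    fix xs assume xs: "xs \<in> tuples ?P"
    show "rotate1 xs \<in> tuples ?P" using xs by (simp add: tuples_def)
    show "(rotate1 ^^ ?P) xs = xs" using xs rotate_id[of ?P xs] by (simp add: tuples_def rotate_def)
    obtain x ys where x: "xs = x # ys" using xs P0 by (cases xs) (auto simp: tuples_def)
    have c: "x \<in> carrier G" "set ys \<subseteq> carrier G" using xs x by (auto simp: tuples_def)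
    have "\<tau> (list_mult (ys @ [x])) = \<tau> (x \<otimes> list_mult ys)"
      using assms(3) c list_mult_closed by (simp add: list_mult_append trace_fun_def)
    then show "prod_list (map f (rotate1 xs)) * \<tau> (list_mult (rotate1 xs)) = prod_list (map f xs) * \<tau> (list_mult xs)"
      by (simp add: x mult_ac list_mult_def)
  qed simp
  also have "{xs. xs \<in> tuples ?P \<and> rotate1 xs = xs} = (\<lambda>x. replicate ?P x) ` carrier G"
  proof
    show "{xs. xs \<in> tuples ?P \<and> rotate1 xs = xs} \<subseteq> (\<lambda>x. replicate ?P x) ` carrier G"
    proof clarify
      fix xs assume xs: "xs \<in> tuples ?P" "rotate1 xs = xs"
      then have "xs \<noteq> []" using P0 by (auto simp: tuples_def)
      then have "xs = replicate ?P (hd xs)" "hd xs \<in> carrier G"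
        using rotate1_fixed_replicate[OF xs(2)] xs(1) hd_in_set[of xs] by (auto simp: tuples_def)
      then show "xs \<in> (\<lambda>x. replicate ?P x) ` carrier G" by blast
    qed
    show "(\<lambda>x. replicate ?P x) ` carrier G \<subseteq> {xs. xs \<in> tuples ?P \<and> rotate1 xs = xs}"
      by (auto simp: tuples_def)
  qed
  also have "(\<Sum>xs\<in>(\<lambda>x. replicate ?P x) ` carrier G. prod_list (map f xs) * \<tau> (list_mult xs))
    = (\<Sum>x\<in>carrier G. f x ^ ?P * \<tau> (x [^] ?P))"
  proof (subst sum.reindex)
    show "inj_on (\<lambda>x. replicate ?P x) (carrier G)" using P0 by (auto simp: inj_on_def)
  qed (auto simp: list_mult_replicate intro!: sum.cong)
  finally show ?thesis by (simp add: lf_ga_pow)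
qed

end

context ga_iso_pair
begin

lemma phi_ga_pow: "f \<in> ga_carrier G \<Longrightarrow> ga_pow G f n \<in> ga_carrier G \<and> \<phi> (ga_pow G f n) = ga_pow H (\<phi> f) n"
proof (induction n)
  case 0 then show ?case using phi_one by (simp add: ga_one_def ga_carrier_def)
qed (auto simp: phi_mult)

text \<open>For \<open>w\<close> with \<open>w [^] (p ^ k)\<close> in \<open>M\<close>, the pullback
  has to kill \<open>x \<otimes> w - x\<close>. Traces constant on the cosets of \<open>M'\<close>
  vanish on the \<open>p ^ k\<close>-th power of its image, as a computation in \<open>G\<close>
  shows. Evaluated in \<open>H\<close> for an indicator trace, this says that the coefficients of
  the image sum to zero over each fibre of the power map modulo \<open>M'\<close>, and
  \<open>\<tau>\<close> is constant on these fibres.\<close>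

lemma pulls_back_power_preimage:
  assumes M: "M \<lhd> G" and M': "M' \<lhd> H" and pb: "pulls_back M M'"
    and homG: "\<And>x y. x \<in> carrier G \<Longrightarrow> y \<in> carrier G \<Longrightarrow>
      M #> ((x \<otimes> y) [^] (p ^ k)) = M #> (x [^] (p ^ k) \<otimes> y [^] (p ^ k))"
    and homH: "\<And>x y. x \<in> carrier H \<Longrightarrow> y \<in> carrier H \<Longrightarrow>
      M' #>\<^bsub>H\<^esub> ((x \<otimes>\<^bsub>H\<^esub> y) [^]\<^bsub>H\<^esub> (p ^ k)) = M' #>\<^bsub>H\<^esub> (x [^]\<^bsub>H\<^esub> (p ^ k) \<otimes>\<^bsub>H\<^esub> y [^]\<^bsub>H\<^esub> (p ^ k))"
    and cenH: "\<And>x y. x \<in> carrier H \<Longrightarrow> y \<in> carrier H \<Longrightarrow>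
      M' #>\<^bsub>H\<^esub> (x [^]\<^bsub>H\<^esub> (p ^ k) \<otimes>\<^bsub>H\<^esub> y) = M' #>\<^bsub>H\<^esub> (y \<otimes>\<^bsub>H\<^esub> x [^]\<^bsub>H\<^esub> (p ^ k))"
  shows "pulls_back {x \<in> carrier G. x [^] (p ^ k) \<in> M} {x \<in> carrier H. x [^]\<^bsub>H\<^esub> (p ^ k) \<in> M'}"
  unfolding pulls_back_def
proof (intro allI impI)
  let ?P = "p ^ k"
  interpret M: normal M G by fact
  interpret M': normal M' H by fact
  let ?\<pi> = "\<lambda>x. M' #>\<^bsub>H\<^esub> x"
  fix \<tau> :: "'c \<Rightarrow> 'k" assume t: "coset_const H {x \<in> carrier H. x [^]\<^bsub>H\<^esub> ?P \<in> M'} \<tau>"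
  \<comment> \<open>By \<open>homH\<close>, two elements of a fibre differ by an element of the
    preimage of \<open>M'\<close>.\<close>
  have fiber: "\<tau> h = \<tau> g" if g: "g \<in> carrier H" and h: "h \<in> carrier H" and e: "?\<pi> (h [^]\<^bsub>H\<^esub> ?P) = ?\<pi> (g [^]\<^bsub>H\<^esub> ?P)" for g h
  proof -
    define w where "w = inv\<^bsub>H\<^esub> g \<otimes>\<^bsub>H\<^esub> h"
    have w: "w \<in> carrier H" "h = g \<otimes>\<^bsub>H\<^esub> w" using g h by (auto simp: w_def H.m_assoc[symmetric])
    have "?\<pi> (g [^]\<^bsub>H\<^esub> ?P) = ?\<pi> (g [^]\<^bsub>H\<^esub> ?P \<otimes>\<^bsub>H\<^esub> w [^]\<^bsub>H\<^esub> ?P)" using homH[OF g w(1)] e w(2) by simp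
    then obtain n where n: "n \<in> M'" "g [^]\<^bsub>H\<^esub> ?P \<otimes>\<^bsub>H\<^esub> w [^]\<^bsub>H\<^esub> ?P = g [^]\<^bsub>H\<^esub> ?P \<otimes>\<^bsub>H\<^esub> n"
      using H.normal_coset_eqD[OF M'] g w(1) by (metis H.m_closed H.nat_pow_closed)
    then have "w [^]\<^bsub>H\<^esub> ?P = n" using g w(1) M'.mem_carrier by (metis H.l_cancel H.nat_pow_closed)
    then show ?thesis using coset_constD[OF t g, of w] n w by simp
  qed
  have tr_sum: "lf H \<tau> y = 0"
    if y: "\<And>\<sigma>. coset_const H M' \<sigma> \<Longrightarrow> trace_fun H \<sigma> \<Longrightarrow> lf H \<sigma> (ga_pow H y ?P) = 0" for y
  proof -
    have zero: "(\<Sum>x | x \<in> carrier H \<and> ?\<pi> (x [^]\<^bsub>H\<^esub> ?P) = ?\<pi> (g [^]\<^bsub>H\<^esub> ?P). y x) = 0" if g: "g \<in> carrier H" for g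
    proof -
      let ?F = "{x. x \<in> carrier H \<and> ?\<pi> (x [^]\<^bsub>H\<^esub> ?P) = ?\<pi> (g [^]\<^bsub>H\<^esub> ?P)}"
      \<comment> \<open>The indicator of one coset; it is a trace because this coset is central
        modulo \<open>M'\<close> by \<open>cenH\<close>.\<close>
      define \<sigma> where "\<sigma> = (\<lambda>x. if ?\<pi> x = ?\<pi> (g [^]\<^bsub>H\<^esub> ?P) then 1 else 0 :: 'k)"
      have "coset_const H M' \<sigma>"
        using H.normal_coset_absorb[OF M'] by (simp add: coset_const_def \<sigma>_def)
      moreover have "trace_fun H \<sigma>"
        unfolding trace_fun_def
      proof (intro ballI)
        have w: "?\<pi> (v \<otimes>\<^bsub>H\<^esub> u) = ?\<pi> (g [^]\<^bsub>H\<^esub> ?P)" if u: "u \<in> carrier H" and v: "v \<in> carrier H"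
          and e: "?\<pi> (u \<otimes>\<^bsub>H\<^esub> v) = ?\<pi> (g [^]\<^bsub>H\<^esub> ?P)" for u v
        proof -
          have "?\<pi> (v \<otimes>\<^bsub>H\<^esub> u) = ?\<pi> (inv\<^bsub>H\<^esub> u \<otimes>\<^bsub>H\<^esub> ((u \<otimes>\<^bsub>H\<^esub> v) \<otimes>\<^bsub>H\<^esub> u))"
            using u v by (simp add: H.m_assoc[symmetric])
          also have "\<dots> = ?\<pi> (inv\<^bsub>H\<^esub> u) <#>\<^bsub>H\<^esub> (?\<pi> (u \<otimes>\<^bsub>H\<^esub> v) <#>\<^bsub>H\<^esub> ?\<pi> u)"
            using u v by (simp add: M'.rcos_sum)
          also have "\<dots> = ?\<pi> (inv\<^bsub>H\<^esub> u) <#>\<^bsub>H\<^esub> ?\<pi> (u \<otimes>\<^bsub>H\<^esub> g [^]\<^bsub>H\<^esub> ?P)"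
            unfolding e using cenH[OF g u] u g by (simp add: M'.rcos_sum)
          also have "\<dots> = ?\<pi> (g [^]\<^bsub>H\<^esub> ?P)" using u g by (simp add: M'.rcos_sum H.m_assoc[symmetric])
          finally show ?thesis .
        qed
        fix u v assume "u \<in> carrier H" "v \<in> carrier H"
        then show "\<sigma> (u \<otimes>\<^bsub>H\<^esub> v) = \<sigma> (v \<otimes>\<^bsub>H\<^esub> u)" unfolding \<sigma>_def using w by metis
      qed
      ultimately have "(\<Sum>x\<in>carrier H. y x ^ ?P * \<sigma> (x [^]\<^bsub>H\<^esub> ?P)) = 0"
        using y H.trace_ga_pow[OF p char, of \<sigma> y k] by metis
      moreover have "(\<Sum>x\<in>carrier H. y x ^ ?P * \<sigma> (x [^]\<^bsub>H\<^esub> ?P)) = (\<Sum>x\<in>?F. y x ^ ?P)"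
        by (rule sum.mono_neutral_cong_right) (auto simp: \<sigma>_def)
      \<comment> \<open>In characteristic \<open>p\<close> the sum of the powers is the power of the
        sum, so the sum itself vanishes.\<close>
      moreover have "(\<Sum>x\<in>?F. y x ^ ?P) = (\<Sum>x\<in>?F. y x) ^ ?P"
        by (rule freshmans_dream_sum'[symmetric]) (use p char in auto)
      ultimately show ?thesis by simp
    qed
    have "lf H \<tau> y = (\<Sum>B\<in>(\<lambda>x. ?\<pi> (x [^]\<^bsub>H\<^esub> ?P)) ` carrier H. \<Sum>x | x \<in> carrier H \<and> ?\<pi> (x [^]\<^bsub>H\<^esub> ?P) = B. y x * \<tau> x)"
      unfolding lf_def by (rule sum.image_gen) simp
    also have "\<dots> = 0"
    proof (rule sum.neutral, rule ballI)
      fix B assume "B \<in> (\<lambda>x. ?\<pi> (x [^]\<^bsub>H\<^esub> ?P)) ` carrier H"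
      then obtain g where g: "g \<in> carrier H" "B = ?\<pi> (g [^]\<^bsub>H\<^esub> ?P)" by auto
      have "(\<Sum>x | x \<in> carrier H \<and> ?\<pi> (x [^]\<^bsub>H\<^esub> ?P) = B. y x * \<tau> x)
        = (\<Sum>x | x \<in> carrier H \<and> ?\<pi> (x [^]\<^bsub>H\<^esub> ?P) = B. y x * \<tau> g)"
        by (rule sum.cong[OF refl]) (use fiber[OF g(1)] g(2) in auto)
      also have "\<dots> = 0" unfolding sum_distrib_right[symmetric] g(2) zero[OF g(1)] by simp
      finally show "(\<Sum>x | x \<in> carrier H \<and> ?\<pi> (x [^]\<^bsub>H\<^esub> ?P) = B. y x * \<tau> x) = 0" .
    qed
    finally show ?thesis .
  qed
  show "coset_const G {x \<in> carrier G. x [^] ?P \<in> M} (pull H \<phi> \<tau>)"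
    unfolding coset_const_def
  proof (intro ballI)
    fix x w assume x: "x \<in> carrier G" and "w \<in> {x \<in> carrier G. x [^] ?P \<in> M}"
    then have w: "w \<in> carrier G" "w [^] ?P \<in> M" by auto
    show "pull H \<phi> \<tau> (x \<otimes> w) = pull H \<phi> \<tau> x"
    proof (cases "x \<otimes> w = x")
      case False
      define y where "y = (\<lambda>u. ga_delta (x \<otimes> w) u - ga_delta x u :: 'k)"
      have yc: "y \<in> ga_carrier G" using x w by (auto simp: y_def ga_carrier_def ga_delta_def)
      have ly: "lf G \<rho> y = \<rho> (x \<otimes> w) - \<rho> x" for \<rho>
        using G.lf_delta[of "x \<otimes> w" \<rho>] G.lf_delta[of x \<rho>] x w(1)
        by (simp add: y_def lf_def left_diff_distrib sum_subtractf)
      have "lf H \<tau> (\<phi> y) = 0"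
      proof (rule tr_sum)
        fix \<sigma> :: "'c \<Rightarrow> 'k" assume s: "coset_const H M' \<sigma>" "trace_fun H \<sigma>"
        let ?\<rho> = "pull H \<phi> \<sigma>"
        have cM: "coset_const G M ?\<rho>" using pb s(1) by (simp add: pulls_back_def)
        have "lf H \<sigma> (ga_pow H (\<phi> y) ?P) = lf G ?\<rho> (ga_pow G y ?P)"
          using phi_ga_pow[OF yc, of ?P] lf_phi by metis
        also have "\<dots> = (\<Sum>u\<in>carrier G. y u ^ ?P * ?\<rho> (u [^] ?P))"
          by (rule G.trace_ga_pow[OF p char pull_trace[OF s(2)]])
        also have "\<dots> = (\<Sum>u\<in>carrier G. y u * ?\<rho> (u [^] ?P))"
        proof (rule sum.cong[OF refl])
          fix u
          \<comment> \<open>The coefficients are 0, 1 and -1, and -1 is its own \<open>?P\<close>-th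
            power because \<open>p\<close> is odd.\<close>
          have "y u ^ ?P = y u"
            using False podd p1 by (auto simp: y_def ga_delta_def power_0_left)
          then show "y u ^ ?P * ?\<rho> (u [^] ?P) = y u * ?\<rho> (u [^] ?P)" by simp
        qed
        also have "\<dots> = ?\<rho> ((x \<otimes> w) [^] ?P) - ?\<rho> (x [^] ?P)"
          using ly[of "\<lambda>u. ?\<rho> (u [^] ?P)"] by (simp add: lf_def)
        also have "\<dots> = 0"
        proof -
          have "M #> ((x \<otimes> w) [^] ?P) = M #> (x [^] ?P)"
            using homG[OF x w(1)] G.normal_coset_absorb[OF M w(2)] x by simp
          then show ?thesis using G.coset_const_cong_coset[OF cM M, of "x [^] ?P" "(x \<otimes> w) [^] ?P"] x w(1) by simp
        qed
        finally show "lf H \<sigma> (ga_pow H (\<phi> y) ?P) = 0" .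
      qed
      then show ?thesis using ly lf_phi[OF yc] by simp
    qed simp
  qed
qed

end

section \<open>Powers of the augmentation ideal of the commutator subgroup\<close>

text \<open>The kernel of the projection to the group algebra of the abelianization, described by
  functionals so that \<open>pull_derived\<close> carries it over.\<close>

definition in_aug_ideal :: "('a, 'b) monoid_scheme \<Rightarrow> ('a \<Rightarrow> 'k::field) \<Rightarrow> bool" where
  "in_aug_ideal G y \<longleftrightarrow> y \<in> ga_carrier G \<and>
    (\<forall>\<tau>. coset_const G (derived G (carrier G)) \<tau> \<longrightarrow> lf G \<tau> y = 0)"

text \<open>\<open>kills G i \<tau>\<close> says that \<open>\<tau>\<close> vanishes on the \<open>i\<close>-th power of the ideal \<open>in_aug_ideal G\<close>.\<close>
fun kills :: "('a, 'b) monoid_scheme \<Rightarrow> nat \<Rightarrow> ('a \<Rightarrow> 'k::field) \<Rightarrow> bool" where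
  "kills G 0 \<tau> \<longleftrightarrow> (\<forall>x\<in>carrier G. \<tau> x = 0)"
| "kills G (Suc i) \<tau> \<longleftrightarrow> (\<forall>y. in_aug_ideal G y \<longrightarrow> kills G i (\<lambda>x. lf G (\<lambda>u. \<tau> (u \<otimes>\<^bsub>G\<^esub> x)) y))"

lemma kills_cong:
  assumes "group G" "\<And>x. x \<in> carrier G \<Longrightarrow> \<tau> x = \<sigma> x"
  shows "kills G i \<tau> = kills G i \<sigma>"
  using assms(2)
proof (induction i arbitrary: \<tau> \<sigma>)
  case (Suc i)
  interpret group G by fact
  have "kills G i (\<lambda>x. lf G (\<lambda>u. \<tau> (u \<otimes>\<^bsub>G\<^esub> x)) y) = kills G i (\<lambda>x. lf G (\<lambda>u. \<sigma> (u \<otimes>\<^bsub>G\<^esub> x)) y)" for y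
    by (rule Suc.IH) (rule lf_cong, simp add: Suc.prems)
  then show ?case by simp
qed simp

context ga_iso_pair
begin

lemma phi_aug_ideal: "in_aug_ideal G y \<Longrightarrow> in_aug_ideal H (\<phi> y)"
  using pull_derived lf_phi[of y] by (auto simp: in_aug_ideal_def)

lemma pull_kills: "kills H i \<tau> \<Longrightarrow> kills G i (pull H \<phi> \<tau>)"
proof (induction i arbitrary: \<tau>)
  case 0 then show ?case by (simp add: pull_def lf_def)
next
  case (Suc i)
  show ?case
  proof (simp, intro allI impI)
    fix y :: "'a \<Rightarrow> 'k" assume y: "in_aug_ideal G y"
    then have yc: "y \<in> ga_carrier G" by (simp add: in_aug_ideal_def)
    define \<rho> where "\<rho> = (\<lambda>x. lf H (\<lambda>u. \<tau> (u \<otimes>\<^bsub>H\<^esub> x)) (\<phi> y))"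
    have "kills H i \<rho>" using Suc.prems phi_aug_ideal[OF y] by (simp add: \<rho>_def)
    then have "kills G i (pull H \<phi> \<rho>)" by (rule Suc.IH)
    moreover have "lf G (\<lambda>u. pull H \<phi> \<tau> (u \<otimes> x)) y = pull H \<phi> \<rho> x" if x: "x \<in> carrier G" for x
    proof -
      define T where "T = (\<lambda>u. lf H (\<lambda>z. \<tau> (u \<otimes>\<^bsub>H\<^esub> z)) (\<phi> (ga_delta x)))"
      have "lf G (\<lambda>u. pull H \<phi> \<tau> (u \<otimes> x)) y = lf G (pull H \<phi> T) y"
        by (rule lf_cong, subst pull_mult[OF _ x], assumption) (simp only: H.lf_mult T_def pull_def)
      also have "\<dots> = lf H T (\<phi> y)" using lf_phi[OF yc] by simp
      also have "\<dots> = pull H \<phi> \<rho> x"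
        unfolding T_def \<rho>_def pull_def H.lf_mult[symmetric] H.lf_mult'[symmetric] ..
      finally show ?thesis .
    qed
    ultimately show "kills G i (\<lambda>x. lf G (\<lambda>u. pull H \<phi> \<tau> (u \<otimes> x)) y)"
      using kills_cong[OF G.group_axioms, of "\<lambda>x. lf G (\<lambda>u. pull H \<phi> \<tau> (u \<otimes> x)) y" "pull H \<phi> \<rho>" i] by simp
  qed
qed

end

context finite_group
begin

lemma lf_diff_delta:
  "x \<in> carrier G \<Longrightarrow> z \<in> carrier G \<Longrightarrow> lf G \<tau> (\<lambda>u. ga_delta z u - ga_delta x u) = \<tau> z - \<tau> x"
  using lf_delta[of x \<tau>] lf_delta[of z \<tau>] by (simp add: lf_def left_diff_distrib sum_subtractf)

lemma aug_ideal_translates: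
  assumes s: "coset_const G (derived G (carrier G)) \<sigma>" and y: "in_aug_ideal G y" and x: "x \<in> carrier G"
  shows "lf G (\<lambda>u. \<sigma> (u \<otimes> x)) y = 0"
proof -
  have "coset_const G (derived G (carrier G)) (\<lambda>u. \<sigma> (u \<otimes> x))"
    unfolding coset_const_def
  proof (intro ballI)
    fix u n assume u: "u \<in> carrier G" and n: "n \<in> derived G (carrier G)"
    have nc: "n \<in> carrier G" using n derived_in_carrier[of "carrier G"] by auto
    have "inv x \<otimes> n \<otimes> x \<in> derived G (carrier G)"
      by (rule normal.inv_op_closed1[OF derived_self_is_normal x n])
    moreover have "u \<otimes> n \<otimes> x = (u \<otimes> x) \<otimes> (inv x \<otimes> n \<otimes> x)"
    proof -
      have "(u \<otimes> x) \<otimes> (inv x \<otimes> n \<otimes> x) = u \<otimes> (x \<otimes> inv x) \<otimes> n \<otimes> x"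
        using u x nc by (simp only: m_assoc m_closed inv_closed)
      then show ?thesis using u x nc by simp
    qed
    ultimately show "\<sigma> (u \<otimes> n \<otimes> x) = \<sigma> (u \<otimes> x)" using coset_constD[OF s] u x by simp
  qed
  then show ?thesis using y by (simp add: in_aug_ideal_def)
qed

lemma delta_diff_aug_ideal:
  assumes "u \<in> carrier G" "n \<in> derived G (carrier G)"
  shows "in_aug_ideal G (\<lambda>v. ga_delta (u \<otimes> n) v - ga_delta u v :: 'k::field)"
proof -
  have "n \<in> carrier G" using assms(2) derived_in_carrier[of "carrier G"] by auto
  then show ?thesis
    using assms by (auto simp: in_aug_ideal_def lf_diff_delta coset_constD) (auto simp: ga_carrier_def ga_delta_def)
qed

lemma aug_ideal_annihilator:
  fixes \<sigma> :: "'a \<Rightarrow> 'k::field"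
  shows "(\<forall>y. in_aug_ideal G y \<longrightarrow> (\<forall>x\<in>carrier G. lf G (\<lambda>u. \<sigma> (u \<otimes> x)) y = 0))
    \<longleftrightarrow> coset_const G (derived G (carrier G)) \<sigma>" (is "?L \<longleftrightarrow> ?R")
proof
  assume L: ?L
  show ?R unfolding coset_const_def
  proof (intro ballI)
    fix u n assume u: "u \<in> carrier G" and n: "n \<in> derived G (carrier G)"
    have nc: "n \<in> carrier G" using n derived_in_carrier[of "carrier G"] by auto
    have "lf G (\<lambda>v. \<sigma> (v \<otimes> \<one>)) (\<lambda>v. ga_delta (u \<otimes> n) v - ga_delta u v) = 0"
      using L delta_diff_aug_ideal[OF u n] by blast
    then show "\<sigma> (u \<otimes> n) = \<sigma> u" using u nc by (simp add: lf_diff_delta)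
  qed
next
  assume ?R then show ?L using aug_ideal_translates by blast
qed

text \<open>By hypothesis each difference \<open>\<tau> (u \<otimes> m) - \<tau> u\<close> is
  constant in \<open>u\<close> on the cosets of the commutator subgroup. One factor from the ideal
  therefore turns \<open>\<tau>\<close> into a function constant on these cosets, and a second
  factor kills it.\<close>

lemma kills_2I:
  assumes "\<And>u n m. u \<in> carrier G \<Longrightarrow> n \<in> derived G (carrier G) \<Longrightarrow> m \<in> derived G (carrier G) \<Longrightarrow>
    \<tau> (u \<otimes> n \<otimes> m) - \<tau> (u \<otimes> n) = \<tau> (u \<otimes> m) - \<tau> u"
  shows "kills G 2 \<tau>"
proof -
  have D: "x \<in> carrier G" if "x \<in> derived G (carrier G)" for x using that derived_in_carrier[of "carrier G"] by auto
  have "coset_const G (derived G (carrier G)) (\<lambda>x. lf G (\<lambda>u. \<tau> (u \<otimes> x)) y)" if y: "in_aug_ideal G y" for y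
    unfolding coset_const_def
  proof (intro ballI)
    fix x m assume x: "x \<in> carrier G" and m: "m \<in> derived G (carrier G)"
    have "coset_const G (derived G (carrier G)) (\<lambda>v. \<tau> (v \<otimes> m) - \<tau> v)"
      unfolding coset_const_def using assms m D by simp
    then have "lf G (\<lambda>u. \<tau> (u \<otimes> x \<otimes> m) - \<tau> (u \<otimes> x)) y = 0" by (rule aug_ideal_translates[OF _ y x])
    then have "lf G (\<lambda>u. \<tau> (u \<otimes> x \<otimes> m)) y = lf G (\<lambda>u. \<tau> (u \<otimes> x)) y"
      by (simp add: lf_def right_diff_distrib sum_subtractf)
    moreover have "lf G (\<lambda>u. \<tau> (u \<otimes> x \<otimes> m)) y = lf G (\<lambda>u. \<tau> (u \<otimes> (x \<otimes> m))) y"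
      by (rule lf_cong) (use x D[OF m] in \<open>simp add: m_assoc\<close>)
    ultimately show "lf G (\<lambda>u. \<tau> (u \<otimes> (x \<otimes> m))) y = lf G (\<lambda>u. \<tau> (u \<otimes> x)) y" by simp
  qed
  then have "lf G (\<lambda>u. lf G (\<lambda>v. \<tau> (v \<otimes> (u \<otimes> x))) y) z = 0"
    if "in_aug_ideal G y" "in_aug_ideal G z" "x \<in> carrier G" for x y z
    using aug_ideal_translates[OF _ that(2,3)] that(1) by blast
  then have "kills G (Suc (Suc 0)) \<tau>" by simp
  then show ?thesis by (simp add: numeral_2_eq_2)
qed

end

section \<open>Differences along \<open>b\<close>, the transpose of right multiplication by
  \<open>b - 1\<close>\<close>

definition shift_diff :: "('a, 'b) monoid_scheme \<Rightarrow> 'a \<Rightarrow> ('a \<Rightarrow> 'k::ab_group_add) \<Rightarrow> 'a \<Rightarrow> 'k" where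
  "shift_diff G b \<tau> = (\<lambda>x. \<tau> (x \<otimes>\<^bsub>G\<^esub> b) - \<tau> x)"

lemma shift_diff_apply: "shift_diff G b \<tau> x = \<tau> (x \<otimes>\<^bsub>G\<^esub> b) - \<tau> x"
  by (simp add: shift_diff_def)

lemma shift_diff_cong:
  "\<sigma> x = \<rho> x \<Longrightarrow> \<sigma> (x \<otimes>\<^bsub>G\<^esub> b) = \<rho> (x \<otimes>\<^bsub>G\<^esub> b) \<Longrightarrow> shift_diff G b \<sigma> x = shift_diff G b \<rho> x"
  by (simp add: shift_diff_def)

lemma shift_diff_Suc:
  "(shift_diff G b ^^ Suc i) \<tau> x = (shift_diff G b ^^ i) \<tau> (x \<otimes>\<^bsub>G\<^esub> b) - (shift_diff G b ^^ i) \<tau> x"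
  by (simp add: shift_diff_apply)

lemma lf_diff: "lf G (\<lambda>u. \<sigma> u - \<tau> u) y = lf G \<sigma> y - lf G \<tau> y"
  by (simp add: lf_def right_diff_distrib sum_subtractf)

context finite_group
begin

text \<open>The expansion of the \<open>n\<close>-th power of \<open>b - 1\<close>; the sign
  exponent \<open>n + j\<close> replaces \<open>n - j\<close> to avoid subtraction.\<close>

lemma shift_diff_binomial:
  assumes b: "b \<in> carrier G" and x: "x \<in> carrier G"
  shows "(shift_diff G b ^^ n) \<tau> x
    = (\<Sum>j\<le>n. of_nat (n choose j) * (-1) ^ (n + j) * \<tau> (x \<otimes> b [^] j) :: 'k::field)"
  using x
proof (induction n arbitrary: x)
  case (Suc n)
  define c where "c = (\<lambda>n j. of_nat (n choose j) * (-1) ^ (n + j) :: 'k)"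
  define t where "t = (\<lambda>j::nat. \<tau> (x \<otimes> b [^] j))"
  have c: "c (Suc n) (Suc j) = c n j - c n (Suc j)" "c (Suc n) 0 = - c n 0" "c n (Suc n) = 0" for j
    by (auto simp: c_def algebra_simps binomial_eq_0)
  have "(shift_diff G b ^^ n) \<tau> (x \<otimes> b) = (\<Sum>j\<le>n. c n j * t (Suc j))"
    using Suc.IH[of "x \<otimes> b"] Suc.prems b unfolding c_def t_def
    by (simp add: m_assoc nat_pow_Suc2[symmetric] del: nat_pow_Suc)
  moreover have "(shift_diff G b ^^ n) \<tau> x = c n 0 * t 0 + (\<Sum>j\<le>n. c n (Suc j) * t (Suc j))"
  proof -
    have "(\<Sum>j\<le>Suc n. c n j * t j) = c n 0 * t 0 + (\<Sum>j\<le>n. c n (Suc j) * t (Suc j))"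
      by (rule sum.atMost_Suc_shift)
    then show ?thesis using Suc.IH[OF Suc.prems] c(3) unfolding c_def t_def by simp
  qed
  moreover have "(\<Sum>j\<le>Suc n. c (Suc n) j * t j) = - c n 0 * t 0 + (\<Sum>j\<le>n. c n j * t (Suc j)) - (\<Sum>j\<le>n. c n (Suc j) * t (Suc j))"
    unfolding sum.atMost_Suc_shift c(1,2) by (simp add: left_diff_distrib sum_subtractf)
  ultimately have "(shift_diff G b ^^ Suc n) \<tau> x = (\<Sum>j\<le>Suc n. c (Suc n) j * t j)"
    unfolding shift_diff_Suc by (simp del: sum.atMost_Suc)
  then show ?case unfolding c_def t_def .
qed simp

text \<open>In characteristic \<open>p\<close> the inner binomial coefficients vanish, and the
  constant term has sign -1 because \<open>p\<close> is odd.\<close>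

lemma shift_diff_prime:
  assumes "b \<in> carrier G" "x \<in> carrier G" "Factorial_Ring.prime p" "odd p" "CHAR('k::field) = p"
  shows "(shift_diff G b ^^ p) \<tau> x = (shift_diff G (b [^] p) \<tau> x :: 'k)"
proof -
  have p1: "p > 1" using assms(3) prime_gt_1_nat by blast
  have z: "of_nat (p choose j) = (0 :: 'k)" if "0 < j" "j < p" for j
    using dvd_choose_prime[of j p] that assms by (simp add: of_nat_eq_0_iff_char_dvd)
  have "{..p} = insert 0 (insert p {0<..<p})" using p1 by auto
  then show ?thesis
    using assms z p1 by (simp add: shift_diff_binomial shift_diff_apply)
qed

lemma shift_diff_prime_power:
  assumes "b \<in> carrier G" "x \<in> carrier G" "Factorial_Ring.prime p" "odd p" "CHAR('k::field) = p"
  shows "(shift_diff G b ^^ (p ^ m)) \<tau> x = (shift_diff G (b [^] (p ^ m)) \<tau> x :: 'k)"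
  using assms(2)
proof (induction m arbitrary: x \<tau>)
  case 0 then show ?case using assms(1) by simp
next
  case (Suc m)
  let ?b = "b [^] (p ^ m)"
  have it: "((shift_diff G b ^^ (p ^ m)) ^^ j) \<tau> x = (shift_diff G ?b ^^ j) \<tau> x" if "x \<in> carrier G" for j x
    using that
  proof (induction j arbitrary: x)
    case (Suc j)
    have "((shift_diff G b ^^ (p ^ m)) ^^ Suc j) \<tau> x = shift_diff G ?b (((shift_diff G b ^^ (p ^ m)) ^^ j) \<tau>) x"
      using \<open>\<And>x \<tau>. x \<in> carrier G \<Longrightarrow> (shift_diff G b ^^ (p ^ m)) \<tau> x = shift_diff G ?b \<tau> x\<close>[OF Suc.prems] by simp
    also have "\<dots> = shift_diff G ?b ((shift_diff G ?b ^^ j) \<tau>) x"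
      by (rule shift_diff_cong) (use Suc.prems assms(1) in \<open>auto intro: Suc.IH\<close>)
    finally show ?case by simp
  qed simp
  have "(shift_diff G b ^^ (p ^ Suc m)) \<tau> x = ((shift_diff G b ^^ (p ^ m)) ^^ p) \<tau> x"
    by (simp only: funpow_mult power_Suc2)
  also have "\<dots> = shift_diff G (?b [^] p) \<tau> x"
    using it[OF Suc.prems] shift_diff_prime[OF _ Suc.prems assms(3-5)] assms(1) by simp
  finally show ?case using assms(1) by (simp add: nat_pow_pow mult.commute)
qed

lemma shift_diff_lf:
  assumes b: "b \<in> carrier G" and x: "x \<in> carrier G"
  shows "(shift_diff G b ^^ i) (\<lambda>x. lf G (\<lambda>u. \<tau> (u \<otimes> x)) y) x = lf G (\<lambda>u. (shift_diff G b ^^ i) \<tau> (u \<otimes> x)) y"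
  using x
proof (induction i arbitrary: x)
  case (Suc i)
  have "lf G (\<lambda>u. (shift_diff G b ^^ i) \<tau> (u \<otimes> (x \<otimes> b))) y = lf G (\<lambda>u. (shift_diff G b ^^ i) \<tau> (u \<otimes> x \<otimes> b)) y"
    by (rule lf_cong) (use Suc.prems b in \<open>simp add: m_assoc\<close>)
  then show ?case unfolding shift_diff_Suc lf_diff Suc.IH[OF Suc.prems] Suc.IH[OF m_closed[OF Suc.prems b]] by simp
qed simp

text \<open>When \<open>a\<close> generates the commutator subgroup, the ideal is generated by
  \<open>a - 1\<close>, so its \<open>i\<close>-th power is tested by the \<open>i\<close>-th
  difference along \<open>a\<close>.\<close>

lemma kills_iff_shift_diff:
  assumes a: "a \<in> carrier G" and D: "derived G (carrier G) = {a [^] i | i :: nat. True}"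
  shows "kills G i \<tau> \<longleftrightarrow> (\<forall>x\<in>carrier G. (shift_diff G a ^^ i) \<tau> x = 0)"
proof (induction i arbitrary: \<tau>)
  case (Suc i)
  let ?\<sigma> = "(shift_diff G a ^^ i) \<tau>"
  have "kills G (Suc i) \<tau> \<longleftrightarrow> (\<forall>y. in_aug_ideal G y \<longrightarrow> (\<forall>x\<in>carrier G. lf G (\<lambda>u. ?\<sigma> (u \<otimes> x)) y = 0))"
    by (simp add: Suc.IH shift_diff_lf[OF a] cong: ball_cong)
  also have "\<dots> \<longleftrightarrow> coset_const G (derived G (carrier G)) ?\<sigma>" by (rule aug_ideal_annihilator)
  also have "\<dots> \<longleftrightarrow> (\<forall>x\<in>carrier G. ?\<sigma> (x \<otimes> a) = ?\<sigma> x)"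
  proof
    assume c: "coset_const G (derived G (carrier G)) ?\<sigma>"
    have "a [^] (1::nat) \<in> derived G (carrier G)" unfolding D by blast
    then show "\<forall>x\<in>carrier G. ?\<sigma> (x \<otimes> a) = ?\<sigma> x" using coset_constD[OF c] a by simp
  next
    assume s: "\<forall>x\<in>carrier G. ?\<sigma> (x \<otimes> a) = ?\<sigma> x"
    have "?\<sigma> (x \<otimes> a [^] j) = ?\<sigma> x" if x: "x \<in> carrier G" for x and j :: nat
    proof (induction j)
      case (Suc j)
      have "?\<sigma> (x \<otimes> a [^] Suc j) = ?\<sigma> ((x \<otimes> a [^] j) \<otimes> a)" using x a by (simp add: m_assoc)
      then show ?case using s x a Suc by simp
    qed (use x in simp)
    then show "coset_const G (derived G (carrier G)) ?\<sigma>" unfolding coset_const_def D by auto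
  qed
  also have "\<dots> \<longleftrightarrow> (\<forall>x\<in>carrier G. (shift_diff G a ^^ Suc i) \<tau> x = 0)"
    by (simp add: shift_diff_apply)
  finally show ?case .
qed simp

end

text \<open>The \<open>p ^ m\<close>-th power of \<open>a - 1\<close> is
  \<open>a [^] (p ^ m) - 1\<close>, and \<open>a [^] (p ^ m)\<close> generates
  \<open>Dpow m\<close>.\<close>

lemma (in cyclic_derived) kills_prime_power_iff:
  fixes \<tau> :: "'a \<Rightarrow> 'k::field"
  assumes char: "CHAR('k) = p"
  shows "kills G (p ^ m) \<tau> \<longleftrightarrow> coset_const G (Dpow m) \<tau>"
proof -
  interpret finite_group G by unfold_locales (rule fin)
  let ?b = "a [^] (p ^ m)"
  have "kills G (p ^ m) \<tau> \<longleftrightarrow> (\<forall>x\<in>carrier G. \<tau> (x \<otimes> ?b) = \<tau> x)"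
    unfolding kills_iff_shift_diff[OF a derived_eq]
    using shift_diff_prime_power[OF a _ p podd char] by (simp add: shift_diff_apply)
  also have "\<dots> \<longleftrightarrow> coset_const G (Dpow m) \<tau>"
  proof
    assume s: "\<forall>x\<in>carrier G. \<tau> (x \<otimes> ?b) = \<tau> x"
    have "\<tau> (x \<otimes> ?b [^] j) = \<tau> x" if x: "x \<in> carrier G" for x and j :: nat
    proof (induction j)
      case (Suc j)
      have "\<tau> (x \<otimes> ?b [^] Suc j) = \<tau> ((x \<otimes> ?b [^] j) \<otimes> ?b)" using x by (simp add: m_assoc)
      then show ?case using s x Suc by simp
    qed (use x in simp)
    then show "coset_const G (Dpow m) \<tau>" unfolding coset_const_def Dpow_eq by (auto simp: nat_pow_pow)
  next
    assume c: "coset_const G (Dpow m) \<tau>"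
    have "a [^] (p ^ m * 1) \<in> Dpow m" unfolding Dpow_eq by blast
    then show "\<forall>x\<in>carrier G. \<tau> (x \<otimes> ?b) = \<tau> x" using coset_constD[OF c] by simp
  qed
  finally show ?thesis .
qed

section \<open>Cyclicity of the commutator subgroup\<close>

lemma (in group) powers_subgroup:
  assumes "finite (carrier G)" "b \<in> carrier G"
  shows "subgroup {b [^] i | i :: nat. True} G"
proof (rule finite_subgroupI[OF assms(1)])
  show "\<one> \<in> {b [^] i | i :: nat. True}" by (auto intro: nat_pow_0[symmetric])
qed (use assms(2) in \<open>auto simp: nat_pow_mult\<close>)

text \<open>Both the shift by one on the coset of \<open>x1\<close> and the action of \<open>G\<close> by \<open>(h s) x = s (x h) - s h\<close>
  have a number of fixed points congruent to the number of all functions considered; the shift has none,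
  and the fixed points of the action are the homomorphisms.\<close>
lemma (in group) ex_additive_hom:
  assumes p: "Factorial_Ring.prime p" and char: "CHAR('k::field) = p" and o: "order G = p ^ N"
    and h0: "h0 \<in> carrier G" and x1: "x1 \<in> carrier G" "\<And>i::nat. x1 \<noteq> h0 [^] i"
  shows "\<exists>\<chi> :: 'a \<Rightarrow> 'k. (\<forall>x\<in>carrier G. \<forall>y\<in>carrier G. \<chi> (x \<otimes> y) = \<chi> x + \<chi> y) \<and>
    \<chi> h0 = 0 \<and> (\<exists>x\<in>carrier G. \<chi> x \<noteq> 0)"
proof -
  have p0: "p > 0" using p prime_gt_0_nat by blast
  have fin: "finite (carrier G)" using o p0 order_gt_0_iff_finite by (metis zero_less_power)
  \<comment> \<open>The prime field: the functions counted below must form a finite set even if the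
    field is infinite.\<close>
  define F where "F = range (of_nat :: nat \<Rightarrow> 'k)"
  have p_zero: "of_nat p = (0 :: 'k)" using char by (metis of_nat_CHAR)
  have "F \<subseteq> of_nat ` {..<p}"
  proof
    fix z assume "z \<in> F"
    then obtain n where "z = of_nat n" by (auto simp: F_def)
    moreover have "(of_nat n :: 'k) = of_nat (p * (n div p)) + of_nat (n mod p)"
      unfolding of_nat_add[symmetric] by simp
    ultimately have "z = of_nat (n mod p)" by (simp add: p_zero)
    then show "z \<in> of_nat ` {..<p}" using p0 by auto
  qed
  then have finF: "finite F" by (rule finite_subset) simp
  have F0: "0 \<in> F" unfolding F_def by (metis of_nat_0 rangeI)
  have F_add1: "z + 1 \<in> F" if "z \<in> F" for z using that unfolding F_def by (metis (no_types) imageE of_nat_Suc add.commute rangeI)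
  have F_diff: "z - w \<in> F" if zw: "z \<in> F" "w \<in> F" for z w
  proof -
    obtain m n where mn: "z = of_nat m" "w = of_nat n" using zw by (auto simp: F_def)
    have "(of_nat (m + (p - 1) * n) :: 'k) + of_nat n = of_nat (m + ((p - 1) * n + n))" by simp
    also have "(p - 1) * n + n = p * n" using p0 by (cases p) auto
    also have "of_nat (m + p * n) = (of_nat m :: 'k)" by (simp add: p_zero)
    finally have "z - w = of_nat (m + (p - 1) * n)" unfolding mn by (metis add_diff_cancel_right')
    then show ?thesis unfolding F_def by (rule range_eqI)
  qed
  define E where "E = {s. (\<forall>x. (x \<in> carrier G \<longrightarrow> s x \<in> F) \<and> (x \<notin> carrier G \<longrightarrow> s x = 0)) \<and>
    (\<forall>x\<in>carrier G. s (h0 \<otimes> x) = s x) \<and> s \<one> = 0}"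
  have finE: "finite E"
    by (rule finite_subset[OF _ finite_set_of_finite_funs[OF fin finF, of 0]]) (auto simp: E_def)
  define S where "S = {h0 [^] i | i :: nat. True}"
  have sS: "subgroup S G" unfolding S_def by (rule powers_subgroup[OF fin h0])
  have "h0 [^] (1::nat) \<in> S" unfolding S_def by blast
  then have h0S: "h0 \<in> S" using h0 by simp
  have x1S: "x1 \<notin> S" using x1(2) by (auto simp: S_def)
  \<comment> \<open>The coset of \<open>x1\<close>. It is stable under \<open>h0\<close> and avoids
    \<open>\<one>\<close>, so adding 1 on it preserves all conditions in \<open>E\<close>.\<close>
  define K where "K = {x \<in> carrier G. x \<otimes> inv x1 \<in> S}"
  have Kh: "h0 \<otimes> x \<in> K \<longleftrightarrow> x \<in> K" if x: "x \<in> carrier G" for x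
  proof
    assume "h0 \<otimes> x \<in> K"
    then have "inv h0 \<otimes> (h0 \<otimes> x \<otimes> inv x1) \<in> S"
      using sS h0S by (simp add: K_def subgroup.m_closed subgroup.m_inv_closed)
    moreover have "inv h0 \<otimes> (h0 \<otimes> x \<otimes> inv x1) = x \<otimes> inv x1" using h0 x x1 by (simp add: m_assoc[symmetric])
    ultimately show "x \<in> K" using x by (simp add: K_def)
  next
    assume "x \<in> K"
    then have "h0 \<otimes> (x \<otimes> inv x1) \<in> S" using sS h0S by (simp add: K_def subgroup.m_closed)
    then show "h0 \<otimes> x \<in> K" using h0 x x1 by (simp add: K_def m_assoc)
  qed
  have K1: "\<one> \<notin> K"
  proof
    assume "\<one> \<in> K"
    then have "inv x1 \<in> S" using x1 by (simp add: K_def)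
    then have "inv (inv x1) \<in> S" by (rule subgroup.m_inv_closed[OF sS])
    then show False using x1S x1 by simp
  qed
  have Kx1: "x1 \<in> K" using subgroup.one_closed[OF sS] x1 by (simp add: K_def)
  define f where "f = (\<lambda>s x. if x \<in> K then s x + 1 else s x :: 'k)"
  have "(\<Sum>s\<in>E. 1 :: 'k) = (\<Sum>s | s \<in> E \<and> f s = s. 1)"
  proof (rule sum_fixed_points_permutation[OF p char finE, where N = 1])
    fix s assume s: "s \<in> E"
    show "f s \<in> E"
      using s K1 Kh F_add1 h0 by (auto simp: E_def f_def) (auto simp: K_def)
    have "(f ^^ j) s x = (if x \<in> K then s x + of_nat j else s x)" for j x
      by (induction j) (auto simp: f_def)
    then show "(f ^^ p ^ 1) s = s" using p_zero by auto
  qed simp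
  also have "{s. s \<in> E \<and> f s = s} = {}"
  proof -
    have "f s \<noteq> s" for s
    proof
      assume "f s = s"
      then have "f s x1 = s x1" by simp
      then show False using Kx1 by (simp add: f_def)
    qed
    then show ?thesis by simp
  qed
  finally have zero: "(\<Sum>s\<in>E. 1 :: 'k) = 0" by simp
  define act where "act = (\<lambda>h s x. if x \<in> carrier G then s (x \<otimes> h) - s h else 0 :: 'k)"
  have "(\<Sum>s\<in>E. 1 :: 'k) = (\<Sum>s | s \<in> E \<and> (\<forall>h\<in>carrier G. act h s = s). 1)"
  proof (rule sum_fixed_points_p_group[OF group_axioms o p char finE])
    fix h s assume hs: "h \<in> carrier G" "s \<in> E"
    show "act h s \<in> E" using hs h0 F_diff by (auto simp: E_def act_def m_assoc)
  next
    fix s assume "s \<in> E" then show "act \<one> s = s" by (auto simp: E_def act_def)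
  next
    fix g h s assume "g \<in> carrier G" "h \<in> carrier G" "s \<in> E"
    then show "act (g \<otimes> h) s = act g (act h s)" by (auto simp: act_def m_assoc)
  qed simp
  moreover have "finite {s. s \<in> E \<and> (\<forall>h\<in>carrier G. act h s = s)}" using finE by simp
  ultimately have "of_nat (card {s. s \<in> E \<and> (\<forall>h\<in>carrier G. act h s = s)}) = (0 :: 'k)"
    using zero by simp
  then have "p dvd card {s. s \<in> E \<and> (\<forall>h\<in>carrier G. act h s = s)}" using char by (simp add: of_nat_eq_0_iff_char_dvd)
  \<comment> \<open>The zero function is a fixed point, and the number of fixed points is divisible
    by \<open>p\<close>, so there is another one.\<close>
  then have c1: "card {s. s \<in> E \<and> (\<forall>h\<in>carrier G. act h s = s)} \<noteq> 1" using p not_prime_unit by fastforce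
  have zE: "(\<lambda>_. 0) \<in> {s. s \<in> E \<and> (\<forall>h\<in>carrier G. act h s = s)}" using F0 by (auto simp: E_def act_def)
  have "{s. s \<in> E \<and> (\<forall>h\<in>carrier G. act h s = s)} \<noteq> {\<lambda>_. 0}" using c1 by (metis card_1_singleton_iff One_nat_def)
  then obtain s where s: "s \<in> E" "\<And>h. h \<in> carrier G \<Longrightarrow> act h s = s" "s \<noteq> (\<lambda>_. 0)" using zE by blast
  have "s (x \<otimes> h) = s x + s h" if "x \<in> carrier G" "h \<in> carrier G" for x h
  proof -
    have "act h s x = s x" using s(2)[OF that(2)] by simp
    then show ?thesis using that by (simp add: act_def algebra_simps)
  qed
  moreover have "s h0 = 0"
  proof -
    have "s (h0 \<otimes> \<one>) = s \<one>" using s(1) unfolding E_def by blast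
    then show ?thesis using s(1) h0 by (simp add: E_def)
  qed
  moreover have "\<exists>x\<in>carrier G. s x \<noteq> 0" using s(1,3) unfolding E_def by blast
  ultimately show ?thesis by blast
qed

text \<open>Apply \<open>ex_additive_hom\<close> first with \<open>\<one>\<close> and then with the
  element \<open>x1\<close> found there. The vanishing of \<open>\<chi>2\<close> at
  \<open>x1\<close> gives a triangular system, which makes 1, \<open>\<chi>1\<close> and
  \<open>\<chi>2\<close> independent.\<close>

lemma (in group) ex_independent_homs:
  assumes p: "Factorial_Ring.prime p" and char: "CHAR('k::field) = p" and o: "order G = p ^ N"
    and nc: "\<And>b. b \<in> carrier G \<Longrightarrow> \<exists>x\<in>carrier G. \<forall>i::nat. x \<noteq> b [^] i"
  shows "\<exists>(\<chi>1 :: 'a \<Rightarrow> 'k) (\<chi>2 :: 'a \<Rightarrow> 'k) x1 x2.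
    (\<forall>x\<in>carrier G. \<forall>y\<in>carrier G. \<chi>1 (x \<otimes> y) = \<chi>1 x + \<chi>1 y) \<and>
    (\<forall>x\<in>carrier G. \<forall>y\<in>carrier G. \<chi>2 (x \<otimes> y) = \<chi>2 x + \<chi>2 y) \<and>
    x1 \<in> carrier G \<and> x2 \<in> carrier G \<and> \<chi>1 x1 \<noteq> 0 \<and> \<chi>2 x1 = 0 \<and> \<chi>2 x2 \<noteq> 0"
proof -
  obtain y1 where y1: "y1 \<in> carrier G" "\<And>i::nat. y1 \<noteq> \<one> [^] i" using nc[OF one_closed] by blast
  obtain \<chi>1 :: "'a \<Rightarrow> 'k" and x1 where 1: "\<forall>x\<in>carrier G. \<forall>y\<in>carrier G. \<chi>1 (x \<otimes> y) = \<chi>1 x + \<chi>1 y"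
      "x1 \<in> carrier G" "\<chi>1 x1 \<noteq> 0"
    using ex_additive_hom[OF p char o one_closed y1] by blast
  obtain y2 where y2: "y2 \<in> carrier G" "\<And>i::nat. y2 \<noteq> x1 [^] i" using nc[OF 1(2)] by blast
  obtain \<chi>2 :: "'a \<Rightarrow> 'k" and x2 where 2: "\<forall>x\<in>carrier G. \<forall>y\<in>carrier G. \<chi>2 (x \<otimes> y) = \<chi>2 x + \<chi>2 y"
      "\<chi>2 x1 = 0" "x2 \<in> carrier G" "\<chi>2 x2 \<noteq> 0"
    using ex_additive_hom[OF p char o 1(2) y2] by blast
  show ?thesis using 1 2 by blast
qed

context ga_iso_pair
begin

lemma pulls_back_derived: "pulls_back (derived G (carrier G)) (derived H (carrier H))"
  unfolding pulls_back_def using pull_derived by blast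

text \<open>If the commutator subgroup of \<open>H\<close> is not cyclic, then 1,
  \<open>\<chi>1\<close> and \<open>\<chi>2\<close> give three independent functionals on each of
  its cosets that vanish on the square of the ideal. Their pullbacks obey a second-order recurrence
  along each coset of the powers of \<open>a\<close>, so two values per coset determine them. As
  \<open>G\<close> has at most as many cosets as \<open>H\<close>, this is a contradiction.\<close>

lemma derived_cyclic:
  assumes a: "a \<in> carrier G" and D: "derived G (carrier G) = {a [^] i | i :: nat. True}"
  shows "\<exists>b\<in>carrier H. derived H (carrier H) = {b [^]\<^bsub>H\<^esub> i | i :: nat. True}"
proof (rule ccontr)
  assume neg: "\<not> ?thesis"
  let ?D = "derived G (carrier G)" and ?E = "derived H (carrier H)"
  interpret S: ga_iso_pair H G \<psi> p by (rule iso_sym)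
  have nG: "?D \<lhd> G" by (rule G.derived_self_is_normal)
  have nH: "?E \<lhd> H" by (rule H.derived_self_is_normal)
  interpret E: normal ?E H by (rule nH)
  let ?Q = "H\<lparr>carrier := ?E\<rparr>"
  interpret Q: group ?Q by (rule H.subgroup_imp_group[OF E.subgroup_axioms])
  obtain N where N: "order ?Q = p ^ N"
  proof -
    obtain M where "order H = p ^ M" using pH by blast
    then have "card ?E dvd p ^ M" using H.lagrange[OF E.subgroup_axioms] by (metis dvd_triv_right)
    then show ?thesis using that p by (auto simp: order_def divides_primepow_nat)
  qed
  have nc: "\<exists>x\<in>carrier ?Q. \<forall>i::nat. x \<noteq> b [^]\<^bsub>?Q\<^esub> i" if b: "b \<in> carrier ?Q" for b
  proof (rule ccontr)
    assume "\<not> ?thesis"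
    then have "?E \<subseteq> {b [^]\<^bsub>H\<^esub> i | i :: nat. True}" by (auto simp: H.nat_pow_consistent[symmetric])
    moreover have "{b [^]\<^bsub>H\<^esub> i | i :: nat. True} \<subseteq> ?E"
      using H.subgroup_pow_closed[OF E.subgroup_axioms] b by auto
    ultimately have "?E = {b [^]\<^bsub>H\<^esub> i | i :: nat. True}" by blast
    moreover have "b \<in> carrier H" using E.mem_carrier b by simp
    ultimately show False using neg by blast
  qed
  obtain \<chi>1 \<chi>2 :: "'c \<Rightarrow> 'k" and x1 x2 where
    h: "\<forall>x\<in>?E. \<forall>y\<in>?E. \<chi>1 (x \<otimes>\<^bsub>H\<^esub> y) = \<chi>1 x + \<chi>1 y"
       "\<forall>x\<in>?E. \<forall>y\<in>?E. \<chi>2 (x \<otimes>\<^bsub>H\<^esub> y) = \<chi>2 x + \<chi>2 y" and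
    x12: "x1 \<in> ?E" "x2 \<in> ?E" "\<chi>1 x1 \<noteq> 0" "\<chi>2 x1 = 0" "\<chi>2 x2 \<noteq> 0"
  proof -
    have "\<exists>(\<chi>1 :: 'c \<Rightarrow> 'k) (\<chi>2 :: 'c \<Rightarrow> 'k) x1 x2.
      (\<forall>x\<in>?E. \<forall>y\<in>?E. \<chi>1 (x \<otimes>\<^bsub>H\<^esub> y) = \<chi>1 x + \<chi>1 y) \<and>
      (\<forall>x\<in>?E. \<forall>y\<in>?E. \<chi>2 (x \<otimes>\<^bsub>H\<^esub> y) = \<chi>2 x + \<chi>2 y) \<and>
      x1 \<in> ?E \<and> x2 \<in> ?E \<and> \<chi>1 x1 \<noteq> 0 \<and> \<chi>2 x1 = 0 \<and> \<chi>2 x2 \<noteq> 0"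
      using Q.ex_independent_homs[OF p char N nc] by simp
    then show ?thesis using that by (elim exE conjE) (rule that)
  qed
  have hom1: "\<chi>1 (x \<otimes>\<^bsub>H\<^esub> y) = \<chi>1 x + \<chi>1 y" and hom2: "\<chi>2 (x \<otimes>\<^bsub>H\<^esub> y) = \<chi>2 x + \<chi>2 y"
    if "x \<in> ?E" "y \<in> ?E" for x y
    using h that by blast+
  have one: "\<chi>1 \<one>\<^bsub>H\<^esub> = 0" "\<chi>2 \<one>\<^bsub>H\<^esub> = 0"
    using hom1[OF E.one_closed E.one_closed] hom2[OF E.one_closed E.one_closed]
    unfolding H.l_one[OF H.one_closed] by (simp_all only: add_cancel_right_right)
  obtain r where r: "\<And>x. x \<in> carrier G \<Longrightarrow> r (?D #> x) \<in> carrier G"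
    "\<And>x. x \<in> carrier G \<Longrightarrow> \<exists>n\<in>?D. x = r (?D #> x) \<otimes> n" using G.coset_representatives[OF nG] by blast
  obtain q where q: "\<And>x. x \<in> carrier H \<Longrightarrow> q (?E #>\<^bsub>H\<^esub> x) \<in> carrier H"
    "\<And>x. x \<in> carrier H \<Longrightarrow> \<exists>n\<in>?E. x = q (?E #>\<^bsub>H\<^esub> x) \<otimes>\<^bsub>H\<^esub> n" using H.coset_representatives[OF nH] by blast
  have finG: "finite (rcosets\<^bsub>G\<^esub> ?D)" and finH: "finite (rcosets\<^bsub>H\<^esub> ?E)" by (auto simp: RCOSETS_def)
  define \<chi> where "\<chi> = (\<lambda>i::nat. if i = 0 then (\<lambda>_. 1) else if i = 1 then \<chi>1 else \<chi>2)"
  \<comment> \<open>Two consecutive points on each coset carry the initial values of the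
    recurrence.\<close>
  define P where "P = r ` (rcosets\<^bsub>G\<^esub> ?D) \<union> (\<lambda>B. r B \<otimes> a) ` (rcosets\<^bsub>G\<^esub> ?D)"
  let ?J = "(rcosets\<^bsub>H\<^esub> ?E) \<times> {..<3::nat}"
  \<comment> \<open>An index is a coset together with one of three functions, which is read off
    relative to the representative of the coset.\<close>
  let ?\<tau> = "\<lambda>j y. if ?E #>\<^bsub>H\<^esub> y = fst j then \<chi> (snd j) (inv\<^bsub>H\<^esub> (q (fst j)) \<otimes>\<^bsub>H\<^esub> y) else 0"
  have "card ?J \<le> card P"
  proof (rule pull_dimension_bound[where \<tau> = ?\<tau>])
    fix c assume c: "\<And>x. x \<in> P \<Longrightarrow> pull H \<phi> (\<lambda>y. \<Sum>j\<in>?J. c j * ?\<tau> j y) x = 0"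
    define \<sigma> where "\<sigma> = (\<lambda>y. \<Sum>j\<in>?J. c j * ?\<tau> j y)"
    define g where "g = (\<lambda>B n. c (B, 0) + c (B, 1) * \<chi>1 n + c (B, 2) * \<chi>2 n)"
    have \<sigma>: "\<sigma> y = g (?E #>\<^bsub>H\<^esub> y) (inv\<^bsub>H\<^esub> (q (?E #>\<^bsub>H\<^esub> y)) \<otimes>\<^bsub>H\<^esub> y)" if "y \<in> carrier H" for y
    proof -
      let ?B = "?E #>\<^bsub>H\<^esub> y"
      have "\<sigma> y = (\<Sum>B\<in>rcosets\<^bsub>H\<^esub> ?E. \<Sum>i<3. c (B, i) * ?\<tau> (B, i) y)"
        unfolding \<sigma>_def sum.cartesian_product by (intro sum.cong refl) (simp add: case_prod_beta)
      also have "\<dots> = (\<Sum>B\<in>rcosets\<^bsub>H\<^esub> ?E. if ?B = B then \<Sum>i<3. c (B, i) * \<chi> i (inv\<^bsub>H\<^esub> (q B) \<otimes>\<^bsub>H\<^esub> y) else 0)"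
        by (rule sum.cong) auto
      also have "\<dots> = (\<Sum>i<3. c (?B, i) * \<chi> i (inv\<^bsub>H\<^esub> (q ?B) \<otimes>\<^bsub>H\<^esub> y))"
        using finH that by (auto simp: RCOSETS_def)
      also have "\<dots> = g ?B (inv\<^bsub>H\<^esub> (q ?B) \<otimes>\<^bsub>H\<^esub> y)"
        by (simp add: g_def \<chi>_def numeral_3_eq_3 numeral_2_eq_2)
      finally show ?thesis .
    qed
    have \<sigma>': "\<sigma> (y \<otimes>\<^bsub>H\<^esub> n) = g (?E #>\<^bsub>H\<^esub> y) (inv\<^bsub>H\<^esub> (q (?E #>\<^bsub>H\<^esub> y)) \<otimes>\<^bsub>H\<^esub> y \<otimes>\<^bsub>H\<^esub> n)"
      if "y \<in> carrier H" "n \<in> ?E" for y n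
      using \<sigma>[of "y \<otimes>\<^bsub>H\<^esub> n"] H.normal_coset_absorb[OF nH that(2,1)] that q(1)[OF that(1)] E.mem_carrier[OF that(2)]
      by (simp add: H.m_assoc)
    have mem: "inv\<^bsub>H\<^esub> (q (?E #>\<^bsub>H\<^esub> y)) \<otimes>\<^bsub>H\<^esub> y \<in> ?E" if y: "y \<in> carrier H" for y
    proof -
      obtain n where "n \<in> ?E" "y = q (?E #>\<^bsub>H\<^esub> y) \<otimes>\<^bsub>H\<^esub> n" using q(2)[OF y] by blast
      then have "inv\<^bsub>H\<^esub> (q (?E #>\<^bsub>H\<^esub> y)) \<otimes>\<^bsub>H\<^esub> y = n"
        using q(1)[OF y] E.mem_carrier y by (metis H.inv_solve_left)
      then show ?thesis using \<open>n \<in> ?E\<close> by simp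
    qed
    have "kills H 2 \<sigma>"
    proof (rule H.kills_2I)
      fix u n m assume u: "u \<in> carrier H" and n: "n \<in> ?E" and m: "m \<in> ?E"
      define B where "B = ?E #>\<^bsub>H\<^esub> u"
      define v where "v = inv\<^bsub>H\<^esub> (q B) \<otimes>\<^bsub>H\<^esub> u"
      have v: "v \<in> ?E" using mem[OF u] by (simp add: v_def B_def)
      have nm: "n \<otimes>\<^bsub>H\<^esub> m \<in> ?E" using n m by simp
      have "\<sigma> (u \<otimes>\<^bsub>H\<^esub> n \<otimes>\<^bsub>H\<^esub> m) = g B (v \<otimes>\<^bsub>H\<^esub> (n \<otimes>\<^bsub>H\<^esub> m))"
        using \<sigma>'[OF u nm] u E.mem_carrier[OF n] E.mem_carrier[OF m] by (simp add: v_def B_def H.m_assoc)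
      moreover have "\<sigma> (u \<otimes>\<^bsub>H\<^esub> n) = g B (v \<otimes>\<^bsub>H\<^esub> n)" "\<sigma> (u \<otimes>\<^bsub>H\<^esub> m) = g B (v \<otimes>\<^bsub>H\<^esub> m)" "\<sigma> u = g B v"
        using \<sigma>'[OF u n] \<sigma>'[OF u m] \<sigma>[OF u] by (simp_all add: v_def B_def)
      ultimately show "\<sigma> (u \<otimes>\<^bsub>H\<^esub> n \<otimes>\<^bsub>H\<^esub> m) - \<sigma> (u \<otimes>\<^bsub>H\<^esub> n) = \<sigma> (u \<otimes>\<^bsub>H\<^esub> m) - \<sigma> u"
        using v n m nm by (simp add: g_def hom1 hom2 algebra_simps)
    qed
    then have k2: "kills G 2 (pull H \<phi> \<sigma>)" by (rule pull_kills)
    define \<rho> where "\<rho> = pull H \<phi> \<sigma>"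
    \<comment> \<open>The recurrence says that the square of \<open>a - 1\<close> annihilates
      \<open>\<rho>\<close>.\<close>
    have rec: "\<rho> (x \<otimes> a \<otimes> a) = 2 * \<rho> (x \<otimes> a) - \<rho> x" if x: "x \<in> carrier G" for x
    proof -
      have "(shift_diff G a ^^ Suc (Suc 0)) \<rho> x = 0"
        using k2[unfolded G.kills_iff_shift_diff[OF a D]] x by (simp add: \<rho>_def numeral_2_eq_2)
      then show ?thesis unfolding shift_diff_Suc by (simp add: algebra_simps)
    qed
    have "\<rho> x = 0" if x: "x \<in> carrier G" for x
    proof -
      define B where "B = ?D #> x"
      have B: "B \<in> rcosets\<^bsub>G\<^esub> ?D" "r B \<in> carrier G" using x r(1)[OF x] by (auto simp: B_def RCOSETS_def)
      obtain n where "n \<in> ?D" "x = r B \<otimes> n" using r(2)[OF x] by (auto simp: B_def)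
      then obtain i where i: "x = r B \<otimes> a [^] (i::nat)" using D by auto
      have z: "\<rho> (r B) = 0" "\<rho> (r B \<otimes> a) = 0" using c B unfolding \<rho>_def \<sigma>_def P_def by blast+
      have "\<rho> (r B \<otimes> a [^] j) = 0 \<and> \<rho> (r B \<otimes> a [^] Suc j) = 0" for j :: nat
      proof (induction j)
        case 0 then show ?case using z B a by simp
      next
        case (Suc j)
        have "\<rho> (r B \<otimes> a [^] Suc (Suc j)) = \<rho> ((r B \<otimes> a [^] j) \<otimes> a \<otimes> a)" using B a by (simp add: G.m_assoc)
        also have "\<dots> = 2 * \<rho> (r B \<otimes> a [^] j \<otimes> a) - \<rho> (r B \<otimes> a [^] j)" by (rule rec) (use B a in simp)
        also have "r B \<otimes> a [^] j \<otimes> a = r B \<otimes> a [^] Suc j" using B a by (simp add: G.m_assoc)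
        finally show ?case using Suc by simp
      qed
      then show ?thesis using i by simp
    qed
    then have \<sigma>0: "\<sigma> y = 0" if "y \<in> carrier H" for y using pull_zero that unfolding \<rho>_def by blast
    show "\<forall>j\<in>?J. c j = 0"
    proof
      fix j assume "j \<in> ?J"
      then obtain y i where j: "y \<in> carrier H" "j = (?E #>\<^bsub>H\<^esub> y, i)" "i < 3" by (auto simp: RCOSETS_def)
      define B where "B = ?E #>\<^bsub>H\<^esub> y"
      define v where "v = inv\<^bsub>H\<^esub> (q B) \<otimes>\<^bsub>H\<^esub> y"
      have v: "v \<in> ?E" using mem[OF j(1)] by (simp add: v_def B_def)
      have gz: "g B n = 0" if n: "n \<in> ?E" for n
      proof -
        have vn: "inv\<^bsub>H\<^esub> v \<otimes>\<^bsub>H\<^esub> n \<in> ?E" using v n by simp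
        have "g B (v \<otimes>\<^bsub>H\<^esub> (inv\<^bsub>H\<^esub> v \<otimes>\<^bsub>H\<^esub> n)) = 0"
          using \<sigma>'[OF j(1) vn] \<sigma>0[of "y \<otimes>\<^bsub>H\<^esub> (inv\<^bsub>H\<^esub> v \<otimes>\<^bsub>H\<^esub> n)"] j(1) E.mem_carrier[OF vn] by (simp add: v_def B_def)
        then show ?thesis using E.mem_carrier[OF v] E.mem_carrier[OF n] by (simp add: H.m_assoc[symmetric])
      qed
      have c0: "c (B, 0) = 0" using gz[of "\<one>\<^bsub>H\<^esub>"] one by (simp add: g_def)
      have c1: "c (B, 1) = 0" using gz[OF x12(1)] x12 c0 by (simp add: g_def)
      have c2: "c (B, 2) = 0" using gz[OF x12(2)] x12 c0 c1 by (simp add: g_def)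
      have "i = 0 \<or> i = 1 \<or> i = 2" using j(3) by auto
      then show "c j = 0" using c0 c1 c2 unfolding j(2) B_def by auto
    qed
  qed (use finG finH in \<open>auto simp: P_def\<close>)
  moreover have "card P \<le> card (rcosets\<^bsub>G\<^esub> ?D) + card (rcosets\<^bsub>G\<^esub> ?D)"
    unfolding P_def by (rule order_trans[OF card_Un_le add_mono[OF card_image_le[OF finG] card_image_le[OF finG]]])
  moreover have "card (rcosets\<^bsub>G\<^esub> ?D) \<le> card (rcosets\<^bsub>H\<^esub> ?E)"
    by (rule S.pulls_back_index[OF nH nG S.pulls_back_derived])
  moreover have "rcosets\<^bsub>H\<^esub> ?E \<noteq> {}" by (auto simp: RCOSETS_def)
  then have "card (rcosets\<^bsub>H\<^esub> ?E) > 0" using finH by (simp add: card_gt_0_iff)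
  ultimately show False by (simp add: card_cartesian_product)
qed

end

section \<open>Counting in products and quotients\<close>

context group
begin

text \<open>All fibres of the multiplication from the pairs onto the product set have the size of
  the intersection; the product set may fail to be a subgroup.\<close>

lemma card_set_mult:
  assumes "finite (carrier G)" and A: "subgroup A G" and B: "subgroup B G"
  shows "card (A <#> B) * card (A \<inter> B) = card A * card B"
proof -
  have cA: "x \<in> carrier G" if "x \<in> A" for x using subgroup.mem_carrier[OF A that] .
  have cB: "x \<in> carrier G" if "x \<in> B" for x using subgroup.mem_carrier[OF B that] .
  have fin: "finite A" "finite B" using assms(1) cA cB by (auto intro: finite_subset[of _ "carrier G"])
  define S where "S = (\<lambda>z. {(x, y) \<in> A \<times> B. x \<otimes> y = z})"
  have fib: "card (S z) = card (A \<inter> B)" if "z \<in> A <#> B" for z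
  proof -
    obtain x y where xy: "x \<in> A" "y \<in> B" "z = x \<otimes> y" using \<open>z \<in> A <#> B\<close> by (auto simp: set_mult_def)
    have "bij_betw (\<lambda>d. (x \<otimes> d, inv d \<otimes> y)) (A \<inter> B) (S z)"
    proof (rule bij_betwI[where g = "\<lambda>(u, v). inv x \<otimes> u"])
      show "(\<lambda>d. (x \<otimes> d, inv d \<otimes> y)) \<in> A \<inter> B \<rightarrow> S z"
      proof
        fix d assume d: "d \<in> A \<inter> B"
        have "x \<otimes> d \<otimes> (inv d \<otimes> y) = x \<otimes> (d \<otimes> inv d) \<otimes> y"
          using d xy cA cB by (simp only: m_assoc m_closed inv_closed Int_iff)
        then have "x \<otimes> d \<otimes> (inv d \<otimes> y) = z" using d xy cA cB by simp
        then show "(x \<otimes> d, inv d \<otimes> y) \<in> S z"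
          using d xy subgroup.m_closed[OF A] subgroup.m_closed[OF B] subgroup.m_inv_closed[OF B] by (simp add: S_def)
      qed
      show "(\<lambda>(u, v). inv x \<otimes> u) \<in> S z \<rightarrow> A \<inter> B"
      proof
        fix w assume "w \<in> S z"
        then obtain u v where uv: "w = (u, v)" "u \<in> A" "v \<in> B" "u \<otimes> v = x \<otimes> y" by (auto simp: S_def xy)
        have "inv x \<otimes> u = y \<otimes> inv v"
        proof -
          have "inv x \<otimes> u \<otimes> v = inv x \<otimes> (u \<otimes> v)" using uv xy cA cB by (simp add: m_assoc)
          also have "\<dots> = y" unfolding uv(4) using xy cA cB by (simp add: m_assoc[symmetric])
          finally show ?thesis using uv xy cA cB by (simp add: inv_solve_right)
        qed
        moreover have "inv x \<otimes> u \<in> A" by (rule subgroup.m_closed[OF A subgroup.m_inv_closed[OF A xy(1)] uv(2)])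
        moreover have "y \<otimes> inv v \<in> B" by (rule subgroup.m_closed[OF B xy(2) subgroup.m_inv_closed[OF B uv(3)]])
        ultimately show "(\<lambda>(u, v). inv x \<otimes> u) w \<in> A \<inter> B" using uv by simp
      qed
    next
      fix w assume "w \<in> S z"
      then obtain u v where uv: "w = (u, v)" "u \<in> A" "v \<in> B" "u \<otimes> v = x \<otimes> y" by (auto simp: S_def xy)
      have "inv (inv x \<otimes> u) \<otimes> y = inv u \<otimes> (u \<otimes> v)"
        unfolding uv(4) using uv xy cA cB by (simp add: inv_mult_group m_assoc)
      also have "\<dots> = v" using cA[OF uv(2)] cB[OF uv(3)] by (simp add: m_assoc[symmetric])
      finally have "inv (inv x \<otimes> u) \<otimes> y = v" .
      moreover have "x \<otimes> (inv x \<otimes> u) = u" using cA[OF uv(2)] cA[OF xy(1)] by (simp add: m_assoc[symmetric])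
      ultimately show "(x \<otimes> (case w of (u, v) \<Rightarrow> inv x \<otimes> u), inv (case w of (u, v) \<Rightarrow> inv x \<otimes> u) \<otimes> y) = w"
        using uv(1) by simp
    qed (use xy cA cB in \<open>auto simp: m_assoc[symmetric]\<close>)
    then show ?thesis by (simp add: bij_betw_same_card)
  qed
  have "A \<times> B = (\<Union>z\<in>A <#> B. S z)" by (auto simp: S_def set_mult_def)
  then have "card (A \<times> B) = card (\<Union>z\<in>A <#> B. S z)" by simp
  also have "\<dots> = (\<Sum>z\<in>A <#> B. card (S z))"
  proof (rule card_UN_disjoint)
    have "A <#> B = (\<lambda>(x, y). x \<otimes> y) ` (A \<times> B)" by (auto simp: set_mult_def)
    then show "finite (A <#> B)" using fin by simp
    have "finite (S z)" for z
      by (rule finite_subset[of _ "A \<times> B"]) (use fin in \<open>auto simp: S_def\<close>)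
    then show "\<forall>z\<in>A <#> B. finite (S z)" by blast
  qed (auto simp: S_def)
  also have "\<dots> = card (A <#> B) * card (A \<inter> B)" using fib by simp
  finally show ?thesis by (simp add: card_cartesian_product)
qed

lemma coset_commute_derived:
  assumes N: "N \<lhd> G" and D: "derived G (carrier G) \<subseteq> N" and x: "x \<in> carrier G" and y: "y \<in> carrier G"
  shows "N #> (x \<otimes> y) = N #> (y \<otimes> x)"
proof -
  have "inv x \<otimes> conj_by G (inv y) x \<in> N" using comm_derived[of "inv y" x] D x y by auto
  moreover have "(y \<otimes> x) \<otimes> (inv x \<otimes> conj_by G (inv y) x) = x \<otimes> y"
  proof -
    have c: "conj_by G (inv y) x = inv y \<otimes> x \<otimes> y" using x y by (simp add: conj_by_def)
    have "(y \<otimes> x) \<otimes> (inv x \<otimes> conj_by G (inv y) x) = y \<otimes> (x \<otimes> inv x) \<otimes> inv y \<otimes> x \<otimes> y"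
      unfolding c using x y by (simp only: m_assoc m_closed inv_closed)
    then show ?thesis using x y by simp
  qed
  ultimately show ?thesis
    using normal_coset_absorb[OF N, of "inv x \<otimes> conj_by G (inv y) x" "y \<otimes> x"] x y by simp
qed

lemma coset_pow_mult_derived:
  assumes N: "N \<lhd> G" and D: "derived G (carrier G) \<subseteq> N" and x: "x \<in> carrier G" and y: "y \<in> carrier G"
  shows "N #> ((x \<otimes> y) [^] (n::nat)) = N #> (x [^] n \<otimes> y [^] n)"
proof (induction n)
  case (Suc n)
  interpret N: normal N G by fact
  have "N #> ((x \<otimes> y) [^] Suc n) = (N #> (x [^] n \<otimes> y [^] n)) <#> (N #> (x \<otimes> y))"
    using x y by (simp add: N.rcos_sum Suc[symmetric])
  also have "\<dots> = (N #> x [^] n) <#> (N #> (y [^] n \<otimes> x)) <#> (N #> y)"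
    using x y by (simp add: N.rcos_sum m_assoc)
  also have "N #> (y [^] n \<otimes> x) = N #> (x \<otimes> y [^] n)" by (rule coset_commute_derived[OF N D]) (use x y in auto)
  also have "(N #> x [^] n) <#> (N #> (x \<otimes> y [^] n)) <#> (N #> y) = N #> (x [^] Suc n \<otimes> y [^] Suc n)"
    using x y by (simp add: N.rcos_sum m_assoc)
  finally show ?case .
qed simp

lemma comm_group_quotient:
  assumes N: "N \<lhd> G" and D: "derived G (carrier G) \<subseteq> N"
  shows "comm_group (G Mod N)"
proof -
  interpret N: normal N G by fact
  interpret Q: group "G Mod N" by (rule N.factorgroup_is_group)
  show ?thesis
    by (rule Q.group_comm_groupI)
      (use coset_commute_derived[OF N D] in \<open>auto simp: carrier_FactGroup N.rcos_sum\<close>)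
qed

lemma pow_preimage_normal:
  assumes fin: "finite (carrier G)" and N: "N \<lhd> G"
    and h: "\<And>x y. x \<in> carrier G \<Longrightarrow> y \<in> carrier G \<Longrightarrow> N #> ((x \<otimes> y) [^] n) = N #> (x [^] n \<otimes> y [^] (n::nat))"
  shows "{x \<in> carrier G. x [^] n \<in> N} \<lhd> G"
proof -
  interpret N: normal N G by fact
  have mem: "z \<in> N" if "N #> z = N #> w" "w \<in> N" "z \<in> carrier G" for z w
  proof -
    have "N #> w = N" by (rule coset_join2) (use that N.subgroup_axioms in auto)
    then show ?thesis using rcos_self[OF that(3) N.subgroup_axioms] that(1) by simp
  qed
  have "subgroup {x \<in> carrier G. x [^] n \<in> N} G"
    by (rule finite_subgroupI[OF fin]) (use mem[OF h] in auto)
  moreover have "(g \<otimes> x \<otimes> inv g) [^] n \<in> N" if "g \<in> carrier G" "x \<in> carrier G" "x [^] n \<in> N" for g x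
    using conj_by_pow[of g x n] N.inv_op_closed2[OF that(1,3)] that by (simp add: conj_by_def)
  ultimately show ?thesis by (auto simp: normal_inv_iff)
qed

text \<open>Both sides count the union of the cosets that are \<open>n\<close>-torsion.\<close>

lemma torsion_count_quotient:
  assumes fin: "finite (carrier G)" and N: "N \<lhd> G"
  shows "torsion_count (G Mod N) n * card N = card {x \<in> carrier G. x [^] n \<in> N}"
proof -
  interpret N: normal N G by fact
  let ?T = "{B \<in> carrier (G Mod N). B [^]\<^bsub>G Mod N\<^esub> n = \<one>\<^bsub>G Mod N\<^esub>}"
  have car: "carrier (G Mod N) = rcosets N" by (simp add: FactGroup_def)
  have iff: "N #> z = N \<longleftrightarrow> z \<in> N" if "z \<in> carrier G" for z
    using coset_join2[OF that N.subgroup_axioms] rcos_self[OF that N.subgroup_axioms] by auto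
  have pw: "(N #> x) [^]\<^bsub>G Mod N\<^esub> n = N #> (x [^] n)" if "x \<in> carrier G" for x
    by (rule N.FactGroup_pow[OF that])
  have U: "\<Union>?T = {x \<in> carrier G. x [^] n \<in> N}"
  proof
    show "\<Union>?T \<subseteq> {x \<in> carrier G. x [^] n \<in> N}"
    proof
      fix x assume "x \<in> \<Union>?T"
      then obtain z where z: "z \<in> carrier G" "x \<in> N #> z" "(N #> z) [^]\<^bsub>G Mod N\<^esub> n = N"
        by (auto simp: carrier_FactGroup)
      have xc: "x \<in> carrier G" using z r_coset_subset_G[OF N.subset z(1)] by auto
      have "N #> x = N #> z" using repr_independence[OF z(2,1) N.subgroup_axioms] by simp
      then have "N #> (x [^] n) = N" using z(3) pw[OF xc] by simp
      then show "x \<in> {x \<in> carrier G. x [^] n \<in> N}" using iff xc by simp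
    qed
    show "{x \<in> carrier G. x [^] n \<in> N} \<subseteq> \<Union>?T"
    proof clarify
      fix x assume x: "x \<in> carrier G" "x [^] n \<in> N"
      then have "(N #> x) [^]\<^bsub>G Mod N\<^esub> n = N" using pw iff by simp
      then show "x \<in> \<Union>?T" using x rcos_self[OF x(1) N.subgroup_axioms] by (auto simp: carrier_FactGroup)
    qed
  qed
  have sub: "?T \<subseteq> rcosets N" using car by auto
  have finT: "finite ?T" by (rule finite_subset[OF sub]) (use fin in \<open>auto simp: RCOSETS_def\<close>)
  have "card N * card ?T = card (\<Union>?T)"
  proof (rule card_partition)
    show "finite (\<Union>?T)" unfolding U using fin by simp
    show "card B = card N" if "B \<in> ?T" for B
      by (rule card_rcosets_equal[OF subsetD[OF sub that] N.subset, symmetric])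
    show "B \<inter> B' = {}" if "B \<in> ?T" "B' \<in> ?T" "B \<noteq> B'" for B B'
      using pairwiseD[OF rcos_disjoint[OF N.subgroup_axioms] subsetD[OF sub that(1)] subsetD[OF sub that(2)] that(3)]
      by (simp only: disjnt_def)
  qed (rule finT)
  then show ?thesis unfolding torsion_count_def using U by (simp add: mult.commute)
qed

end

context ga_iso_pair
begin

text \<open>Every functional is constant on the cosets of the trivial group, so this compares the
  dimensions of the group algebras.\<close>

lemma order_le: "order H \<le> order G"
proof -
  have "pulls_back {\<one>} {\<one>\<^bsub>H\<^esub>}" by (simp add: pulls_back_def coset_const_def)
  then have "card (rcosets\<^bsub>H\<^esub> {\<one>\<^bsub>H\<^esub>}) \<le> card (rcosets\<^bsub>G\<^esub> {\<one>})"
    by (rule pulls_back_index[OF G.one_is_normal H.one_is_normal])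
  then show ?thesis
    using G.lagrange[OF G.triv_subgroup] H.lagrange[OF H.triv_subgroup] by simp
qed

lemma order_eq: "order G = order H"
proof -
  interpret S: ga_iso_pair H G \<psi> p by (rule iso_sym)
  show ?thesis using order_le S.order_le by simp
qed

lemma pulls_back_card_le:
  assumes "N \<lhd> G" "N' \<lhd> H" "pulls_back N N'"
  shows "card N \<le> card N'"
proof -
  have i: "card (rcosets\<^bsub>H\<^esub> N') \<le> card (rcosets\<^bsub>G\<^esub> N)" by (rule pulls_back_index[OF assms])
  have l: "card (rcosets\<^bsub>G\<^esub> N) * card N = order H" "card (rcosets\<^bsub>H\<^esub> N') * card N' = order H"
    using G.lagrange[OF normal_imp_subgroup[OF assms(1)]] H.lagrange[OF normal_imp_subgroup[OF assms(2)]] order_eq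
    by auto
  have "order H > 0" using H.order_gt_0_iff_finite by simp
  then have pos: "card (rcosets\<^bsub>H\<^esub> N') > 0" using l(2) by (cases "card (rcosets\<^bsub>H\<^esub> N')") auto
  have "card (rcosets\<^bsub>H\<^esub> N') * card N \<le> card (rcosets\<^bsub>H\<^esub> N') * card N'"
    using mult_le_mono1[OF i, of "card N"] l by simp
  then show ?thesis using pos by simp
qed

end

section \<open>Invariants of the centralizer of the commutator subgroup\<close>

lemma (in group) center_normal: "centralizer G (carrier G) \<lhd> G"
proof -
  have "subgroup (centralizer G (carrier G)) G" by (rule centralizer_subgroup) simp
  moreover have "g \<otimes> z \<otimes> inv g \<in> centralizer G (carrier G)"
    if "g \<in> carrier G" "z \<in> centralizer G (carrier G)" for g z
  proof -
    have "conj_by G g z = z" using that center_conj_by_iff[of z] by (auto simp: centralizer_def)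
    then show ?thesis using that(2) by (simp add: conj_by_def)
  qed
  ultimately show ?thesis by (simp add: normal_inv_iff)
qed

context cyclic_derived
begin

lemma C_normal: "C \<lhd> G"
proof -
  { fix g c assume g: "g \<in> carrier G" and c: "c \<in> C"
    obtain b where "b \<in> D" "conj_by G g c = c \<otimes> b" using conj_by_C[OF g c] by blast
    then have "conj_by G g c \<in> C" using subgroup.m_closed[OF C_subgroup c D_C] by simp }
  then show ?thesis using C_subgroup by (simp add: normal_inv_iff conj_by_def)
qed

lemma ZD_normal: "Z <#> D \<lhd> G"
  by (rule normal_subgroup_set_mult_closed[OF center_normal derived_self_is_normal])

lemma D_ZD: "D \<subseteq> Z <#> D"
proof
  fix d assume d: "d \<in> D"
  have "d = \<one> \<otimes> d" using D_carrier[OF d] by simp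
  then show "d \<in> Z <#> D" unfolding set_mult_def using d subgroup.one_closed[OF Z_subgroup] by blast
qed

definition Omega :: "nat \<Rightarrow> nat \<Rightarrow> 'a set" where
  "Omega m k = {x \<in> carrier G. x [^] (p ^ k) \<in> Dpow m}"

lemma C_Int_Omega: "C \<inter> Omega m k = {x \<in> C. x [^] (p ^ k) \<in> Dpow m}"
  using C_carrier by (auto simp: Omega_def)

abbreviation "K \<equiv> G\<lparr>carrier := C\<rparr>"

lemma K_group: "group K" by (rule subgroup_imp_group[OF C_subgroup])

lemma derived_K: "derived K (carrier K) = derived G C"
  using derived_consistent[OF _ C_subgroup, of C] by simp

lemma derived_C_D: "derived G C \<subseteq> D"
  by (rule mono_derived) (use C_carrier in auto)

lemma normal_K: "N \<lhd> G \<Longrightarrow> N \<subseteq> C \<Longrightarrow> N \<lhd> K"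
  by (rule normal_restrict_supergroup[OF C_subgroup])

lemma torsion_count_K_quotient:
  assumes "N \<lhd> G" "N \<subseteq> C"
  shows "torsion_count (K Mod N) m * card N = card {x \<in> C. x [^] m \<in> N}"
proof -
  interpret K: group K by (rule K_group)
  have "finite (carrier K)" using fin C_carrier by (auto intro: finite_subset[of _ "carrier G"])
  then show ?thesis using K.torsion_count_quotient[OF _ normal_K[OF assms]] by (simp add: nat_pow_consistent[symmetric])
qed

lemma K_quotient_p_group:
  assumes "N \<lhd> G" "N \<subseteq> C" "derived G C \<subseteq> N"
  shows "comm_group (K Mod N)" "\<exists>M. order (K Mod N) = p ^ M"
proof -
  interpret K: group K by (rule K_group)
  show "comm_group (K Mod N)"
    by (rule K.comm_group_quotient[OF normal_K[OF assms(1,2)]]) (use assms(3) derived_K in simp)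
  obtain M where M: "order G = p ^ M" using p_group by blast
  have "order (K Mod N) * card N = card C"
    using K.lagrange[OF normal_imp_subgroup[OF normal_K[OF assms(1,2)]]] by (simp add: order_def FactGroup_def)
  then have "order (K Mod N) dvd card C" by (metis dvd_triv_left)
  also have "card C dvd p ^ M" using lagrange[OF C_subgroup] M by (metis dvd_triv_right)
  finally show "\<exists>M. order (K Mod N) = p ^ M" using p by (auto simp: divides_primepow_nat)
qed

end

context cyclic_derived_gen
begin

lemma card_D: "card D = p ^ n" using card_Dpow[of 0] Dpow_0 by simp

lemma Omega_normal: "m \<le> k \<Longrightarrow> Omega m k \<lhd> G"
  unfolding Omega_def by (rule pow_preimage_normal[OF fin Dpow_normal pow_hom_mod(1)])

text \<open>Dividing by suitable elements of \<open>D\<close> shows that \<open>C \<inter> Omega k k\<close> is the product of \<open>D\<close>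
  with the subgroup counted on the left.\<close>
lemma card_pow_in_derived_C:
  assumes ks: "k \<le> n - e"
  shows "card {x \<in> C. x [^] (p ^ k) \<in> Dpow (n - e)} * p ^ n = card (C \<inter> Omega k k) * p ^ (n - (n - e - k))"
proof -
  let ?s = "n - e" and ?P = "p ^ k"
  define V where "V = {x \<in> C. x [^] ?P \<in> Dpow ?s}"
  interpret K: group K by (rule K_group)
  have finC: "finite (carrier K)" using fin C_carrier by (auto intro: finite_subset[of _ "carrier G"])
  have sub: "Dpow ?s \<subseteq> C" using Dpow_D D_C by blast
  have "{x \<in> carrier K. x [^]\<^bsub>K\<^esub> ?P \<in> Dpow ?s} \<lhd> K"
    by (rule K.pow_preimage_normal[OF finC normal_K[OF Dpow_normal sub]])
      (rule K.coset_pow_mult_derived[OF normal_K[OF Dpow_normal sub]], use derived_K derived_C in auto)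
  then have "subgroup V K" using normal_imp_subgroup by (auto simp: V_def nat_pow_consistent[symmetric])
  then have sV: "subgroup V G" by (rule incl_subgroup[OF C_subgroup])
  have dP: "(x \<otimes> d) [^] ?P = x [^] ?P \<otimes> d [^] ?P" if "x \<in> C" "d \<in> D" for x d
    by (rule pow_mult_distrib[OF C_D_commute[OF that] C_carrier[OF that(1)] D_carrier[OF that(2)]])
  have "V <#> D = C \<inter> Omega k k"
    unfolding C_Int_Omega
  proof
    show "V <#> D \<subseteq> {x \<in> C. x [^] ?P \<in> Dpow k}"
    proof
      fix y assume "y \<in> V <#> D"
      then obtain x d where xd: "x \<in> C" "x [^] ?P \<in> Dpow ?s" "d \<in> D" "y = x \<otimes> d" by (auto simp: set_mult_def V_def)
      obtain z where z: "x [^] ?P = z [^] (p ^ ?s)" "z \<in> D" using xd(2) by (auto simp: Dpow_def)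
      have "x [^] ?P \<in> Dpow k" unfolding z(1) by (rule D_pow_Dpow[OF z(2) le_imp_power_dvd[OF ks]]) simp
      moreover have "d [^] ?P \<in> Dpow k" using xd(3) by (auto simp: Dpow_def)
      ultimately have "y [^] ?P \<in> Dpow k" unfolding xd(4) dP[OF xd(1,3)] by (rule subgroup.m_closed[OF Dpow_subgroup])
      then show "y \<in> {x \<in> C. x [^] ?P \<in> Dpow k}" using xd subgroup.m_closed[OF C_subgroup xd(1) D_C[OF xd(3)]] by simp
    qed
    show "{x \<in> C. x [^] ?P \<in> Dpow k} \<subseteq> V <#> D"
    proof
      fix y assume "y \<in> {x \<in> C. x [^] ?P \<in> Dpow k}"
      \<comment> \<open>\<open>y\<close> and \<open>d\<close> commute and have the same power, so
        the quotient of \<open>y\<close> by \<open>d\<close> has trivial power and belongs to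
        \<open>V\<close>.\<close>
      then obtain d where d: "y \<in> C" "d \<in> D" "y [^] ?P = d [^] ?P" by (auto simp: Dpow_def)
      note cc = C_carrier[OF d(1)] D_carrier[OF d(2)]
      have iD: "inv d \<in> D" by (rule subgroup.m_inv_closed[OF D_subgroup d(2)])
      have "(y \<otimes> inv d) [^] ?P = d [^] ?P \<otimes> inv d [^] ?P" using dP[OF d(1) iD] d(3) by simp
      also have "\<dots> = (d \<otimes> inv d) [^] ?P" using dP[OF D_C[OF d(2)] iD] by simp
      also have "\<dots> = \<one>" using cc by simp
      finally have "y \<otimes> inv d \<in> V"
        using subgroup.m_closed[OF C_subgroup d(1) D_C[OF iD]] subgroup.one_closed[OF Dpow_subgroup] by (simp add: V_def)
      moreover have "y = (y \<otimes> inv d) \<otimes> d" using cc by (simp add: m_assoc)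
      ultimately show "y \<in> V <#> D" unfolding set_mult_def using d(2) by blast
    qed
  qed
  moreover have "V \<inter> D = Dpow (?s - k)"
  proof
    have ex: "p ^ ?s dvd p ^ n" by (rule le_imp_power_dvd) simp
    have ps: "p ^ ?s = p ^ (?s - k) * p ^ k" using ks by (metis le_add_diff_inverse2 power_add)
    show "V \<inter> D \<subseteq> Dpow (?s - k)"
    proof
      fix x assume x: "x \<in> V \<inter> D"
      then obtain i where i: "x = a [^] (i::nat)" using derived_eq by auto
      have "x [^] ?P \<in> Dpow ?s" using x by (simp add: V_def)
      then obtain j where "a [^] (i * ?P) = a [^] (p ^ ?s * j)" unfolding Dpow_eq i by (auto simp: nat_pow_pow)
      then have "i * ?P mod p ^ n = p ^ ?s * j mod p ^ n" by (simp only: a_pow_eq_iff)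
      then have "i * ?P mod p ^ ?s = p ^ ?s * j mod p ^ ?s" using ex by (metis mod_mod_cancel)
      then have "p ^ ?s dvd i * ?P" by (simp add: dvd_eq_mod_eq_0)
      then have "p ^ (?s - k) dvd i" unfolding ps using p1 by simp
      then obtain l where "i = p ^ (?s - k) * l" unfolding dvd_def by blast
      then show "x \<in> Dpow (?s - k)" unfolding Dpow_eq i by blast
    qed
    show "Dpow (?s - k) \<subseteq> V \<inter> D"
    proof
      fix x assume x: "x \<in> Dpow (?s - k)"
      then obtain z where z: "z \<in> D" "x = z [^] (p ^ (?s - k))" by (auto simp: Dpow_def)
      have "x [^] ?P = z [^] (p ^ ?s)" using z D_carrier by (simp add: nat_pow_pow ps)
      then have "x [^] ?P \<in> Dpow ?s" using z(1) by (auto simp: Dpow_def)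
      then show "x \<in> V \<inter> D" using Dpow_D[OF x] D_C by (simp add: V_def)
    qed
  qed
  moreover note card_D
  moreover have "card (Dpow (?s - k)) = p ^ (n - (?s - k))" by (rule card_Dpow) simp
  ultimately show ?thesis using card_set_mult[OF fin sV D_subgroup] by (simp add: V_def)
qed

text \<open>This recovers \<open>e\<close> from the orders of \<open>Z\<close>, \<open>D\<close> and
  \<open>Z <#> D\<close>.\<close>

lemma card_ZD: "card (Z <#> D) * p ^ e = card Z * p ^ n"
proof -
  have "card (Z \<inter> D) = p ^ e" unfolding Z_Int_D using card_Dpow[of "n - e"] en by simp
  then show ?thesis using card_set_mult[OF fin Z_subgroup D_subgroup] card_D by simp
qed

end

section \<open>Two groups with isomorphic group algebras, with common \<open>n\<close> and
  \<open>e\<close>\<close>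

locale cyclic_pair = ga_iso_pair G H \<phi> p +
  GG: cyclic_derived_gen G p n a g0 r e t + HH: cyclic_derived_gen H p n b h0 r' e t'
  for G (structure) and H (structure) and \<phi> :: "('a \<Rightarrow> 'k::field) \<Rightarrow> ('c \<Rightarrow> 'k)"
    and p n e a g0 r t b h0 r' t'
begin

lemma pair_sym: "cyclic_pair H G \<psi> p n e b h0 r' t' a g0 r t"
  by (rule cyclic_pair.intro[OF iso_sym HH.cyclic_derived_gen_axioms GG.cyclic_derived_gen_axioms])

lemma pulls_back_Dpow: "pulls_back (GG.Dpow m) (HH.Dpow m)"
  unfolding pulls_back_def GG.kills_prime_power_iff[OF char, symmetric] HH.kills_prime_power_iff[OF char, symmetric]
  using pull_kills by blast

lemma pulls_back_Omega: "m \<le> k \<Longrightarrow> pulls_back (GG.Omega m k) (HH.Omega m k)"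
  unfolding GG.Omega_def HH.Omega_def
  by (rule pulls_back_power_preimage[OF GG.Dpow_normal HH.Dpow_normal pulls_back_Dpow
    GG.pow_hom_mod(1) HH.pow_hom_mod(1) HH.pow_hom_mod(2)])

lemma pulls_back_ZD: "pulls_back (GG.Z <#> GG.D) (HH.Z <#>\<^bsub>H\<^esub> HH.D)"
  unfolding pulls_back_def using pull_center_derived by blast

lemma pulls_back_C: "pulls_back GG.C HH.C"
  unfolding GG.C_eq_pow HH.C_eq_pow
  by (rule pulls_back_power_preimage[OF GG.ZD_normal HH.ZD_normal pulls_back_ZD
    G.coset_pow_mult_derived[OF GG.ZD_normal GG.D_ZD] H.coset_pow_mult_derived[OF HH.ZD_normal HH.D_ZD]
    H.coset_commute_derived[OF HH.ZD_normal HH.D_ZD _ _]]) auto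

lemma card_C_le: "card GG.C \<le> card HH.C"
  by (rule pulls_back_card_le[OF GG.C_normal HH.C_normal pulls_back_C])

lemma card_Omega_le: "m \<le> k \<Longrightarrow> card (GG.Omega m k) \<le> card (HH.Omega m k)"
  by (rule pulls_back_card_le[OF GG.Omega_normal HH.Omega_normal pulls_back_Omega])

lemma card_C_Omega_le:
  assumes "m \<le> k"
  shows "card (GG.C <#> GG.Omega m k) \<le> card (HH.C <#>\<^bsub>H\<^esub> HH.Omega m k)"
proof (rule pulls_back_card_le)
  note O = GG.Omega_normal[OF assms] HH.Omega_normal[OF assms]
  show "GG.C <#> GG.Omega m k \<lhd> G" by (rule G.normal_subgroup_set_mult_closed[OF GG.C_normal O(1)])
  show "HH.C <#>\<^bsub>H\<^esub> HH.Omega m k \<lhd> H" by (rule H.normal_subgroup_set_mult_closed[OF HH.C_normal O(2)])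
  show "pulls_back (GG.C <#> GG.Omega m k) (HH.C <#>\<^bsub>H\<^esub> HH.Omega m k)"
    by (rule pulls_back_mult[OF GG.C_subgroup normal_imp_subgroup[OF O(1)] HH.C_subgroup normal_imp_subgroup[OF O(2)]
      pulls_back_C pulls_back_Omega[OF assms]])
qed

text \<open>The intersection is not compared directly: \<open>C\<close>, \<open>Omega m k\<close>
  and their product have equal orders in both groups, and the product formula gives the
  rest.\<close>

lemma card_C_Int_Omega:
  assumes "m \<le> k"
  shows "card (GG.C \<inter> GG.Omega m k) = card (HH.C \<inter> HH.Omega m k)"
proof -
  interpret S: cyclic_pair H G \<psi> p n e b h0 r' t' a g0 r t by (rule pair_sym)
  note G_prod = G.card_set_mult[OF G.fin GG.C_subgroup normal_imp_subgroup[OF GG.Omega_normal[OF assms]]]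
  note H_prod = H.card_set_mult[OF H.fin HH.C_subgroup normal_imp_subgroup[OF HH.Omega_normal[OF assms]]]
  have eq: "card GG.C = card HH.C" "card (GG.Omega m k) = card (HH.Omega m k)"
    "card (GG.C <#> GG.Omega m k) = card (HH.C <#>\<^bsub>H\<^esub> HH.Omega m k)"
    using card_C_le S.card_C_le card_Omega_le[OF assms] S.card_Omega_le[OF assms]
      card_C_Omega_le[OF assms] S.card_C_Omega_le[OF assms] by auto
  have "GG.C <#> GG.Omega m k \<noteq> {}"
    using subgroup.one_closed[OF GG.C_subgroup]
      subgroup.one_closed[OF normal_imp_subgroup[OF GG.Omega_normal[OF assms]]] by (auto simp: set_mult_def)
  moreover have "finite (GG.C <#> GG.Omega m k)"
    by (rule finite_subset[OF G.set_mult_closed G.fin]) (use GG.C_carrier in \<open>auto simp: GG.Omega_def\<close>)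
  ultimately have "card (GG.C <#> GG.Omega m k) > 0" by (simp add: card_gt_0_iff)
  then show ?thesis using G_prod H_prod eq by (metis mult_left_cancel not_less_zero)
qed

lemma card_C_eq: "card GG.C = card HH.C"
proof -
  interpret S: cyclic_pair H G \<psi> p n e b h0 r' t' a g0 r t by (rule pair_sym)
  show ?thesis using card_C_le S.card_C_le by simp
qed

lemma quotient_by_derived_iso: "GG.K Mod GG.D \<cong> HH.K Mod HH.D"
proof -
  have sub: "GG.D \<subseteq> GG.C" "HH.D \<subseteq> HH.C" using GG.D_C HH.D_C by auto
  note nG = G.derived_self_is_normal and nH = H.derived_self_is_normal
  obtain M where M: "order (GG.K Mod GG.D) = p ^ M" using GG.K_quotient_p_group(2)[OF nG sub(1) GG.derived_C_D] by blast
  obtain M' where M': "order (HH.K Mod HH.D) = p ^ M'" using HH.K_quotient_p_group(2)[OF nH sub(2) HH.derived_C_D] by blast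
  show ?thesis
  proof (rule abelian_p_groups_isomorphic[OF _ _ p M M'])
    fix k
    have "torsion_count (GG.K Mod GG.D) (p ^ k) * card GG.D = torsion_count (HH.K Mod HH.D) (p ^ k) * card HH.D"
      unfolding GG.torsion_count_K_quotient[OF nG sub(1)] HH.torsion_count_K_quotient[OF nH sub(2)]
      using card_C_Int_Omega[of 0 k] GG.C_Int_Omega[of 0 k] HH.C_Int_Omega[of 0 k]
      by (simp add: GG.Dpow_0 HH.Dpow_0)
    then show "torsion_count (GG.K Mod GG.D) (p ^ k) = torsion_count (HH.K Mod HH.D) (p ^ k)"
      using p1 by (simp add: GG.card_D HH.card_D)
  qed (rule GG.K_quotient_p_group(1)[OF nG sub(1) GG.derived_C_D], rule HH.K_quotient_p_group(1)[OF nH sub(2) HH.derived_C_D])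
qed

lemma abelianization_iso: "GG.K Mod derived GG.K (carrier GG.K) \<cong> HH.K Mod derived HH.K (carrier HH.K)"
proof -
  let ?s = "n - e"
  have sub: "GG.Dpow ?s \<subseteq> GG.C" "HH.Dpow ?s \<subseteq> HH.C"
    using GG.Dpow_D GG.D_C HH.Dpow_D HH.D_C by blast+
  have d: "derived G GG.C \<subseteq> GG.Dpow ?s" "derived H HH.C \<subseteq> HH.Dpow ?s" using GG.derived_C HH.derived_C by auto
  note nG = GG.Dpow_normal[of ?s] and nH = HH.Dpow_normal[of ?s]
  obtain M where M: "order (GG.K Mod GG.Dpow ?s) = p ^ M" using GG.K_quotient_p_group(2)[OF nG sub(1) d(1)] by blast
  obtain M' where M': "order (HH.K Mod HH.Dpow ?s) = p ^ M'" using HH.K_quotient_p_group(2)[OF nH sub(2) d(2)] by blast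
  have "GG.K Mod GG.Dpow ?s \<cong> HH.K Mod HH.Dpow ?s"
  proof (rule abelian_p_groups_isomorphic[OF _ _ p M M'])
    fix k
    have "card {x \<in> GG.C. x [^] (p ^ k) \<in> GG.Dpow ?s} = card {x \<in> HH.C. x [^]\<^bsub>H\<^esub> (p ^ k) \<in> HH.Dpow ?s}"
    \<comment> \<open>For \<open>k\<close> below \<open>?s\<close> this set is not covered by
      \<open>card_C_Int_Omega\<close>, which needs \<open>m \<le> k\<close>; its size is expressed
      through the case \<open>m = k\<close>.\<close>
    proof (cases "?s \<le> k")
      case True
      then show ?thesis using card_C_Int_Omega[of ?s k] GG.C_Int_Omega[of ?s k] HH.C_Int_Omega[of ?s k] by simp
    next
      case False
      then have "k \<le> ?s" by simp
      then have "card {x \<in> GG.C. x [^] (p ^ k) \<in> GG.Dpow ?s} * p ^ n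
        = card {x \<in> HH.C. x [^]\<^bsub>H\<^esub> (p ^ k) \<in> HH.Dpow ?s} * p ^ n"
        using GG.card_pow_in_derived_C[of k] HH.card_pow_in_derived_C[of k] card_C_Int_Omega[of k k] by simp
      then show ?thesis using p1 by simp
    qed
    then have "torsion_count (GG.K Mod GG.Dpow ?s) (p ^ k) * card (GG.Dpow ?s)
      = torsion_count (HH.K Mod HH.Dpow ?s) (p ^ k) * card (HH.Dpow ?s)"
      unfolding GG.torsion_count_K_quotient[OF nG sub(1)] HH.torsion_count_K_quotient[OF nH sub(2)] .
    then show "torsion_count (GG.K Mod GG.Dpow ?s) (p ^ k) = torsion_count (HH.K Mod HH.Dpow ?s) (p ^ k)"
      using p1 GG.card_Dpow[of ?s] HH.card_Dpow[of ?s] by simp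
  qed (rule GG.K_quotient_p_group(1)[OF nG sub(1) d(1)], rule HH.K_quotient_p_group(1)[OF nH sub(2) d(2)])
  then show ?thesis unfolding GG.derived_K HH.derived_K GG.derived_C HH.derived_C .
qed

text \<open>Only the \<open>p\<close>-part \<open>p ^ k\<close> of \<open>N\<close> matters. Since
  \<open>a\<close> lies in \<open>C\<close>, it follows that \<open>n \<le> k\<close>. As
  \<open>Dpow n\<close> is trivial, comparing the sets \<open>C \<inter> Omega n k\<close> compares
  the elements of \<open>C\<close> killed by \<open>p ^ k\<close>.\<close>

lemma exponent_transfer:
  assumes N: "N > 0" and G: "\<And>x. x \<in> GG.C \<Longrightarrow> x [^] (N::nat) = \<one>" and y: "y \<in> HH.C"
  shows "y [^]\<^bsub>H\<^esub> N = \<one>\<^bsub>H\<^esub>"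
proof -
  define k where "k = multiplicity p N"
  have unit: "\<not> is_unit p" using p1 by simp
  have "a [^] (1::nat) \<in> GG.C" by (rule GG.D_C[OF GG.a_pow_D])
  then have "a [^] N = \<one>" using G by simp
  then have nk: "n \<le> k" unfolding k_def GG.a_pow_one_iff using power_dvd_iff_le_multiplicity[of N p n] N unit by simp
  have "x [^] (p ^ k) = \<one>" if x: "x \<in> GG.C" for x
  proof -
    have xc: "x \<in> carrier G" using GG.C_carrier[OF x] .
    obtain M where "order G = p ^ M" using pG by blast
    then have "G.ord x dvd p ^ M" using G.ord_dvd_group_order[OF xc] by simp
    then obtain i where i: "G.ord x = p ^ i" using p divides_primepow_nat by blast
    have "p ^ i dvd N" using G[OF x] G.pow_eq_id[OF xc] i by simp
    then have "i \<le> k" unfolding k_def using power_dvd_iff_le_multiplicity[of N p i] N unit by simp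
    then show ?thesis using G.pow_eq_id[OF xc] i by (simp add: le_imp_power_dvd)
  qed
  then have "GG.C \<inter> GG.Omega n k = GG.C" unfolding GG.C_Int_Omega GG.Dpow_ge_n[OF order_refl] by auto
  then have "card (HH.C \<inter> HH.Omega n k) = card HH.C" using card_C_Int_Omega[OF nk] card_C_eq by simp
  moreover have "finite HH.C" using HH.C_carrier by (auto intro: finite_subset[OF _ H.fin])
  ultimately have "HH.C \<inter> HH.Omega n k = HH.C" by (intro card_subset_eq) auto
  then have "y \<in> HH.Omega n k" using y by blast
  then have yk: "y [^]\<^bsub>H\<^esub> (p ^ k) = \<one>\<^bsub>H\<^esub>" by (simp add: HH.Omega_def HH.Dpow_ge_n[OF order_refl])
  have "p ^ k dvd N" unfolding k_def by (rule multiplicity_dvd)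
  then obtain j where "N = p ^ k * j" unfolding dvd_def by blast
  then have "y [^]\<^bsub>H\<^esub> N = (y [^]\<^bsub>H\<^esub> (p ^ k)) [^]\<^bsub>H\<^esub> j" using HH.C_carrier[OF y] by (simp add: H.nat_pow_pow)
  then show ?thesis using yk by simp
qed

lemma exponent_eq: "group_exponent GG.K = group_exponent HH.K"
proof -
  interpret S: cyclic_pair H G \<psi> p n e b h0 r' t' a g0 r t by (rule pair_sym)
  have "(0 < N \<and> (\<forall>x\<in>GG.C. x [^] N = \<one>)) \<longleftrightarrow> (0 < N \<and> (\<forall>y\<in>HH.C. y [^]\<^bsub>H\<^esub> N = \<one>\<^bsub>H\<^esub>))" for N :: nat
    using exponent_transfer[of N] S.exponent_transfer[of N] by blast
  then show ?thesis unfolding group_exponent_def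
    by (simp add: G.nat_pow_consistent[symmetric] H.nat_pow_consistent[symmetric])
qed

end

lemma cyclic_derivedI:
  fixes G (structure)
  assumes "Factorial_Ring.prime p" "odd p" "finite_group G" "\<exists>N. order G = p ^ N"
    and a: "a \<in> carrier G" and D: "derived G (carrier G) = {a [^] i | i :: nat. True}"
  shows "\<exists>n. cyclic_derived G p n a"
proof -
  interpret finite_group G by fact
  obtain N where "order G = p ^ N" using assms(4) by blast
  then have "ord a dvd p ^ N" using ord_dvd_group_order[OF a] by simp
  then obtain n where "ord a = p ^ n" using assms(1) divides_primepow_nat by blast
  then have "cyclic_derived G p n a" using assms by unfold_locales auto
  then show ?thesis by blast
qed

lemma (in cyclic_derived) ex_cyclic_derived_gen:
  "\<exists>g0 r e t. cyclic_derived_gen G p n a g0 r e t"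
proof -
  obtain g0 r e t where "g0 \<in> carrier G \<and> conj_by G g0 a = a [^] r \<and> r = 1 + p ^ e * t \<and> r mod p = 1 mod p
    \<and> e \<le> n \<and> (e < n \<longrightarrow> coprime t p) \<and> (\<forall>g\<in>carrier G. \<exists>c\<in>C. \<exists>v::nat. g = c \<otimes> g0 [^] v)"
    using ex_action_generator by blast
  then have "cyclic_derived_gen G p n a g0 r e t" by unfold_locales blast+
  then show ?thesis by blast
qed

text \<open>The data of the two groups are chosen independently; equality of the invariant orders
  then shows that \<open>n\<close> and \<open>e\<close> agree.\<close>

lemma (in ga_iso_pair) ex_cyclic_pair:
  assumes a: "a \<in> carrier G" and D: "derived G (carrier G) = {a [^] i | i :: nat. True}"
  shows "\<exists>n e g0 r t b h0 r' t'. cyclic_pair G H \<phi> p n e a g0 r t b h0 r' t'"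
proof -
  interpret S: ga_iso_pair H G \<psi> p by (rule iso_sym)
  obtain b where b: "b \<in> carrier H" "derived H (carrier H) = {b [^]\<^bsub>H\<^esub> i | i :: nat. True}"
    using derived_cyclic[OF a D] by blast
  obtain n where nG: "cyclic_derived G p n a"
    using cyclic_derivedI[OF p podd G.finite_group_axioms pG a D] by blast
  then obtain g0 r e t where GG: "cyclic_derived_gen G p n a g0 r e t"
    using cyclic_derived.ex_cyclic_derived_gen[OF nG] by blast
  obtain n' where nH: "cyclic_derived H p n' b"
    using cyclic_derivedI[OF p podd H.finite_group_axioms pH b] by blast
  then obtain h0 r' e' t' where HH: "cyclic_derived_gen H p n' b h0 r' e' t'"
    using cyclic_derived.ex_cyclic_derived_gen[OF nH] by blast
  interpret GG: cyclic_derived_gen G p n a g0 r e t by (rule GG)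
  interpret HH: cyclic_derived_gen H p n' b h0 r' e' t' by (rule HH)
  have "card GG.D = card HH.D"
    using pulls_back_card_le[OF G.derived_self_is_normal H.derived_self_is_normal pulls_back_derived]
      S.pulls_back_card_le[OF H.derived_self_is_normal G.derived_self_is_normal S.pulls_back_derived] by simp
  then have n: "n' = n" using GG.card_D HH.card_D p1 by simp
  have "pulls_back (GG.Z <#> GG.D) (HH.Z <#>\<^bsub>H\<^esub> HH.D)" "S.pulls_back (HH.Z <#>\<^bsub>H\<^esub> HH.D) (GG.Z <#> GG.D)"
    unfolding pulls_back_def S.pulls_back_def using pull_center_derived S.pull_center_derived by blast+
  then have ZD: "card (GG.Z <#> GG.D) = card (HH.Z <#>\<^bsub>H\<^esub> HH.D)"
    using pulls_back_card_le[OF GG.ZD_normal HH.ZD_normal] S.pulls_back_card_le[OF HH.ZD_normal GG.ZD_normal]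
    by (simp add: le_antisym)
  have Z: "card GG.Z = card HH.Z" using card_center_le S.card_center_le by simp
  have "card (GG.Z <#> GG.D) > 0"
  proof -
    have "card GG.Z > 0" using subgroup.one_closed[OF GG.Z_subgroup] GG.fin
      by (auto simp: card_gt_0_iff centralizer_def)
    then show ?thesis using GG.card_ZD p1 by (cases "card (GG.Z <#> GG.D)") auto
  qed
  \<comment> \<open>The orders of \<open>Z\<close>, \<open>D\<close> and \<open>Z <#> D\<close>
    agree, so the two instances of \<open>card_ZD\<close> force equal powers of
    \<open>p\<close>.\<close>
  then have "e' = e" using GG.card_ZD HH.card_ZD ZD Z n p1
    by (metis mult_left_cancel not_less_zero power_inject_exp)
  then have "cyclic_pair G H \<phi> p n e a g0 r t b h0 r' t'"
    using cyclic_pair.intro[OF ga_iso_pair_axioms GG] HH n by simp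
  then show ?thesis by blast
qed

theorem theoremA:
  fixes G :: "('a, 'b) monoid_scheme" and H :: "('c, 'd) monoid_scheme" and p :: nat
  assumes "Factorial_Ring.prime p" and "odd p"
    and "CHAR('k::field) = p"
    and "finite_p_group p G" and "finite_p_group p H"
    and "group_algebras_isomorphic TYPE('k) G H"
    and "cyclic_subgroup G (commutator_subgroup G)"
  shows "group_exponent (cent_comm_group G) = group_exponent (cent_comm_group H)
    \<and> (cent_comm_group G Mod commutator_subgroup G \<cong>
         cent_comm_group H Mod commutator_subgroup H)
    \<and> (cent_comm_group G Mod commutator_subgroup (cent_comm_group G) \<cong>
         cent_comm_group H Mod commutator_subgroup (cent_comm_group H))"
proof -
  obtain \<phi> :: "('a \<Rightarrow> 'k) \<Rightarrow> ('c \<Rightarrow> 'k)" where \<phi>: "ga_iso G H \<phi>"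
    using assms(6) by (auto simp: group_algebras_isomorphic_def)
  interpret G: group G using assms(4) by (simp add: finite_p_group_def)
  interpret H: group H using assms(5) by (simp add: finite_p_group_def)
  have fin: "finite (carrier G)" "finite (carrier H)" using assms(4,5) by (auto simp: finite_p_group_def)
  interpret ga_iso_pair G H \<phi> p
    using assms \<phi> fin by unfold_locales (auto simp: finite_p_group_def)
  obtain a where a: "a \<in> carrier G" "commutator_subgroup G = generate G {a}"
    using assms(7) by (auto simp: cyclic_subgroup_def)
  \<comment> \<open>In a finite group the natural powers of \<open>a\<close> already form a
    subgroup, so inverses add nothing.\<close>
  have "generate G {a} = {a [^]\<^bsub>G\<^esub> i | i :: nat. True}"
  proof
    have "a [^]\<^bsub>G\<^esub> (1::nat) \<in> {a [^]\<^bsub>G\<^esub> i | i :: nat. True}" by blast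
    then show "generate G {a} \<subseteq> {a [^]\<^bsub>G\<^esub> i | i :: nat. True}"
      using a by (intro G.generate_subgroup_incl G.powers_subgroup[OF fin(1)]) auto
    show "{a [^]\<^bsub>G\<^esub> i | i :: nat. True} \<subseteq> generate G {a}"
      using G.subgroup_pow_closed[OF G.generate_is_subgroup[of "{a}"]] a generate.incl[of a "{a}" G] by auto
  qed
  then obtain n e g0 r t b h0 r' t' where pair: "cyclic_pair G H \<phi> p n e a g0 r t b h0 r' t'"
    using ex_cyclic_pair[OF a(1)] a(2) by metis
  interpret cyclic_pair G H \<phi> p n e a g0 r t b h0 r' t' by (rule pair)
  show ?thesis
    using exponent_eq quotient_by_derived_iso abelianization_iso by (simp add: cent_comm_group_def)
qed

end
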